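(* Let $T$ be a homeomorphism of a compact topological space $X$, let $(V,|\cdot|)$ be a Banach space, let $k\ge 1$ be an integer with $k\le \dim V$, and let $A\colon X\times\mathbb{N}\to L(V)$, $(x,n)\mapsto A_x^n$, be a continuous cocycle over $T$ of injective bounded linear operators. Then the following two statements are equivalent: (1) There exist constants $K>0$ and $\tau\in(0,1)$ such that $$\max\{c_{k+1}(A_x^n),\,c_{k+1}(A_{Tx}^n)\}<K\tau^n\,c_k(A_x^{n+1})$$ for all $x\in X$ and $n\ge 1$. (2) There exist a continuous equivariant splitting $V=\mathcal{E}(x)\oplus\mathcal{F}(x)$ $(x\in X)$, for which $\dim\mathcal{E}(x)=k<\infty$ for all $x\in X$, and constants $K>0$, $\tau\in(0,1)$ such that $$\sup_{\substack{u\in\mathcal{E}(x),\,v\in\mathcal{F}(x)\\ |u|=|v|=1}}\frac{|A_x^nv|}{|A_x^nu|}\le K\tau^n$$ for every $x\in X$ and $n\ge 1$.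
   Context: $L(V)$ is the space of bounded linear operators on $V$ with operator norm $|\cdot|$. A cocycle over $T$ is a map $A\colon X\times\mathbb{N}\to L(V)$ ($\mathbb{N}$ includes $0$) with $A_x^0=\mathrm{Id}_V$ and $A_x^{n+m}=A_{T^mx}^nA_x^m$ for all $x\in X$, $n,m\ge0$; it is continuous if $x\mapsto A_x^n$ is continuous in the operator norm for each $n$. Gelfand numbers: for an integer $q\ge1$, $c_q(B)=\inf\{|B|_F| : F\subset V \text{ a closed subspace of codimension } q-1\}$. $\mathcal{G}(V)$ is the set of closed subspaces of $V$ with the Hausdorff metric $d_H(E,E')=\max\{\sup_{e\in S_E}d(e,S_{E'}),\ \sup_{e'\in S_{E'}}d(e',S_E)\}$, where $S_E=\{v\in E:|v|=1\}$ (and $d_H(\{0\},\{0\})=0$). A continuous equivariant splitting is a pair of continuous maps $\mathcal{E},\mathcal{F}\colon X\to\mathcal{G}(V)$ with $V=\mathcal{E}(x)\oplus\mathcal{F}(x)$, $A_x^n\mathcal{E}(x)=\mathcal{E}(T^nx)$ and $A_x^n\mathcal{F}(x)\subseteq\mathcal{F}(T^nx)$ for all $x\in X$, $n\ge1$. *)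

theory Defs
  imports "HOL-Analysis.Analysis"
begin

text \<open>The library's \<^const>\<open>dim\<close> is natural-number valued and returns 0 on
  infinite-dimensional spaces, hence the following extended version.\<close>

definition edim :: "'v::real_vector set \<Rightarrow> enat" where
  "edim S = (if \<exists>B. finite B \<and> S \<subseteq> span B then enat (dim S) else \<infinity>)"

definition complementary :: "'v::real_vector set \<Rightarrow> 'v set \<Rightarrow> bool" where
  "complementary E F \<longleftrightarrow> subspace E \<and> subspace F \<and> E \<inter> F = {0} \<and> (\<forall>v. \<exists>e\<in>E. \<exists>f\<in>F. v = e + f)"

text \<open>The codimension of \<open>F\<close> is the dimension of the quotient by \<open>F\<close>, that is, of any
  algebraic complement of \<open>F\<close>.\<close>

definition has_codim :: "'v::real_vector set \<Rightarrow> nat \<Rightarrow> bool" where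
  "has_codim F m \<longleftrightarrow> (\<exists>W. complementary W F \<and> edim W = enat m)"

text \<open>The operator norm of the restriction of \<open>B\<close> to \<open>F\<close>, in the style of \<^const>\<open>onorm\<close>;
  the vector 0 contributes the value 0, so that the norm on the zero subspace is 0.\<close>

definition norm_on :: "'v::real_normed_vector set \<Rightarrow> ('v \<Rightarrow>\<^sub>L 'v) \<Rightarrow> real" where
  "norm_on F B = (SUP v\<in>F. norm (blinfun_apply B v) / norm v)"

text \<open>Only meaningful for \<open>1 \<le> q\<close> and when a closed subspace of codimension \<open>q - 1\<close> exists,
  that is, when \<open>q - 1\<close> does not exceed the dimension of the space.\<close>

definition gelfand_number :: "nat \<Rightarrow> ('v::real_normed_vector \<Rightarrow>\<^sub>L 'v) \<Rightarrow> real" where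
  "gelfand_number q B =
    (INF F \<in> {F. subspace F \<and> closed F \<and> has_codim F (q - 1)}. norm_on F B)"

definition closed_subspaces :: "'v::real_normed_vector set set" where
  "closed_subspaces = {E. subspace E \<and> closed E}"

definition unit_sphere :: "'v::real_normed_vector set \<Rightarrow> 'v set" where
  "unit_sphere E = {v \<in> E. norm v = 1}"

text \<open>In \<open>ennreal\<close> an empty supremum is 0 and the distance to the empty set is \<open>\<infinity>\<close>.
  Thus the zero subspace has distance 0 from itself and \<open>\<infinity>\<close> from every other subspace;
  any two nonzero subspaces have distance at most 2.\<close>

definition dist_to_set :: "'v::metric_space \<Rightarrow> 'v set \<Rightarrow> ennreal" where
  "dist_to_set v S = (INF s\<in>S. ennreal (dist v s))"

definition grass_dist :: "'v::real_normed_vector set \<Rightarrow> 'v set \<Rightarrow> ennreal" where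
  "grass_dist E E' =
    max (SUP e \<in> unit_sphere E. dist_to_set e (unit_sphere E'))
        (SUP e' \<in> unit_sphere E'. dist_to_set e' (unit_sphere E))"

definition grass_continuous ::
  "('x::topological_space \<Rightarrow> 'v::real_normed_vector set) \<Rightarrow> bool" where
  "grass_continuous E \<longleftrightarrow> (\<forall>x. E x \<in> closed_subspaces) \<and>
    (\<forall>x. \<forall>\<epsilon>>0. \<forall>\<^sub>F y in nhds x. grass_dist (E y) (E x) < ennreal \<epsilon>)"

definition cocycle ::
  "('x \<Rightarrow> 'x) \<Rightarrow> ('x \<Rightarrow> nat \<Rightarrow> 'v::real_normed_vector \<Rightarrow>\<^sub>L 'v) \<Rightarrow> bool" where
  "cocycle T A \<longleftrightarrow> (\<forall>x. A x 0 = id_blinfun) \<and>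
    (\<forall>x n m. A x (n + m) = A ((T ^^ m) x) n o\<^sub>L A x m)"

definition continuous_cocycle ::
  "('x::topological_space \<Rightarrow> 'x) \<Rightarrow> ('x \<Rightarrow> nat \<Rightarrow> 'v::real_normed_vector \<Rightarrow>\<^sub>L 'v) \<Rightarrow> bool" where
  "continuous_cocycle T A \<longleftrightarrow> cocycle T A \<and> (\<forall>n. continuous_on UNIV (\<lambda>x. A x n))"

definition continuous_equivariant_splitting ::
  "('x::topological_space \<Rightarrow> 'x) \<Rightarrow> ('x \<Rightarrow> nat \<Rightarrow> 'v::real_normed_vector \<Rightarrow>\<^sub>L 'v) \<Rightarrow>
    ('x \<Rightarrow> 'v set) \<Rightarrow> ('x \<Rightarrow> 'v set) \<Rightarrow> bool" where
  "continuous_equivariant_splitting T A E F \<longleftrightarrow>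
    grass_continuous E \<and> grass_continuous F \<and>
    (\<forall>x. complementary (E x) (F x)) \<and>
    (\<forall>x. \<forall>n\<ge>1. blinfun_apply (A x n) ` E x = E ((T ^^ n) x) \<and>
                blinfun_apply (A x n) ` F x \<subseteq> F ((T ^^ n) x))"

end

theory Submission
  imports Defs "Jordan_Normal_Form.Determinant"
begin

text \<open>Write \<open>c x n\<close> for the \<open>k\<close>-th Gelfand number of \<open>A x n\<close>.

  From (1) to (2): the gap provides closed subspaces \<open>G\<close> of codimension \<open>k\<close> on which \<open>A x n\<close> has
  norm \<open>O(\<tau> ^ n * c x n)\<close>. If \<open>H\<close> is a complement of \<open>G\<close> with controlled angle, then \<open>A x n\<close>
  expands \<open>H\<close> by a multiple of \<open>c x n\<close>, for otherwise \<open>G\<close> and a line of \<open>H\<close> would span a subspace of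
  codimension \<open>k - 1\<close> with too small a norm. Comparing along \<open>H\<close>, any two such \<open>G\<close> are at distance
  \<open>O(\<tau> ^ n)\<close>, so they converge to a slow space \<open>Fs x\<close>, uniformly in \<open>x\<close>. Dually, the images
  \<open>A z n ` Hs z\<close> with \<open>z = S ^^ n x\<close>, where \<open>S\<close> is the inverse of \<open>T\<close> and \<open>Hs z\<close> a complement
  of \<open>Fs z\<close>, converge to a fast space \<open>Es x\<close>. Uniformity yields continuity and equivariance.

  The crux is that \<open>Es x\<close> and \<open>Fs x\<close> are transversal. If they share a nonzero vector, then so do
  \<open>Es\<close> and \<open>Fs\<close> along the whole forward orbit, and then the determinant of \<open>A x (2 * n)\<close> as a map from
  \<open>Hs\<close> to \<open>Es\<close> is at most \<open>C * \<tau> ^ n\<close> times the product of the two determinants of time \<open>n\<close>. Iterated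
  doubling makes the determinants decay superexponentially. But \<open>A\<close> is bounded below on \<open>Es\<close>
  uniformly over the compact base, so they decay at most exponentially.

  From (2) to (1): restricting to \<open>F x\<close> bounds the Gelfand number of index \<open>k + 1\<close> from above, and every subspace of
  codimension \<open>k - 1\<close> meets \<open>E x\<close>, which bounds the one of index \<open>k\<close> from below.\<close>

subsection \<open>Dimension and codimension\<close>

text \<open>Both halves of the gap compare time \<open>n\<close> with time \<open>n + 1\<close>
  because nothing bounds the growth over one step from below: an injective operator on an
  infinite-dimensional space may be arbitrarily weak, so \<open>c x (n + 1)\<close> could be far
  below \<open>c x n\<close>. The half for \<open>A x n\<close> yields one subspace that is slow at
  both times and so links consecutive slow spaces; the half for \<open>A (T x) n\<close> links
  consecutive images arriving at a common point.

  The complements \<open>Hs x\<close> are chosen without continuity; only their angle constant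
  \<open>3 ^ k\<close> is uniform. Continuity of the limits therefore comes from keeping one test
  subspace fixed while the base point moves.

  \<open>Fs x\<close> depends on the future of \<open>x\<close> and \<open>Es x\<close> on its past,
  so nothing relates them directly. Determinants serve because they are multiplicative: losing a
  single direction costs a full factor \<open>\<tau> ^ n\<close>, and each doubling of the time
  multiplies the base of the resulting power by a fixed number below 1. The opposing lower bound
  needs continuity of \<open>Es\<close> first, since injectivity bounds the cocycle below only on
  finite-dimensional fibres.\<close>

definition has_dim :: "'v::real_vector set \<Rightarrow> nat \<Rightarrow> bool" where
  "has_dim S k \<longleftrightarrow> (\<exists>B. finite B \<and> independent B \<and> card B = k \<and> span B = S)"

lemma has_dim_subspace: "has_dim S k \<Longrightarrow> subspace S"
  unfolding has_dim_def by (auto simp: subspace_span)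

lemma has_dim_if_spanned:
  assumes "subspace S" "finite B" "S \<subseteq> span B"
  shows "has_dim S (dim S)"
proof -
  obtain C where C: "C \<subseteq> S" "independent C" "S \<subseteq> span C" "card C = dim S"
    using basis_exists by blast
  have "finite C" using independent_span_bound[of B C] C assms by auto
  moreover have "span C = S" using C assms(1) by (simp add: span_minimal subset_antisym)
  ultimately show ?thesis using C unfolding has_dim_def by blast
qed

lemma edim_eq_iff_has_dim:
  assumes "subspace S"
  shows "edim S = enat k \<longleftrightarrow> has_dim S k"
proof
  assume a: "edim S = enat k"
  then obtain B where "finite B" "S \<subseteq> span B" unfolding edim_def by (auto split: if_splits)
  then show "has_dim S k" using a has_dim_if_spanned[OF assms] unfolding edim_def
    by (metis enat.inject)
next
  assume "has_dim S k"
  then obtain B where B: "finite B" "independent B" "card B = k" "span B = S"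
    unfolding has_dim_def by auto
  then have "dim S = k" using dim_span_eq_card_independent by blast
  then show "edim S = enat k" using B unfolding edim_def by auto
qed

lemma has_dim_unique: "has_dim S k \<Longrightarrow> has_dim S j \<Longrightarrow> k = j"
  by (metis edim_eq_iff_has_dim enat.inject has_dim_subspace)

lemma complementaryD:
  assumes "complementary E F"
  shows "subspace E" "subspace F" "E \<inter> F = {0}" "\<exists>e\<in>E. \<exists>f\<in>F. v = e + f"
  using assms unfolding complementary_def by auto

lemma complementary_eq_0:
  "complementary E F \<Longrightarrow> v \<in> E \<Longrightarrow> v \<in> F \<Longrightarrow> v = 0"
  unfolding complementary_def by auto

lemma has_codim_iff:
  "has_codim F m \<longleftrightarrow> (\<exists>W. complementary W F \<and> has_dim W m)"
  unfolding has_codim_def using edim_eq_iff_has_dim complementaryD(1) by metis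

lemma has_codim_subspace: "has_codim F m \<Longrightarrow> subspace F"
  unfolding has_codim_def complementary_def by auto

text \<open>Purely algebraic: nothing is said about boundedness. Where a norm bound matters it is
  supplied by \<open>angle_bound\<close> or by \<open>coordinates\<close>.\<close>

lemma complementary_projection:
  fixes W G :: "'v::real_vector set"
  assumes c: "complementary W G"
  obtains p where "linear p" "\<And>v. p v \<in> W" "\<And>v. v - p v \<in> G"
    "\<And>v. v \<in> G \<Longrightarrow> p v = 0" "\<And>w. w \<in> W \<Longrightarrow> p w = w"
proof -
  note sW = complementaryD(1)[OF c] and sG = complementaryD(2)[OF c]
  define p where "p v = (SOME w. w \<in> W \<and> v - w \<in> G)" for v
  have p: "p v \<in> W \<and> v - p v \<in> G" for v
  proof -
    obtain e f where "e \<in> W" "f \<in> G" "v = e + f" using complementaryD(4)[OF c] by blast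
    then have "e \<in> W \<and> v - e \<in> G" by auto
    then show ?thesis unfolding p_def by (rule someI)
  qed
  have uniq: "p v = w" if "w \<in> W" "v - w \<in> G" for v w
  proof -
    have 1: "p v - w \<in> W" using p that sW by (simp add: subspace_diff)
    have "(v - w) - (v - p v) \<in> G" using p that sG by (blast intro: subspace_diff)
    then have "p v - w \<in> G" by simp
    with 1 have "p v - w = 0" using complementary_eq_0[OF c] by blast
    then show ?thesis by simp
  qed
  have "linear p"
  proof (rule linearI)
    show "p (x + y) = p x + p y" for x y
    proof (rule uniq)
      show "p x + p y \<in> W" using p sW by (simp add: subspace_add)
      have "(x - p x) + (y - p y) \<in> G" using p sG by (simp add: subspace_add)
      then show "x + y - (p x + p y) \<in> G" by (simp add: algebra_simps)
    qed
    show "p (r *\<^sub>R x) = r *\<^sub>R p x" for r x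
    proof (rule uniq)
      show "r *\<^sub>R p x \<in> W" using p sW by (simp add: subspace_scale)
      have "r *\<^sub>R (x - p x) \<in> G" using p sG by (simp add: subspace_scale)
      then show "r *\<^sub>R x - r *\<^sub>R p x \<in> G" by (simp add: algebra_simps)
    qed
  qed
  moreover have "p v = 0" if "v \<in> G" for v
    using uniq[of 0 v] that sW by (simp add: subspace_0)
  moreover have "p w = w" if "w \<in> W" for w
    using uniq[of w w] that sG by (simp add: subspace_0)
  ultimately show ?thesis using that p by blast
qed

lemma linear_inj_on_subspace:
  assumes "linear f" "subspace E" "\<And>e. e \<in> E \<Longrightarrow> f e = 0 \<Longrightarrow> e = 0"
  shows "inj_on f E"
proof (rule inj_onI)
  fix x y assume "x \<in> E" "y \<in> E" "f x = f y"
  then have "f (x - y) = 0" "x - y \<in> E"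
    using assms(2) by (simp_all add: linear_diff[OF assms(1)] subspace_diff)
  then show "x = y" using assms(3) by force
qed

text \<open>\<open>E\<close> is not known to be finite-dimensional in advance: the injection into
  \<open>W\<close> bounds the size of its independent sets. This is how the limits of fast spaces
  acquire a dimension.\<close>

lemma has_dim_inj:
  fixes f :: "'v::real_vector \<Rightarrow> 'w::real_vector"
  assumes lin: "linear f" and E: "subspace E" and inj: "\<And>e. e \<in> E \<Longrightarrow> f e = 0 \<Longrightarrow> e = 0"
    and W: "has_dim W j" and sub: "f ` E \<subseteq> W"
  obtains i where "i \<le> j" "has_dim E i"
proof -
  obtain C where C: "finite C" "independent C" "card C = j" "span C = W"
    using W unfolding has_dim_def by auto
  obtain B where B: "B \<subseteq> E" "independent B" "E \<subseteq> span B"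
    using maximal_independent_subset by blast
  have spB: "span B = E" using B E by (simp add: span_minimal subset_antisym)
  have injE: "inj_on f E" using linear_inj_on_subspace[OF lin E inj] by blast
  have ind: "independent (f ` B)"
    using linear_independent_injective_image[OF lin B(2)] injE spB by simp
  have "finite (f ` B) \<and> card (f ` B) \<le> card C"
    using independent_span_bound[OF C(1) ind] B sub C by auto
  moreover have "inj_on f B" using injE B by (meson inj_on_subset)
  ultimately have "finite B" "card B \<le> j" using C by (auto simp: finite_image_iff card_image)
  then show ?thesis using that B spB unfolding has_dim_def by blast
qed

lemma has_dim_inj_le:
  assumes "linear f" "has_dim E i" "\<And>e. e \<in> E \<Longrightarrow> f e = 0 \<Longrightarrow> e = 0"
    and "has_dim W j" "f ` E \<subseteq> W"
  shows "i \<le> j"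
  using has_dim_inj[OF assms(1) has_dim_subspace[OF assms(2)] assms(3-5)]
    has_dim_unique[OF assms(2)] by metis

lemma has_dim_image:
  fixes f :: "'v::real_vector \<Rightarrow> 'w::real_vector"
  assumes lin: "linear f" and E: "has_dim E k" and inj: "\<And>e. e \<in> E \<Longrightarrow> f e = 0 \<Longrightarrow> e = 0"
  shows "has_dim (f ` E) k"
proof -
  obtain B where B: "finite B" "independent B" "card B = k" "span B = E"
    using E unfolding has_dim_def by auto
  have injE: "inj_on f E" using linear_inj_on_subspace[OF lin has_dim_subspace[OF E] inj] by blast
  have "independent (f ` B)" using linear_independent_injective_image[OF lin B(2)] injE B by simp
  moreover have "inj_on f B" using injE B span_superset by (metis inj_on_subset)
  moreover have "span (f ` B) = f ` E" using linear_span_image[OF lin] B by metis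
  ultimately show ?thesis using B unfolding has_dim_def
    by (metis card_image finite_imageI)
qed

lemma has_dim_subset_eq:
  assumes E: "has_dim E k" and W: "has_dim W k" and sub: "E \<subseteq> W"
  shows "E = W"
proof (rule ccontr)
  assume "E \<noteq> W"
  then obtain w where w: "w \<in> W" "w \<notin> E" using sub by blast
  obtain B where B: "finite B" "independent B" "card B = k" "span B = E"
    using E unfolding has_dim_def by auto
  obtain C where C: "finite C" "independent C" "card C = k" "span C = W"
    using W unfolding has_dim_def by auto
  have "independent (insert w B)" using B w by (simp add: independent_insertI)
  moreover have "insert w B \<subseteq> span C" using w B C sub span_superset by blast
  ultimately have "card (insert w B) \<le> card C" using independent_span_bound[OF C(1)] by blast
  moreover have "w \<notin> B" using w B span_base by blast
  ultimately show False using B C by simp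
qed

text \<open>The projection along \<open>G\<close> onto a known complement \<open>W\<close> is
  injective on \<open>H\<close>, hence onto \<open>W\<close> by counting dimensions; lifting
  \<open>p v\<close> back to \<open>H\<close> splits \<open>v\<close>.\<close>

lemma complementary_if_trivial_inter:
  fixes H G :: "'v::real_vector set"
  assumes G: "has_codim G k" and H: "has_dim H k" and tr: "\<And>v. v \<in> H \<Longrightarrow> v \<in> G \<Longrightarrow> v = 0"
  shows "complementary H G"
proof -
  obtain W where W: "complementary W G" "has_dim W k" using G has_codim_iff by blast
  obtain p where p: "linear p" "\<And>v. p v \<in> W" "\<And>v. v - p v \<in> G"
    "\<And>v. v \<in> G \<Longrightarrow> p v = 0" "\<And>w. w \<in> W \<Longrightarrow> p w = w"
    using complementary_projection[OF W(1)] by blast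
  have inj: "e = 0" if "e \<in> H" "p e = 0" for e
    using tr[OF that(1)] p(3)[of e] that by simp
  have "has_dim (p ` H) k" using has_dim_image[OF p(1) H inj] by blast
  then have pH: "p ` H = W" using has_dim_subset_eq W(2) p(2) by blast
  have sH: "subspace H" using H by (rule has_dim_subspace)
  have sG: "subspace G" using W(1) by (rule complementaryD)
  have "\<exists>e\<in>H. \<exists>f\<in>G. v = e + f" for v
  proof -
    obtain h where h: "h \<in> H" "p v = p h" using pH p(2)[of v] by force
    have "v - h = (v - p v) - (h - p h)" using h by simp
    then have "v - h \<in> G" using subspace_diff[OF sG p(3)[of v] p(3)[of h]] by simp
    moreover have "v = h + (v - h)" by simp
    ultimately show ?thesis using h(1) by blast
  qed
  moreover have "H \<inter> G = {0}" using tr sH sG by (auto simp: subspace_0)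
  ultimately show ?thesis unfolding complementary_def using sH sG by auto
qed

lemma has_dim_codim_inter:
  fixes H G :: "'v::real_vector set"
  assumes G: "has_codim G j" and H: "has_dim H k" and "j < k"
  shows "\<exists>v. v \<in> H \<and> v \<in> G \<and> v \<noteq> 0"
proof (rule ccontr)
  assume a: "\<not> ?thesis"
  obtain W where W: "complementary W G" "has_dim W j" using G has_codim_iff by blast
  obtain p where p: "linear p" "\<And>v. p v \<in> W" "\<And>v. v - p v \<in> G"
    "\<And>v. v \<in> G \<Longrightarrow> p v = 0" "\<And>w. w \<in> W \<Longrightarrow> p w = w"
    using complementary_projection[OF W(1)] by blast
  have inj: "e = 0" if "e \<in> H" "p e = 0" for e
  proof -
    have "e \<in> G" using p(3)[of e] that by simp
    with that a show ?thesis by blast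
  qed
  have "k \<le> j" using has_dim_inj_le[OF p(1) H inj W(2)] p(2) by blast
  then show False using assms by simp
qed

lemma has_dim_0: "has_dim {0::'v::real_vector} 0"
  unfolding has_dim_def by (rule exI[of _ "{}"]) (auto simp: independent_empty)

lemma has_dim_0_iff: "has_dim S 0 \<longleftrightarrow> S = {0}"
proof
  assume "has_dim S 0"
  then show "S = {0}" unfolding has_dim_def by auto
qed (simp add: has_dim_0)

lemma has_codim_0: "has_codim UNIV 0"
proof -
  have "complementary {0::'a} UNIV" unfolding complementary_def by (simp add: subspace_single_0)
  then show ?thesis unfolding has_codim_iff using has_dim_0 by blast
qed

lemma has_codim_0_iff: "has_codim G 0 \<longleftrightarrow> G = UNIV"
proof
  assume "has_codim G 0"
  then have c: "complementary {0} G" unfolding has_codim_iff has_dim_0_iff by blast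
  have "v \<in> G" for v using complementaryD(4)[OF c, of v] by auto
  then show "G = UNIV" by blast
qed (simp add: has_codim_0)

lemma has_dim_insert:
  assumes H: "has_dim H k" and v: "v \<notin> H"
  shows "has_dim {h + t *\<^sub>R v | h t. h \<in> H} (Suc k)"
proof -
  obtain B where B: "finite B" "independent B" "card B = k" "span B = H"
    using H unfolding has_dim_def by auto
  have "independent (insert v B)" using B v by (simp add: independent_insertI)
  moreover have "v \<notin> B" using v B span_base by blast
  moreover have "span (insert v B) = {h + t *\<^sub>R v | h t. h \<in> H}"
  proof (intro equalityI subsetI)
    fix x assume "x \<in> span (insert v B)"
    then obtain t where "x - t *\<^sub>R v \<in> H" unfolding span_insert B by auto
    then show "x \<in> {h + t *\<^sub>R v | h t. h \<in> H}" by (metis (mono_tags, lifting) diff_add_cancel mem_Collect_eq)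
  next
    fix x assume "x \<in> {h + t *\<^sub>R v | h t. h \<in> H}"
    then obtain h t where ht: "h \<in> span B" "x = h + t *\<^sub>R v" using B by auto
    then have "h \<in> span (insert v B)" using span_mono[of B "insert v B"] ht(1) by blast
    moreover have "t *\<^sub>R v \<in> span (insert v B)" by (simp add: span_base span_scale)
    ultimately show "x \<in> span (insert v B)" using ht by (simp add: span_add)
  qed
  ultimately show ?thesis using B unfolding has_dim_def
    by (metis card_insert_disjoint finite_insert)
qed

text \<open>Exchange argument: \<open>p v\<close> is extended to a basis of the complement
  \<open>W\<close>, and the remaining basis vectors span a complement of the enlarged space.\<close>

lemma has_codim_add_line:
  fixes G :: "'v::real_vector set"
  assumes G: "has_codim G (Suc k)" and v: "v \<notin> G"
  shows "has_codim {g + t *\<^sub>R v | g t. g \<in> G} k"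
proof -
  obtain W where W: "complementary W G" "has_dim W (Suc k)" using G has_codim_iff by blast
  obtain p where p: "linear p" "\<And>v. p v \<in> W" "\<And>v. v - p v \<in> G"
    "\<And>v. v \<in> G \<Longrightarrow> p v = 0" "\<And>w. w \<in> W \<Longrightarrow> p w = w"
    using complementary_projection[OF W(1)] by blast
  have sG: "subspace G" and sW: "subspace W" using W(1) complementaryD by blast+
  have pv: "p v \<noteq> 0" using p(3)[of v] v by (metis diff_0_right)
  obtain B where B: "finite B" "independent B" "card B = Suc k" "span B = W"
    using W(2) unfolding has_dim_def by auto
  have "independent {p v}" using pv by simp
  then obtain C where C: "{p v} \<subseteq> C" "C \<subseteq> W" "independent C" "W \<subseteq> span C"
    using maximal_independent_subset_extend[of "{p v}" W] p(2) by (metis empty_subsetI insert_subset)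
  have spC: "span C = W" using C sW by (simp add: span_minimal subset_antisym)
  have fC: "finite C" using independent_span_bound[OF B(1) C(3)] C(2) B(4) by blast
  have "has_dim W (card C)" unfolding has_dim_def using C fC spC by blast
  then have cC: "card C = Suc k" using has_dim_unique[OF W(2)] by simp
  define D where "D = C - {p v}"
  have CD: "C = insert (p v) D" using C D_def by auto
  have "p v \<notin> D" unfolding D_def by simp
  then have iD: "independent D" "p v \<notin> span D"
    using C(3) unfolding CD independent_insert by auto
  have cD: "card D = k" "finite D" using cC fC C D_def by auto
  let ?G = "{g + t *\<^sub>R v | g t. g \<in> G}"
  have dD: "has_dim (span D) k" unfolding has_dim_def using iD cD by blast
  have sG': "subspace ?G"
    unfolding subspace_def
  proof (intro conjI ballI allI)
    have "(0::'v) = 0 + 0 *\<^sub>R v" "0 \<in> G" using sG by (auto simp: subspace_0)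
    then show "0 \<in> ?G" by blast
    fix x y assume "x \<in> ?G" "y \<in> ?G"
    then obtain g t g' t' where *: "x = g + t *\<^sub>R v" "g \<in> G" "y = g' + t' *\<^sub>R v" "g' \<in> G" by auto
    have "x + y = (g + g') + (t + t') *\<^sub>R v" unfolding * by (simp add: algebra_simps)
    moreover have "g + g' \<in> G" using sG *(2,4) by (rule subspace_add)
    ultimately show "x + y \<in> ?G" by blast
  next
    fix c x assume "x \<in> ?G"
    then obtain g t where *: "x = g + t *\<^sub>R v" "g \<in> G" by auto
    have "c *\<^sub>R x = c *\<^sub>R g + (c * t) *\<^sub>R v" unfolding * by (simp add: algebra_simps)
    moreover have "c *\<^sub>R g \<in> G" using sG *(2) by (rule subspace_scale)
    ultimately show "c *\<^sub>R x \<in> ?G" by blast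
  qed
  have "complementary (span D) ?G"
    unfolding complementary_def
  proof (intro conjI allI)
    show "subspace (span D)" by simp
    show "subspace ?G" by (rule sG')
    show "span D \<inter> ?G = {0}"
    proof (intro equalityI subsetI)
      fix x assume x: "x \<in> span D \<inter> ?G"
      then obtain g t where *: "x = g + t *\<^sub>R v" "g \<in> G" by auto
      have "x \<in> W" using x spC span_mono[of D C] D_def by blast
      then have "x = p x" using p(5)[of x] by simp
      also have "\<dots> = p g + t *\<^sub>R p v"
        by (simp only: *(1) linear_add[OF p(1)] linear_scale[OF p(1)])
      also have "\<dots> = t *\<^sub>R p v" by (simp only: p(4)[OF *(2)] add_0)
      finally have xt: "x = t *\<^sub>R p v" .
      have "t = 0"
      proof (rule ccontr)
        assume "t \<noteq> 0"
        then have "(1/t) *\<^sub>R x = p v" unfolding xt by simp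
        moreover have "(1/t) *\<^sub>R x \<in> span D" using x by (intro span_scale) (rule IntD1)
        ultimately show False using iD(2) by simp
      qed
      then show "x \<in> {0}" using xt by simp
    next
      fix x assume "x \<in> {0::'v}"
      then have "x = 0" by simp
      show "x \<in> span D \<inter> ?G"
        unfolding \<open>x = 0\<close> by (rule IntI[OF span_0 subspace_0[OF sG']])
    qed
    fix x
    have "p x \<in> span (insert (p v) D)" using p(2) spC CD by simp
    then obtain t where t: "p x - t *\<^sub>R p v \<in> span D" unfolding span_insert by auto
    have "x = (p x - t *\<^sub>R p v) + ((x - p x) - t *\<^sub>R (v - p v) + t *\<^sub>R v)"
      by (simp add: scaleR_diff_right)
    moreover
    have "(x - p x) - t *\<^sub>R (v - p v) \<in> G"
      using subspace_diff[OF sG p(3) subspace_scale[OF sG p(3)]] .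
    then have "(x - p x) - t *\<^sub>R (v - p v) + t *\<^sub>R v \<in> ?G" by blast
    ultimately show "\<exists>e\<in>span D. \<exists>f\<in>?G. x = e + f" using t by blast
  qed
  then show ?thesis using dD has_codim_iff by blast
qed

lemma has_codim_inter_kernel:
  fixes f :: "'v::real_vector \<Rightarrow> real"
  assumes G: "has_codim G k" and f: "linear f" and v: "v \<in> G" "f v \<noteq> 0"
  shows "has_codim {g \<in> G. f g = 0} (Suc k)"
proof -
  obtain W where W: "complementary W G" "has_dim W k" using G has_codim_iff by blast
  have sG: "subspace G" using W(1) complementaryD by blast
  let ?W = "{w + t *\<^sub>R v | w t. w \<in> W}" and ?G = "{g \<in> G. f g = 0}"
  have vW: "v \<notin> W" using v complementary_eq_0[OF W(1), of v] linear_0[OF f] by auto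
  have dW: "has_dim ?W (Suc k)" using has_dim_insert[OF W(2) vW] .
  have sG': "subspace ?G" using sG f
    unfolding subspace_def by (simp add: linear_0[OF f] linear_add[OF f] linear_scale[OF f])
  have "complementary ?W ?G"
    unfolding complementary_def
  proof (intro conjI allI)
    show "subspace ?W" using dW by (rule has_dim_subspace)
    show "subspace ?G" by (rule sG')
    show "?W \<inter> ?G = {0}"
    proof (intro equalityI subsetI)
      fix x assume "x \<in> ?W \<inter> ?G"
      then obtain w t where *: "x = w + t *\<^sub>R v" "w \<in> W" "x \<in> G" "f x = 0" by auto
      have "x - t *\<^sub>R v \<in> G" using subspace_diff[OF sG *(3) subspace_scale[OF sG v(1)]] .
      then have "w = 0" using * complementary_eq_0[OF W(1)] by simp
      then have xt: "x = t *\<^sub>R v" using *(1) by simp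
      then have "t * f v = 0" using *(4) linear_scale[OF f, of t v] by simp
      then have "t = 0" using v by simp
      with xt show "x \<in> {0}" by simp
    next
      fix x assume "x \<in> {0::'v}"
      then have "x = 0" by simp
      show "x \<in> ?W \<inter> ?G"
        unfolding \<open>x = 0\<close> by (rule IntI[OF subspace_0[OF has_dim_subspace[OF dW]] subspace_0[OF sG']])
    qed
    fix x
    obtain w g where wg: "w \<in> W" "g \<in> G" "x = w + g" using complementaryD(4)[OF W(1)] by blast
    let ?t = "f g / f v"
    have "g - ?t *\<^sub>R v \<in> ?G" using wg v sG f
      by (simp add: subspace_diff subspace_scale linear_diff[OF f] linear_scale[OF f])
    moreover have "x = (w + ?t *\<^sub>R v) + (g - ?t *\<^sub>R v)" using wg by simp
    ultimately show "\<exists>e\<in>?W. \<exists>f\<in>?G. x = e + f" using wg by blast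
  qed
  then show ?thesis using dW has_codim_iff by blast
qed

text \<open>The codimension drops when \<open>G\<close> and the range of \<open>A\<close> do not
  span the whole space, hence only \<open>i \<le> j\<close>. A largest subspace transversal to the
  preimage is a complement, for otherwise a further line could be added to it.\<close>

lemma has_codim_vimage:
  fixes A :: "'v::real_vector \<Rightarrow> 'w::real_vector"
  assumes A: "linear A" and G: "has_codim G j"
  obtains i where "i \<le> j" "has_codim (A -` G) i"
proof -
  obtain W where W: "complementary W G" "has_dim W j" using G has_codim_iff by blast
  obtain p where p: "linear p" "\<And>v. p v \<in> W" "\<And>v. v - p v \<in> G"
    "\<And>v. v \<in> G \<Longrightarrow> p v = 0" "\<And>w. w \<in> W \<Longrightarrow> p w = w"
    using complementary_projection[OF W(1)] by blast
  have sG: "subspace G" using W(1) complementaryD by blast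
  have sA: "subspace (A -` G)" using linear_subspace_vimage[OF A sG] .
  have bound: "i \<le> j" if H: "has_dim H i" and tr: "H \<inter> A -` G = {0}" for H i
  proof (rule has_dim_inj_le[OF _ H _ W(2)])
    show "linear (p \<circ> A)" using A p(1) by (simp add: linear_compose)
    show "(p \<circ> A) ` H \<subseteq> W" using p(2) by auto
    fix e assume e: "e \<in> H" "(p \<circ> A) e = 0"
    then have "A e \<in> G" using p(3)[of "A e"] by simp
    then show "e = 0" using e tr by auto
  qed
  define P where "P i \<longleftrightarrow> (\<exists>H. has_dim H i \<and> H \<inter> A -` G = {0})" for i
  have z: "0 \<in> A -` G" using sA by (rule subspace_0)
  then have "{0} \<inter> A -` G = {0}" by blast
  then have "P 0" unfolding P_def has_dim_0_iff by metis
  moreover have "P i \<Longrightarrow> i \<le> j" for i unfolding P_def using bound by blast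
  ultimately have i: "P (GREATEST i. P i)" "\<And>i. P i \<Longrightarrow> i \<le> (GREATEST i. P i)"
    by (blast intro: GreatestI_nat Greatest_le_nat)+
  then obtain i where Pi: "P i" and mx: "\<not> P (Suc i)" by (metis Suc_n_not_le_n)
  then obtain H where H: "has_dim H i" "H \<inter> A -` G = {0}" unfolding P_def by blast
  have sH: "subspace H" using H(1) by (rule has_dim_subspace)
  have "\<exists>e\<in>H. \<exists>f\<in>A -` G. v = e + f" for v
  proof (cases "v \<in> H")
    case True
    then show ?thesis using sA by (metis add.right_neutral subspace_0)
  next
    case False
    have "has_dim {h + t *\<^sub>R v | h t. h \<in> H} (Suc i)" using has_dim_insert[OF H(1) False] .
    then have "{h + t *\<^sub>R v | h t. h \<in> H} \<inter> A -` G \<noteq> {0}" using mx unfolding P_def by blast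
    moreover have "\<exists>h t. 0 = h + t *\<^sub>R v \<and> h \<in> H"
      using subspace_0[OF sH] by (intro exI[of _ 0]) auto
    ultimately obtain h t where ht: "h \<in> H" "h + t *\<^sub>R v \<in> A -` G" "h + t *\<^sub>R v \<noteq> 0" using z by blast
    have t: "t \<noteq> 0"
    proof
      assume "t = 0"
      then have "h \<in> A -` G" "h \<noteq> 0" using ht by simp_all
      then show False using H(2) ht(1) by blast
    qed
    have "(1/t) *\<^sub>R (h + t *\<^sub>R v) \<in> A -` G" using subspace_scale[OF sA ht(2)] .
    moreover have "v = (- (1/t)) *\<^sub>R h + (1/t) *\<^sub>R (h + t *\<^sub>R v)"
      using t by (simp add: algebra_simps)
    moreover have "(- (1/t)) *\<^sub>R h \<in> H" using subspace_scale[OF sH ht(1)] .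
    ultimately show ?thesis by (intro bexI)
  qed
  then have "complementary H (A -` G)" unfolding complementary_def using sH sA H(2) by auto
  then have "has_codim (A -` G) i" using H(1) has_codim_iff by blast
  then show ?thesis using that bound[OF H] by blast
qed

subsection \<open>Functionals and complements of controlled norm\<close>

text \<open>The graph of a functional dominated by the norm is a subspace of the product with the
  reals; Zorn's lemma is applied to such subspaces, and single-valuedness is automatic.\<close>

lemma Hahn_Banach_extend_line:
  fixes g :: "('v::real_normed_vector \<times> real) set"
  assumes g: "subspace g" and dom: "\<And>x t. (x, t) \<in> g \<Longrightarrow> t \<le> norm x"
  shows "\<exists>g'. subspace g' \<and> (\<forall>x t. (x, t) \<in> g' \<longrightarrow> t \<le> norm x) \<and> g \<subseteq> g' \<and> (\<exists>c. (x0, c) \<in> g')"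
proof -
  have z: "(0, 0) \<in> g" using subspace_0[OF g] by (simp add: zero_prod_def)
  \<comment> \<open>Any value between the lower bounds \<open>t - norm (x - x0)\<close> and the
    upper bounds \<open>norm (y + x0) - t'\<close> keeps the extension dominated; the supremum of
    the lower ones is taken.\<close>
  define c where "c = (SUP p\<in>g. snd p - norm (fst p - x0))"
  have le: "t - norm (x - x0) \<le> norm (y + x0) - t'" if "(x, t) \<in> g" "(y, t') \<in> g" for x t y t'
  proof -
    have "(x + y, t + t') \<in> g" using subspace_add[OF g that] by simp
    then have "t + t' \<le> norm (x + y)" using dom by blast
    also have "\<dots> = norm ((x - x0) + (y + x0))" by simp
    also have "\<dots> \<le> norm (x - x0) + norm (y + x0)" by (rule norm_triangle_ineq)
    finally show ?thesis by simp
  qed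
  have bdd: "bdd_above ((\<lambda>p. snd p - norm (fst p - x0)) ` g)"
    using le[OF _ z] by (intro bdd_aboveI2[of _ _ "norm (0 + x0) - 0"]) (auto simp: prod_eq_iff)
  have c1: "t - norm (x - x0) \<le> c" if "(x, t) \<in> g" for x t
    unfolding c_def using cSUP_upper[OF that bdd] by simp
  have c2: "c \<le> norm (y + x0) - t'" if "(y, t') \<in> g" for y t'
    unfolding c_def using le[OF _ that] z by (intro cSUP_least) auto
  let ?g = "span (insert (x0, c) g)"
  have "t \<le> norm x" if xt: "(x, t) \<in> ?g" for x t
  proof -
    obtain s where s: "(x, t) - s *\<^sub>R (x0, c) \<in> g"
      using xt unfolding span_insert span_eq_iff[THEN iffD2, OF g] by blast
    define y r where "y = x - s *\<^sub>R x0" and "r = t - s * c"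
    have yr: "(y, r) \<in> g" using s by (simp add: y_def r_def)
    have x: "x = y + s *\<^sub>R x0" and t: "t = r + s * c" by (simp_all add: y_def r_def)
    have sc: "(a *\<^sub>R y, a * r) \<in> g" for a using subspace_scale[OF g yr, of a] by simp
    consider "s = 0" | "s > 0" | "s < 0" by linarith
    then show ?thesis
    proof cases
      case 1
      then show ?thesis using dom[OF yr] x t by simp
    next
      case 2
      have "c \<le> norm ((1/s) *\<^sub>R y + x0) - (1/s) * r" using c2[OF sc] .
      then have "s * c \<le> s * norm ((1/s) *\<^sub>R y + x0) - r" using 2 by (simp add: field_simps)
      also have "s * norm ((1/s) *\<^sub>R y + x0) = norm (s *\<^sub>R ((1/s) *\<^sub>R y + x0))" using 2 by simp
      also have "s *\<^sub>R ((1/s) *\<^sub>R y + x0) = x" using 2 by (simp add: x scaleR_add_right)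
      finally show ?thesis using t by simp
    next
      case 3
      have "(1/(-s)) * r - norm ((1/(-s)) *\<^sub>R y - x0) \<le> c" using c1[OF sc] .
      then have "(-s) * ((1/(-s)) * r - norm ((1/(-s)) *\<^sub>R y - x0)) \<le> (-s) * c"
        using 3 by (intro mult_left_mono) auto
      then have "r + s * c \<le> (-s) * norm ((1/(-s)) *\<^sub>R y - x0)" using 3 by (simp add: algebra_simps)
      also have "\<dots> = norm ((-s) *\<^sub>R ((1/(-s)) *\<^sub>R y - x0))" using 3 by simp
      also have "(-s) *\<^sub>R ((1/(-s)) *\<^sub>R y - x0) = x" using 3 by (simp add: x scaleR_diff_right)
      finally show ?thesis using t by simp
    qed
  qed
  moreover have "g \<subseteq> ?g" using span_superset[of "insert (x0, c) g"] by blast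
  moreover have "(x0, c) \<in> ?g" by (simp add: span_base)
  moreover have "subspace ?g" by simp
  ultimately show ?thesis by metis
qed

lemma Hahn_Banach_norm:
  fixes v :: "'v::real_normed_vector"
  obtains f :: "'v \<Rightarrow> real" where "linear f" "f v = norm v" "\<And>x. \<bar>f x\<bar> \<le> norm x"
proof -
  define \<A> where "\<A> = {g :: ('v \<times> real) set. subspace g \<and> (\<forall>x t. (x, t) \<in> g \<longrightarrow> t \<le> norm x) \<and> (v, norm v) \<in> g}"
  have base: "span {(v, norm v)} \<in> \<A>"
  proof -
    have "t \<le> norm x" if xt: "(x, t) \<in> span {(v, norm v)}" for x t
    proof -
      obtain k where "(x, t) = k *\<^sub>R (v, norm v)" using xt unfolding span_singleton by blast
      then have "x = k *\<^sub>R v" "t = k * norm v" by auto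
      then show ?thesis by (simp add: mult_right_mono)
    qed
    then show ?thesis unfolding \<A>_def by (auto simp: span_base)
  qed
  have "\<exists>M\<in>\<A>. \<forall>X\<in>\<A>. M \<subseteq> X \<longrightarrow> X = M"
  proof (rule subset_Zorn_nonempty)
    show "\<A> \<noteq> {}" using base by blast
    fix C assume C: "C \<noteq> {}" "subset.chain \<A> C"
    then have sub: "g \<in> \<A>" if "g \<in> C" for g using that unfolding subset.chain_def by blast
    have tot: "g \<subseteq> h \<or> h \<subseteq> g" if "g \<in> C" "h \<in> C" for g h
      using C(2) that unfolding subset.chain_def by blast
    have "subspace (\<Union>C)"
      unfolding subspace_def
    proof (intro conjI ballI allI)
      obtain g where "g \<in> C" using C(1) by blast
      then have "0 \<in> g" using sub[of g] unfolding \<A>_def by (simp add: subspace_0)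
      then show "0 \<in> \<Union>C" using \<open>g \<in> C\<close> by blast
      fix x y assume "x \<in> \<Union>C" "y \<in> \<Union>C"
      then obtain g h where "g \<in> C" "x \<in> g" "h \<in> C" "y \<in> h" by blast
      then obtain k where "k \<in> C" "x \<in> k" "y \<in> k" using tot by blast
      then have "x + y \<in> k" using sub[of k] unfolding \<A>_def by (simp add: subspace_add)
      then show "x + y \<in> \<Union>C" using \<open>k \<in> C\<close> by blast
    next
      fix c x assume "x \<in> \<Union>C"
      then obtain g where "g \<in> C" "x \<in> g" by blast
      then have "c *\<^sub>R x \<in> g" using sub[of g] unfolding \<A>_def by (simp add: subspace_scale)
      then show "c *\<^sub>R x \<in> \<Union>C" using \<open>g \<in> C\<close> by blast
    qed
    moreover have "(v, norm v) \<in> \<Union>C" using C(1) sub unfolding \<A>_def by blast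
    moreover have "t \<le> norm x" if "(x, t) \<in> \<Union>C" for x t using that sub unfolding \<A>_def by blast
    ultimately show "\<Union>C \<in> \<A>" unfolding \<A>_def by blast
  qed
  then obtain g where g: "g \<in> \<A>" and mx: "\<And>X. X \<in> \<A> \<Longrightarrow> g \<subseteq> X \<Longrightarrow> X = g" by blast
  have sg: "subspace g" and dom: "\<And>x t. (x, t) \<in> g \<Longrightarrow> t \<le> norm x" and vg: "(v, norm v) \<in> g"
    using g unfolding \<A>_def by blast+
  have tot: "\<exists>t. (x, t) \<in> g" for x
  proof -
    obtain g' c where g': "subspace g'" "\<forall>x t. (x, t) \<in> g' \<longrightarrow> t \<le> norm x" "g \<subseteq> g'" "(x, c) \<in> g'"
      using Hahn_Banach_extend_line[OF sg dom, of x] by blast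
    then have "g' \<in> \<A>" using vg unfolding \<A>_def by blast
    then have "g' = g" using mx g'(3) by blast
    then show ?thesis using g'(4) by blast
  qed
  have uniq: "t = t'" if "(x, t) \<in> g" "(x, t') \<in> g" for x t t'
  proof -
    have "t - t' \<le> 0" using dom[of 0 "t - t'"] subspace_diff[OF sg that] by simp
    moreover have "t' - t \<le> 0" using dom[of 0 "t' - t"] subspace_diff[OF sg that(2,1)] by simp
    ultimately show ?thesis by simp
  qed
  define f where "f x = (THE t. (x, t) \<in> g)" for x
  have f: "(x, f x) \<in> g" for x
    unfolding f_def using tot[of x] uniq by (metis (mono_tags, lifting) theI')
  have feq: "f x = t" if "(x, t) \<in> g" for x t using uniq[OF f that] .
  have "linear f"
  proof (rule linearI)
    show "f (x + y) = f x + f y" for x y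
      using feq subspace_add[OF sg f[of x] f[of y]] by simp
    show "f (r *\<^sub>R x) = r *\<^sub>R f x" for r x
      using feq subspace_scale[OF sg f[of x], of r] by simp
  qed
  moreover have "\<bar>f x\<bar> \<le> norm x" for x
  proof -
    have "f x \<le> norm x" using dom[OF f] .
    moreover have "- f x \<le> norm x" using dom[of "-x" "- f x"] subspace_neg[OF sg f[of x]] by simp
    ultimately show ?thesis by simp
  qed
  ultimately show ?thesis using that feq[OF vg] by blast
qed

lemma closed_subspace_line_bound:
  fixes G :: "'v::real_normed_vector set"
  assumes G: "subspace G" "closed G" and v: "v \<notin> G"
  obtains d where "d > 0" "\<And>g t. g \<in> G \<Longrightarrow> \<bar>t\<bar> * d \<le> norm (g + t *\<^sub>R v)"
proof -
  have ne: "G \<noteq> {}" using subspace_0[OF G(1)] by blast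
  define d where "d = infdist v G"
  have d: "d > 0" unfolding d_def using in_closed_iff_infdist_zero[OF G(2) ne] v infdist_nonneg[of v G] by force
  have "\<bar>t\<bar> * d \<le> norm (g + t *\<^sub>R v)" if "g \<in> G" for g t
  proof (cases "t = 0")
    case False
    have "(- (1/t)) *\<^sub>R g \<in> G" using subspace_scale[OF G(1) that] .
    then have "d \<le> dist v ((- (1/t)) *\<^sub>R g)" unfolding d_def by (rule infdist_le)
    then have "\<bar>t\<bar> * d \<le> \<bar>t\<bar> * norm (v - (- (1/t)) *\<^sub>R g)"
      by (intro mult_left_mono) (simp_all add: dist_norm)
    also have "\<dots> = norm (t *\<^sub>R (v - (- (1/t)) *\<^sub>R g))" by simp
    also have "t *\<^sub>R (v - (- (1/t)) *\<^sub>R g) = g + t *\<^sub>R v" using False by (simp add: scaleR_add_right)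
    finally show ?thesis .
  qed simp
  then show ?thesis using that d by blast
qed

text \<open>Riesz lemma. The distance from \<open>v\<close> to \<open>G\<close> need not be
  attained, so \<open>g0\<close> is only within twice the distance; this is the factor 2.\<close>

lemma Riesz_almost_orthogonal:
  fixes G :: "'v::real_normed_vector set"
  assumes G: "subspace G" "closed G" and ne: "G \<noteq> UNIV"
  obtains u where "norm u = 1" "\<And>g t. g \<in> G \<Longrightarrow> \<bar>t\<bar> \<le> 2 * norm (g + t *\<^sub>R u)"
proof -
  have ne0: "G \<noteq> {}" using subspace_0[OF G(1)] by blast
  obtain v where v: "v \<notin> G" using ne by blast
  define d where "d = infdist v G"
  have d: "d > 0" unfolding d_def using in_closed_iff_infdist_zero[OF G(2) ne0] v infdist_nonneg[of v G] by force
  have "infdist v G < 2 * d" using d d_def by simp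
  then obtain g0 where g0: "g0 \<in> G" "dist v g0 < 2 * d"
    unfolding infdist_notempty[OF ne0] using ne0 by (subst (asm) cINF_less_iff) auto
  define r where "r = norm (v - g0)"
  have r: "0 < r" "r < 2 * d" using g0 v by (auto simp: r_def dist_norm)
  define u where "u = (1/r) *\<^sub>R (v - g0)"
  have "norm u = 1" using r by (simp add: u_def r_def)
  moreover have "\<bar>t\<bar> \<le> 2 * norm (g + t *\<^sub>R u)" if g: "g \<in> G" for g t
  proof (cases "t = 0")
    case False
    have "g0 - (r/t) *\<^sub>R g \<in> G" using subspace_diff[OF G(1) g0(1) subspace_scale[OF G(1) g]] .
    then have "d \<le> dist v (g0 - (r/t) *\<^sub>R g)" unfolding d_def by (rule infdist_le)
    also have "\<dots> = norm ((r/t) *\<^sub>R (g + t *\<^sub>R u))"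
      using False r by (simp add: dist_norm u_def scaleR_add_right algebra_simps)
    also have "\<dots> = r / \<bar>t\<bar> * norm (g + t *\<^sub>R u)" using r by simp
    finally have "\<bar>t\<bar> * d \<le> r * norm (g + t *\<^sub>R u)" using False by (simp add: field_simps)
    also have "\<dots> \<le> 2 * d * norm (g + t *\<^sub>R u)" using r by (intro mult_right_mono) auto
    finally show ?thesis using d by simp
  qed simp
  ultimately show ?thesis using that by blast
qed

text \<open>As \<open>v\<close> has positive distance from \<open>G\<close>, the coefficients
  \<open>t\<close> of a convergent sequence are Cauchy, and the limit splits accordingly. Only
  completeness of the reals enters.\<close>

lemma closed_add_line:
  fixes G :: "'v::real_normed_vector set"
  assumes G: "subspace G" "closed G"
  shows "closed {g + t *\<^sub>R v | g t. g \<in> G}"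
proof (cases "v \<in> G")
  case True
  have "{g + t *\<^sub>R v | g t. g \<in> G} = G"
  proof (intro equalityI subsetI)
    fix x assume "x \<in> {g + t *\<^sub>R v | g t. g \<in> G}"
    then obtain g t where "g \<in> G" "x = g + t *\<^sub>R v" by blast
    then show "x \<in> G" using subspace_add[OF G(1) _ subspace_scale[OF G(1) True]] by simp
  next
    fix x assume "x \<in> G"
    moreover have "x = x + 0 *\<^sub>R v" by simp
    ultimately show "x \<in> {g + t *\<^sub>R v | g t. g \<in> G}" by blast
  qed
  then show ?thesis using G by simp
next
  case False
  obtain d where d: "d > 0" "\<And>g t. g \<in> G \<Longrightarrow> \<bar>t\<bar> * d \<le> norm (g + t *\<^sub>R v)"
    using closed_subspace_line_bound[OF G False] by blast
  show ?thesis
    unfolding closed_sequential_limits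
  proof (intro allI impI)
    fix x l assume "(\<forall>n. x n \<in> {g + t *\<^sub>R v | g t. g \<in> G}) \<and> x \<longlonglongrightarrow> l"
    then have x: "\<forall>n. \<exists>g t. x n = g + t *\<^sub>R v \<and> g \<in> G" and l: "x \<longlonglongrightarrow> l" by auto
    obtain g t where gt: "\<And>n. x n = g n + t n *\<^sub>R v" "\<And>n. g n \<in> G" using x by metis
    have bd: "\<bar>t m - t n\<bar> * d \<le> norm (x m - x n)" for m n
    proof -
      have "x m - x n = (g m - g n) + (t m - t n) *\<^sub>R v" by (simp add: gt algebra_simps)
      then show ?thesis using d(2)[OF subspace_diff[OF G(1) gt(2) gt(2)]] by simp
    qed
    have "Cauchy t"
    proof (rule metric_CauchyI)
      fix e :: real assume "0 < e"
      then have "0 < e * d" using d by simp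
      then obtain M where M: "\<And>m n. m \<ge> M \<Longrightarrow> n \<ge> M \<Longrightarrow> dist (x m) (x n) < e * d"
        using metric_CauchyD[OF LIMSEQ_imp_Cauchy[OF l]] by metis
      have "dist (t m) (t n) < e" if "m \<ge> M" "n \<ge> M" for m n
      proof -
        have "\<bar>t m - t n\<bar> * d < e * d" using bd[of m n] M[OF that] by (simp add: dist_norm)
        then show ?thesis using d by (simp add: dist_norm)
      qed
      then show "\<exists>M. \<forall>m\<ge>M. \<forall>n\<ge>M. dist (t m) (t n) < e" by blast
    qed
    then obtain s where s: "t \<longlonglongrightarrow> s" using Cauchy_convergent_iff convergent_def by metis
    have "(\<lambda>n. x n - t n *\<^sub>R v) \<longlonglongrightarrow> l - s *\<^sub>R v" by (intro tendsto_intros l s)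
    moreover have "x n - t n *\<^sub>R v \<in> G" for n using gt by simp
    ultimately have "l - s *\<^sub>R v \<in> G" using closed_sequentially[OF G(2)] by presburger
    moreover have "l = (l - s *\<^sub>R v) + s *\<^sub>R v" by simp
    ultimately show "l \<in> {g + t *\<^sub>R v | g t. g \<in> G}" by blast
  qed
qed

lemma has_dim_Suc_split:
  assumes "has_dim H (Suc k)"
  obtains H' v where "has_dim H' k" "v \<notin> H'" "H = {h + t *\<^sub>R v | h t. h \<in> H'}"
proof -
  obtain B where B: "finite B" "independent B" "card B = Suc k" "span B = H"
    using assms unfolding has_dim_def by auto
  obtain v D where D: "B = insert v D" "v \<notin> D" using card_eq_SucD[OF B(3)] by blast
  have i: "independent D" "v \<notin> span D" using B(2) D by (simp_all add: independent_insert)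
  have d: "has_dim (span D) k" unfolding has_dim_def using i B D by auto
  have "H = {h + t *\<^sub>R v | h t. h \<in> span D}"
  proof (intro equalityI subsetI)
    fix x assume "x \<in> H"
    then obtain s where "x - s *\<^sub>R v \<in> span D" using B(4) unfolding D span_insert by auto
    moreover have "x = (x - s *\<^sub>R v) + s *\<^sub>R v" by simp
    ultimately show "x \<in> {h + t *\<^sub>R v | h t. h \<in> span D}" by blast
  next
    fix x assume "x \<in> {h + t *\<^sub>R v | h t. h \<in> span D}"
    then obtain h s where hs: "h \<in> span D" "x = h + s *\<^sub>R v" by blast
    have "h \<in> span B" using hs(1) span_mono[of D B] D by blast
    moreover have "s *\<^sub>R v \<in> span B" by (intro span_scale span_base) (simp add: D)
    ultimately have "h + s *\<^sub>R v \<in> span B" by (rule span_add)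
    then show "x \<in> H" unfolding hs(2) B(4) .
  qed
  then show ?thesis using that d i by blast
qed

lemma has_dim_closed:
  fixes E :: "'v::real_normed_vector set"
  shows "has_dim E k \<Longrightarrow> closed E"
proof (induction k arbitrary: E)
  case 0
  then show ?case by (simp add: has_dim_0_iff)
next
  case (Suc k)
  obtain H v where H: "has_dim H k" "v \<notin> H" "E = {h + t *\<^sub>R v | h t. h \<in> H}"
    by (rule has_dim_Suc_split[OF Suc.prems])
  show ?case unfolding H(3) by (rule closed_add_line[OF has_dim_subspace[OF H(1)] Suc.IH[OF H(1)]])
qed

text \<open>Induction moves one line of \<open>H\<close> over to \<open>F\<close>, which keeps
  \<open>F\<close> closed. The constant comes without any uniformity in \<open>H\<close> and
  \<open>F\<close>; for continuous families, compactness restores it later.\<close>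

lemma angle_bound_exists:
  fixes H F :: "'v::real_normed_vector set"
  assumes "has_dim H k" "subspace F" "closed F" "\<And>v. v \<in> H \<Longrightarrow> v \<in> F \<Longrightarrow> v = 0"
  shows "\<exists>P\<ge>0. \<forall>h\<in>H. \<forall>f\<in>F. norm h \<le> P * norm (h + f)"
  using assms
proof (induction k arbitrary: H F)
  case 0
  then show ?case by (intro exI[of _ 0]) (auto simp: has_dim_0_iff)
next
  case (Suc k)
  obtain H' v where H': "has_dim H' k" "v \<notin> H'" "H = {h + t *\<^sub>R v | h t. h \<in> H'}"
    by (rule has_dim_Suc_split[OF Suc.prems(1)])
  have sH': "subspace H'" using H'(1) by (rule has_dim_subspace)
  have "v = 0 + 1 *\<^sub>R v" by simp
  then have vH: "v \<in> H" using H'(3) subspace_0[OF sH'] by blast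
  have vF: "v \<notin> F" using Suc.prems(4)[OF vH] H'(2) subspace_0[OF sH'] by auto
  obtain d where d: "d > 0" "\<And>g t. g \<in> F \<Longrightarrow> \<bar>t\<bar> * d \<le> norm (g + t *\<^sub>R v)"
    using closed_subspace_line_bound[OF Suc.prems(2,3) vF] by blast
  let ?F = "{g + t *\<^sub>R v | g t. g \<in> F}"
  have "?F = span (insert v F)"
  proof (intro equalityI subsetI)
    fix x assume "x \<in> ?F"
    then obtain g t where "g \<in> F" "x = g + t *\<^sub>R v" by blast
    then show "x \<in> span (insert v F)" by (simp add: span_add span_base span_scale)
  next
    fix x assume "x \<in> span (insert v F)"
    then obtain s where "x - s *\<^sub>R v \<in> F"
      unfolding span_insert span_eq_iff[THEN iffD2, OF Suc.prems(2)] by blast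
    moreover have "x = (x - s *\<^sub>R v) + s *\<^sub>R v" by simp
    ultimately show "x \<in> ?F" by blast
  qed
  then have sF: "subspace ?F" by simp
  have tr: "w = 0" if w1: "w \<in> H'" and w2: "w \<in> ?F" for w
  proof -
    obtain g t where gt: "g \<in> F" "w = g + t *\<^sub>R v" using w2 by blast
    have "g = w + (- t) *\<^sub>R v" using gt by simp
    then have "g \<in> H" using w1 H'(3) by blast
    then have "g = 0" using Suc.prems(4) gt(1) by blast
    then have w: "w = t *\<^sub>R v" using gt by simp
    have "t = 0"
    proof (rule ccontr)
      assume "t \<noteq> 0"
      then have "v = (1/t) *\<^sub>R w" using w by simp
      then show False using H'(2) subspace_scale[OF sH' w1] by simp
    qed
    then show ?thesis using w by simp
  qed
  obtain P where P: "P \<ge> 0" "\<And>h f. h \<in> H' \<Longrightarrow> f \<in> ?F \<Longrightarrow> norm h \<le> P * norm (h + f)"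
    using Suc.IH[OF H'(1) sF closed_add_line[OF Suc.prems(2,3)] tr] by blast
  have "norm h \<le> (P + (1 + P) * norm v / d) * norm (h + f)" if h: "h \<in> H" and f: "f \<in> F" for h f
  proof -
    obtain h' t where ht: "h' \<in> H'" "h = h' + t *\<^sub>R v" using h H'(3) by blast
    have "f + t *\<^sub>R v \<in> ?F" using f by blast
    from P(2)[OF ht(1) this] have 1: "norm h' \<le> P * norm (h + f)" using ht by (simp add: algebra_simps)
    have "\<bar>t\<bar> * d \<le> norm (f + t *\<^sub>R v)" using d(2)[OF f] .
    also have "f + t *\<^sub>R v = (h + f) - h'" using ht by simp
    also have "norm \<dots> \<le> norm (h + f) + norm h'" by (rule norm_triangle_ineq4)
    also have "\<dots> \<le> (1 + P) * norm (h + f)" using 1 by (simp add: algebra_simps)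
    finally have "\<bar>t\<bar> \<le> (1 + P) * norm (h + f) / d" using d by (simp add: field_simps)
    then have "\<bar>t\<bar> * norm v \<le> (1 + P) * norm (h + f) / d * norm v" by (rule mult_right_mono) simp
    moreover have "norm h \<le> norm h' + \<bar>t\<bar> * norm v" using norm_triangle_ineq[of h' "t *\<^sub>R v"] ht by simp
    ultimately show ?thesis using 1 by (simp add: algebra_simps)
  qed
  moreover have "0 \<le> P + (1 + P) * norm v / d" using P d by simp
  ultimately show ?case by blast
qed

text \<open>Here the constant depends on \<open>k\<close> alone, which makes complements of slow
  spaces comparable for all base points and times. Each almost orthogonal line split off turns a
  bound \<open>a\<close> into \<open>3 * a + 2\<close>, and \<open>3 ^ k - 1\<close> solves this
  recursion from \<open>0\<close>.\<close>

lemma Riesz_complement: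
  fixes G :: "'v::real_normed_vector set"
  assumes "closed G" "has_codim G k"
  shows "\<exists>H. has_dim H k \<and> complementary H G \<and> (\<forall>h\<in>H. \<forall>g\<in>G. norm h \<le> (3 ^ k - 1) * norm (h + g))"
  using assms
proof (induction k arbitrary: G)
  case 0
  then have "G = UNIV" by (simp add: has_codim_0_iff)
  then have "complementary {0::'v} G" unfolding complementary_def by (simp add: subspace_single_0)
  then show ?case using has_dim_0 by (intro exI[of _ "{0}"]) auto
next
  case (Suc k)
  have sG: "subspace G" using Suc.prems(2) by (rule has_codim_subspace)
  have "G \<noteq> UNIV"
  proof
    assume "G = UNIV"
    then have "has_codim G 0" using has_codim_0 by simp
    moreover obtain W where W: "complementary W G" "has_dim W (Suc k)"
      using Suc.prems(2) has_codim_iff by blast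
    ultimately have "W = {0}" using \<open>G = UNIV\<close> complementaryD(3)[OF W(1)] by simp
    then show False using W(2) has_dim_0 has_dim_unique by blast
  qed
  then obtain u where u: "norm u = 1" "\<And>g t. g \<in> G \<Longrightarrow> \<bar>t\<bar> \<le> 2 * norm (g + t *\<^sub>R u)"
    using Riesz_almost_orthogonal[OF sG Suc.prems(1)] by metis
  have uG: "u \<notin> G"
  proof
    assume "u \<in> G"
    from u(2)[OF subspace_scale[OF sG this, of "-1"], of 1] show False by simp
  qed
  let ?G = "{g + t *\<^sub>R u | g t. g \<in> G}"
  obtain H where H: "has_dim H k" "complementary H ?G"
    "\<And>h g. h \<in> H \<Longrightarrow> g \<in> ?G \<Longrightarrow> norm h \<le> (3 ^ k - 1) * norm (h + g)"
    using Suc.IH[OF closed_add_line[OF sG Suc.prems(1)] has_codim_add_line[OF Suc.prems(2) uG]] by blast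
  have "u = 0 + 1 *\<^sub>R u" by simp
  then have "u \<in> ?G" using subspace_0[OF sG] by blast
  then have uH: "u \<notin> H" using complementary_eq_0[OF H(2)] u(1) by fastforce
  let ?H = "{h + t *\<^sub>R u | h t. h \<in> H}"
  have dH: "has_dim ?H (Suc k)" using has_dim_insert[OF H(1) uH] .
  have bound: "norm x \<le> (3 ^ Suc k - 1) * norm (x + g)" if x: "x \<in> ?H" and g: "g \<in> G" for x g
  proof -
    obtain h t where ht: "h \<in> H" "x = h + t *\<^sub>R u" using x by blast
    have "g + t *\<^sub>R u \<in> ?G" using g by blast
    from H(3)[OF ht(1) this] have 1: "norm h \<le> (3 ^ k - 1) * norm (x + g)"
      using ht by (simp add: algebra_simps)
    have "\<bar>t\<bar> \<le> 2 * norm (g + t *\<^sub>R u)" using u(2)[OF g] .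
    also have "g + t *\<^sub>R u = (x + g) - h" using ht by simp
    also have "norm \<dots> \<le> norm (x + g) + norm h" by (rule norm_triangle_ineq4)
    finally have "\<bar>t\<bar> \<le> 2 * (norm (x + g) + norm h)" by simp
    moreover have "norm x \<le> norm h + \<bar>t\<bar>" using norm_triangle_ineq[of h "t *\<^sub>R u"] ht u by simp
    ultimately have "norm x \<le> 3 * norm h + 2 * norm (x + g)" by simp
    then show ?thesis using 1 by (simp add: algebra_simps)
  qed
  have "v = 0" if "v \<in> ?H" "v \<in> G" for v
    using bound[OF that(1) subspace_neg[OF sG that(2)]] by simp
  then have "complementary ?H G" using complementary_if_trivial_inter[OF Suc.prems(2) dH] by blast
  then show ?case using dH bound by blast
qed

text \<open>Gelfand numbers use subspaces of one exact codimension, while preimages may have a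
  smaller one. Intersecting with the kernel of a bounded functional that does not vanish on
  \<open>G'\<close> raises the codimension by one and keeps the space closed.\<close>

lemma closed_codim_subspace_exists:
  fixes G :: "'v::real_normed_vector set"
  assumes "closed G" "has_codim G i" "i \<le> j" "enat j \<le> edim (UNIV :: 'v set)"
  shows "\<exists>G'. G' \<subseteq> G \<and> subspace G' \<and> closed G' \<and> has_codim G' j"
  using assms(3,4)
proof (induction j rule: dec_induct)
  case base
  then show ?case using assms has_codim_subspace by blast
next
  case (step j)
  have "enat j \<le> edim (UNIV :: 'v set)" using step.prems by (meson enat_ord_simps(1) le_SucI order_refl order_trans)
  then obtain G' where G': "G' \<subseteq> G" "subspace G'" "closed G'" "has_codim G' j" using step.IH by blast
  have "G' \<noteq> {0}"
  proof
    assume a: "G' = {0}"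
    obtain W where W: "complementary W G'" "has_dim W j" using G'(4) has_codim_iff by blast
    have "v \<in> W" for v using complementaryD(4)[OF W(1), of v] a by auto
    then have "W = UNIV" by blast
    then have "edim (UNIV :: 'v set) = enat j" using W(2) edim_eq_iff_has_dim[OF subspace_UNIV] by blast
    then show False using step.prems by simp
  qed
  then obtain v where v: "v \<in> G'" "v \<noteq> 0" using subspace_0[OF G'(2)] by blast
  obtain f :: "'v \<Rightarrow> real" where f: "linear f" "f v = norm v" "\<And>x. \<bar>f x\<bar> \<le> norm x"
    using Hahn_Banach_norm by blast
  have bl: "bounded_linear f" using f by (intro bounded_linear_intro[of _ 1]) (auto simp: linear_add linear_scale)
  let ?G = "{g \<in> G'. f g = 0}"
  have "?G = G' \<inter> f -` {0}" by auto
  moreover have "closed (f -` {0})"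
    using bl by (intro closed_vimage) (auto intro: bounded_linear.continuous_on continuous_on_id)
  ultimately have "closed ?G" using G'(3) by auto
  moreover have "has_codim ?G (Suc j)" using has_codim_inter_kernel[OF G'(4) f(1) v(1)] f v by simp
  moreover from this have "subspace ?G" by (intro has_codim_subspace)
  moreover have "?G \<subseteq> G" using G'(1) by auto
  ultimately show ?case by (intro exI[of _ ?G] conjI)
qed

section \<open>Biorthogonal coordinates on finite-dimensional subspaces\<close>

definition coordinates ::
  "nat \<Rightarrow> 'v::real_normed_vector set \<Rightarrow> (nat \<Rightarrow> 'v) \<Rightarrow> (nat \<Rightarrow> 'v \<Rightarrow> real) \<Rightarrow> bool" where
  "coordinates k E e l \<longleftrightarrow>
    (\<forall>i<k. e i \<in> E \<and> norm (e i) = 1 \<and> linear (l i) \<and> (\<forall>v. \<bar>l i v\<bar> \<le> 2 ^ k * norm v)) \<and>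
    (\<forall>i<k. \<forall>j<k. l i (e j) = (if i = j then 1 else 0)) \<and>
    (\<forall>v\<in>E. v = (\<Sum>i<k. l i v *\<^sub>R e i))"

lemma coordinatesD:
  assumes "coordinates k E e l"
  shows "i < k \<Longrightarrow> e i \<in> E" "i < k \<Longrightarrow> norm (e i) = 1" "i < k \<Longrightarrow> linear (l i)"
    "i < k \<Longrightarrow> \<bar>l i v\<bar> \<le> 2 ^ k * norm v"
    "i < k \<Longrightarrow> j < k \<Longrightarrow> l i (e j) = (if i = j then 1 else 0)"
    "v \<in> E \<Longrightarrow> (\<Sum>i<k. l i v *\<^sub>R e i) = v"
  using assms unfolding coordinates_def by simp_all

text \<open>A crude Auerbach basis. A unit vector \<open>v\<close> is split off with a norming
  functional \<open>f\<close>; the projection \<open>p\<close> along \<open>v\<close> has norm at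
  most 2 and is applied before the older functionals, so their bound doubles in every step. The
  functionals live on the whole space and therefore also yield a bounded projection onto
  \<open>E\<close>.\<close>

lemma bounded_coordinates:
  fixes E :: "'v::real_normed_vector set"
  assumes "has_dim E k"
  obtains e l where "coordinates k E e l"
proof -
  have "\<exists>e l. coordinates k E e l"
    using assms
  proof (induction k arbitrary: E)
    case 0
    then show ?case by (auto simp: has_dim_0_iff coordinates_def)
  next
    case (Suc k)
    have sE: "subspace E" using Suc.prems by (rule has_dim_subspace)
    have "E \<noteq> {0}" using Suc.prems has_dim_0 has_dim_unique by blast
    then obtain v0 where v0: "v0 \<in> E" "v0 \<noteq> 0" using subspace_0[OF sE] by blast
    define v where "v = (1 / norm v0) *\<^sub>R v0"
    have v: "v \<in> E" "norm v = 1" using v0 subspace_scale[OF sE v0(1)] by (simp_all add: v_def)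
    obtain f :: "'v \<Rightarrow> real" where f: "linear f" "f v = norm v" "\<And>x. \<bar>f x\<bar> \<le> norm x"
      using Hahn_Banach_norm by blast
    have fv: "f v = 1" using f v by simp
    note fl = linear_add[OF f(1)] linear_scale[OF f(1)] linear_diff[OF f(1)] linear_0[OF f(1)]
    define E' where "E' = {e \<in> E. f e = 0}"
    have sE': "subspace E'" unfolding E'_def subspace_def using sE
      by (simp add: fl subspace_0 subspace_add subspace_scale)
    have "id ` E' \<subseteq> E" unfolding E'_def by auto
    then obtain i where i: "has_dim E' i"
      using has_dim_inj[of id E' E "Suc k"] sE' Suc.prems by (metis id_apply linear_id)
    have vE': "v \<notin> E'" unfolding E'_def using fv by simp
    have "{h + t *\<^sub>R v | h t. h \<in> E'} = E"
    proof (intro equalityI subsetI)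
      fix x assume "x \<in> {h + t *\<^sub>R v | h t. h \<in> E'}"
      then obtain h t where "h \<in> E" "x = h + t *\<^sub>R v" unfolding E'_def by blast
      then show "x \<in> E" using subspace_add[OF sE _ subspace_scale[OF sE v(1)]] by simp
    next
      fix x assume x: "x \<in> E"
      have "x - f x *\<^sub>R v \<in> E'" unfolding E'_def
        using subspace_diff[OF sE x subspace_scale[OF sE v(1)]] by (simp add: fl fv)
      moreover have "x = (x - f x *\<^sub>R v) + f x *\<^sub>R v" by simp
      ultimately show "x \<in> {h + t *\<^sub>R v | h t. h \<in> E'}" by blast
    qed
    then have "has_dim E (Suc i)" using has_dim_insert[OF i vE'] by simp
    then have "i = k" using has_dim_unique[OF Suc.prems] by blast
    then have dE': "has_dim E' k" using i by simp
    obtain e l where IH: "coordinates k E' e l" using Suc.IH[OF dE'] by blast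
    note el = coordinatesD(1-4)[OF IH] and dual = coordinatesD(5)[OF IH] and exp = coordinatesD(6)[OF IH]
    define p where "p x = x - f x *\<^sub>R v" for x
    have linp: "linear p" unfolding p_def
      by (rule linearI) (simp_all add: fl algebra_simps)
    have np: "norm (p x) \<le> 2 * norm x" for x
    proof -
      have "norm (p x) \<le> norm x + \<bar>f x\<bar>" unfolding p_def using norm_triangle_ineq4[of x "f x *\<^sub>R v"] v by simp
      then show ?thesis using f(3)[of x] by simp
    qed
    define e' where "e' i = (if i < k then e i else v)" for i
    define l' where "l' i x = (if i < k then l i (p x) else f x)" for i x
    have pe: "p (e i) = e i" if "i < k" for i using el(1)[OF that] unfolding p_def E'_def by simp
    have pv: "p v = 0" unfolding p_def using fv by simp
    have "e' i \<in> E \<and> norm (e' i) = 1 \<and> linear (l' i) \<and> (\<forall>v. \<bar>l' i v\<bar> \<le> 2 ^ Suc k * norm v)"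
      if "i < Suc k" for i
    proof (cases "i < k")
      case True
      have "linear (\<lambda>x. l i (p x))" using linear_compose[OF linp el(3)[OF True]] by (simp add: o_def)
      moreover have "\<bar>l i (p x)\<bar> \<le> 2 ^ Suc k * norm x" for x
      proof -
        have "\<bar>l i (p x)\<bar> \<le> 2 ^ k * norm (p x)" by (rule el(4)[OF True])
        also have "\<dots> \<le> 2 ^ k * (2 * norm x)" using np by (intro mult_left_mono) auto
        finally show ?thesis by simp
      qed
      ultimately show ?thesis using el(1,2)[OF True] True unfolding e'_def l'_def E'_def by simp
    next
      case False
      have "\<bar>f x\<bar> \<le> 2 ^ Suc k * norm x" for x
      proof -
        have "1 * norm x \<le> 2 ^ Suc k * norm x" by (intro mult_right_mono one_le_power) auto
        then show ?thesis using f(3)[of x] by simp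
      qed
      then show ?thesis using v f(1) False unfolding e'_def l'_def by simp
    qed
    moreover have "l' i (e' j) = (if i = j then 1 else 0)" if "i < Suc k" "j < Suc k" for i j
    proof -
      have z: "l i 0 = 0" if "i < k" using linear_0[OF el(3)[OF that]] .
      have "f (e j) = 0" if "j < k" using el(1)[OF that] unfolding E'_def by simp
      then show ?thesis using that dual[of i j] pe[of j] pv fv z unfolding l'_def e'_def by auto
    qed
    moreover have "x = (\<Sum>i<Suc k. l' i x *\<^sub>R e' i)" if x: "x \<in> E" for x
    proof -
      have "p x \<in> E'" unfolding E'_def p_def
        using subspace_diff[OF sE x subspace_scale[OF sE v(1)]] by (simp add: fl fv)
      then have "p x = (\<Sum>i<k. l i (p x) *\<^sub>R e i)" by (rule exp[symmetric])
      also have "\<dots> = (\<Sum>i<k. l' i x *\<^sub>R e' i)" by (intro sum.cong) (auto simp: l'_def e'_def)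
      finally have "x = (\<Sum>i<k. l' i x *\<^sub>R e' i) + f x *\<^sub>R v" unfolding p_def by (simp add: algebra_simps)
      then show ?thesis by (simp add: l'_def e'_def)
    qed
    ultimately show ?case unfolding coordinates_def by (intro exI[of _ e'] exI[of _ l'] conjI) blast+
  qed
  then show ?thesis using that by blast
qed

subsection \<open>Gap and angle between subspaces\<close>

text \<open>One-sided gap between subspaces in homogeneous form. Without normalisation to unit
  spheres it composes easily; below 1 it is comparable to \<open>grass_dist\<close> up to a factor
  2.\<close>

definition near :: "real \<Rightarrow> 'v::real_normed_vector set \<Rightarrow> 'v set \<Rightarrow> bool" where
  "near \<epsilon> G G' \<longleftrightarrow> (\<forall>g\<in>G. \<exists>g'\<in>G'. norm (g - g') \<le> \<epsilon> * norm g)"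

text \<open>\<open>P\<close> bounds the projection of \<open>E + F\<close> onto \<open>E\<close>
  along \<open>F\<close>, and so measures how far the two spaces are from sharing a
  direction.\<close>

definition angle_bound :: "real \<Rightarrow> 'v::real_normed_vector set \<Rightarrow> 'v set \<Rightarrow> bool" where
  "angle_bound P E F \<longleftrightarrow> (\<forall>e\<in>E. \<forall>f\<in>F. norm e \<le> P * norm (e + f))"

lemma nearE:
  assumes "near \<epsilon> G G'" "g \<in> G"
  obtains g' where "g' \<in> G'" "norm (g - g') \<le> \<epsilon> * norm g"
  using assms unfolding near_def by blast

lemma near_mono: "near a G G' \<Longrightarrow> a \<le> b \<Longrightarrow> near b G G'"
  unfolding near_def by (meson mult_right_mono norm_ge_zero order_trans)

lemma near_refl: "0 \<le> \<epsilon> \<Longrightarrow> near \<epsilon> G G"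
  unfolding near_def by (metis diff_self mult_nonneg_nonneg norm_ge_zero norm_zero)

lemma near_trans:
  assumes "near a G G'" "near b G' G''" "0 \<le> b"
  shows "near (a + b * (1 + a)) G G''"
  unfolding near_def
proof
  fix g assume "g \<in> G"
  then obtain g' where g': "g' \<in> G'" "norm (g - g') \<le> a * norm g" using nearE[OF assms(1)] by blast
  obtain g'' where g'': "g'' \<in> G''" "norm (g' - g'') \<le> b * norm g'" using assms(2) g'(1) by (rule nearE)
  have "norm g' \<le> norm g + norm (g - g')" using norm_triangle_ineq4[of g "g - g'"] by simp
  then have "b * norm g' \<le> b * ((1 + a) * norm g)"
    using g' assms(3) by (intro mult_left_mono) (auto simp: algebra_simps)
  moreover have "norm (g - g'') \<le> norm (g - g') + norm (g' - g'')"
    using norm_triangle_ineq[of "g - g'" "g' - g''"] by simp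
  ultimately have "norm (g - g'') \<le> (a + b * (1 + a)) * norm g"
    using g' g'' by (simp add: algebra_simps)
  then show "\<exists>g''\<in>G''. norm (g - g'') \<le> (a + b * (1 + a)) * norm g" using g'' by blast
qed

lemma near_trans_le:
  assumes "near a G G'" "near b G' G''" "0 \<le> b" "a \<le> 1"
  shows "near (a + 2 * b) G G''"
proof (rule near_mono[OF near_trans[OF assms(1-3)]])
  have "b * (1 + a) \<le> b * 2" using assms by (intro mult_left_mono) auto
  then show "a + b * (1 + a) \<le> a + 2 * b" by simp
qed

lemma angle_boundD: "angle_bound P E F \<Longrightarrow> e \<in> E \<Longrightarrow> f \<in> F \<Longrightarrow> norm e \<le> P * norm (e + f)"
  unfolding angle_bound_def by blast

lemma angle_bound_mono: "angle_bound P E F \<Longrightarrow> P \<le> Q \<Longrightarrow> angle_bound Q E F"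
  unfolding angle_bound_def by (meson mult_right_mono norm_ge_zero order_trans)

lemma angle_bound_snd:
  assumes "angle_bound P E F" "e \<in> E" "f \<in> F"
  shows "norm f \<le> (1 + P) * norm (e + f)"
proof -
  have "norm f \<le> norm (e + f) + norm e" using norm_triangle_ineq4[of "e + f" e] by simp
  then show ?thesis using angle_boundD[OF assms] by (simp add: algebra_simps)
qed

text \<open>Replacing \<open>e\<close> and \<open>f\<close> by their approximants produces errors in
  \<open>norm e\<close> and \<open>norm (e + f)\<close>. The threshold \<open>1/8\<close> lets the
  left side absorb the former, which leaves \<open>9/5 * P\<close>, below
  \<open>2 * P\<close>.\<close>

lemma angle_bound_near:
  assumes ang: "angle_bound P E F" and nE: "near \<epsilon> E' E" and nF: "near \<epsilon> F' F"
    and P: "1 \<le> P" and \<epsilon>: "0 \<le> \<epsilon>" "P * \<epsilon> \<le> 1/8"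
  shows "angle_bound (2 * P) E' F'"
  unfolding angle_bound_def
proof (intro ballI)
  fix e f assume e: "e \<in> E'" and f: "f \<in> F'"
  obtain e0 where e0: "e0 \<in> E" "norm (e - e0) \<le> \<epsilon> * norm e" using nE e by (rule nearE)
  obtain f0 where f0: "f0 \<in> F" "norm (f - f0) \<le> \<epsilon> * norm f" using nF f by (rule nearE)
  have e8: "\<epsilon> \<le> 1/8" using mult_right_mono[OF P \<epsilon>(1)] \<epsilon>(2) by (simp only: mult_1)
  have nf: "norm f \<le> norm (e + f) + norm e" using norm_triangle_ineq4[of "e + f" e] by simp
  have "norm e \<le> norm e0 + norm (e - e0)" using norm_triangle_ineq[of e0 "e - e0"] by simp
  then have 1: "norm e \<le> norm e0 + \<epsilon> * norm e" using e0 by simp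
  have "norm e0 \<le> P * norm (e0 + f0)" using angle_boundD[OF ang e0(1) f0(1)] .
  also have "norm (e0 + f0) \<le> norm (e + f) + (norm (e - e0) + norm (f - f0))"
  proof -
    have "norm ((e + f) - ((e - e0) + (f - f0))) \<le> norm (e + f) + norm ((e - e0) + (f - f0))"
      by (rule norm_triangle_ineq4)
    moreover have "(e + f) - ((e - e0) + (f - f0)) = e0 + f0" by simp
    ultimately show ?thesis using norm_triangle_ineq[of "e - e0" "f - f0"] by simp
  qed
  also have "\<dots> \<le> norm (e + f) + (\<epsilon> * norm e + \<epsilon> * (norm (e + f) + norm e))"
  proof -
    have "\<epsilon> * norm f \<le> \<epsilon> * (norm (e + f) + norm e)" using nf \<epsilon> by (intro mult_left_mono)
    then show ?thesis using e0 f0 by simp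
  qed
  finally have "norm e0 \<le> P * (norm (e + f) + (\<epsilon> * norm e + \<epsilon> * (norm (e + f) + norm e)))"
    using P by simp
  also have "\<dots> = P * norm (e + f) + 2 * (P * \<epsilon>) * norm e + (P * \<epsilon>) * norm (e + f)"
    by (simp add: algebra_simps)
  also have "\<dots> \<le> P * norm (e + f) + 2 * (1/8) * norm e + (1/8 * P) * norm (e + f)"
    using P \<epsilon> e8 by (intro add_mono mult_right_mono) auto
  finally have "norm e0 \<le> 9/8 * (P * norm (e + f)) + 1/4 * norm e" by simp
  moreover have "\<epsilon> * norm e \<le> 1/8 * norm e" using e8 by (intro mult_right_mono) auto
  ultimately have "5/8 * norm e \<le> 9/8 * (P * norm (e + f))" using 1 by simp
  moreover have "0 \<le> P * norm (e + f)" using P by simp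
  ultimately show "norm e \<le> 2 * P * norm (e + f)" by simp
qed

lemma closed_add_has_dim:
  fixes H G :: "'v::real_normed_vector set"
  assumes "has_dim H k" "subspace G" "closed G"
  shows "closed {h + g | h g. h \<in> H \<and> g \<in> G}"
  using assms
proof (induction k arbitrary: H)
  case 0
  then have "{h + g | h g. h \<in> H \<and> g \<in> G} = G" by (auto simp: has_dim_0_iff)
  then show ?case using 0 by simp
next
  case (Suc k)
  obtain H' v where H': "has_dim H' k" "v \<notin> H'" "H = {h + t *\<^sub>R v | h t. h \<in> H'}"
    by (rule has_dim_Suc_split[OF Suc.prems(1)])
  let ?S = "{h + g | h g. h \<in> H' \<and> g \<in> G}"
  have "subspace ?S" using subspace_sums[OF has_dim_subspace[OF H'(1)] Suc.prems(2)] .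
  moreover have "closed ?S" using Suc.IH[OF H'(1) Suc.prems(2,3)] .
  ultimately have "closed {x + t *\<^sub>R v | x t. x \<in> ?S}" by (rule closed_add_line)
  moreover have "{x + t *\<^sub>R v | x t. x \<in> ?S} = {h + g | h g. h \<in> H \<and> g \<in> G}"
  proof (intro equalityI subsetI)
    fix y assume "y \<in> {x + t *\<^sub>R v | x t. x \<in> ?S}"
    then obtain h g t where *: "y = (h + g) + t *\<^sub>R v" "h \<in> H'" "g \<in> G" by blast
    have "y = (h + t *\<^sub>R v) + g" using * by simp
    moreover have "h + t *\<^sub>R v \<in> H" unfolding H'(3) using * by blast
    ultimately show "y \<in> {h + g | h g. h \<in> H \<and> g \<in> G}" using * by blast
  next
    fix y assume "y \<in> {h + g | h g. h \<in> H \<and> g \<in> G}"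
    then obtain h g t where *: "y = (h + t *\<^sub>R v) + g" "h \<in> H'" "g \<in> G" unfolding H'(3) by blast
    have "y = (h + g) + t *\<^sub>R v" using * by simp
    then show "y \<in> {x + t *\<^sub>R v | x t. x \<in> ?S}" using * by blast
  qed
  ultimately show ?case by simp
qed

text \<open>The sum of \<open>H\<close> and \<open>G'\<close> is closed. Were it proper, a Riesz
  vector \<open>u\<close> would stay at distance at least \<open>1/2\<close> from it; but
  \<open>u = h + g\<close> with \<open>g\<close> close to \<open>G'\<close> brings \<open>u\<close>
  too near. Codimension is thus stable under small gaps.\<close>

lemma complementary_near:
  fixes H G G' :: "'v::real_normed_vector set"
  assumes H: "has_dim H k" and c: "complementary H G" and ang: "angle_bound P H G"
    and G': "subspace G'" "closed G'" and n1: "near \<epsilon> G G'" and n2: "near \<epsilon> G' G"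
    and P: "1 \<le> P" and \<epsilon>: "0 \<le> \<epsilon>" "P * \<epsilon> \<le> 1/8"
  shows "complementary H G' \<and> angle_bound (2 * P) H G'"
proof -
  have ang': "angle_bound (2 * P) H G'"
    using angle_bound_near[OF ang near_refl[OF \<epsilon>(1)] n2 P \<epsilon>] .
  have sH: "subspace H" using H by (rule has_dim_subspace)
  have tr: "v = 0" if "v \<in> H" "v \<in> G'" for v
    using angle_boundD[OF ang' that(1) subspace_neg[OF G'(1) that(2)]] by simp
  let ?S = "{h + g | h g. h \<in> H \<and> g \<in> G'}"
  have "?S = UNIV"
  proof (rule ccontr)
    assume "?S \<noteq> UNIV"
    then obtain u where u: "norm u = 1" "\<And>g t. g \<in> ?S \<Longrightarrow> \<bar>t\<bar> \<le> 2 * norm (g + t *\<^sub>R u)"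
      using Riesz_almost_orthogonal[OF subspace_sums[OF sH G'(1)] closed_add_has_dim[OF H G']] by blast
    obtain h g where hg: "h \<in> H" "g \<in> G" "u = h + g" using complementaryD(4)[OF c] by blast
    obtain g' where g': "g' \<in> G'" "norm (g - g') \<le> \<epsilon> * norm g" using n1 hg(2) by (rule nearE)
    have "- h + - g' \<in> ?S" using subspace_neg[OF sH hg(1)] subspace_neg[OF G'(1) g'(1)] by blast
    from u(2)[OF this, of 1] have "1 \<le> 2 * norm (- h + - g' + u)" by simp
    also have "- h + - g' + u = g - g'" using hg by simp
    also have "2 * norm (g - g') \<le> 2 * (\<epsilon> * norm g)" using g' by simp
    also have "\<dots> \<le> 2 * (\<epsilon> * ((1 + P) * norm u))"
      using angle_bound_snd[OF ang hg(1,2)] hg \<epsilon> by (intro mult_left_mono) auto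
    also have "\<dots> = 2 * \<epsilon> + 2 * (P * \<epsilon>)" using u by (simp add: algebra_simps)
    finally have "1 \<le> 2 * \<epsilon> + 2 * (P * \<epsilon>)" .
    moreover have "\<epsilon> \<le> P * \<epsilon>" using P \<epsilon> mult_right_mono[of 1 P \<epsilon>] by simp
    ultimately show False using \<epsilon> by simp
  qed
  then have "\<exists>e\<in>H. \<exists>f\<in>G'. v = e + f" for v by blast
  moreover have "H \<inter> G' = {0}" using tr subspace_0[OF sH] subspace_0[OF G'(1)] by auto
  ultimately show ?thesis using ang' sH G' unfolding complementary_def by simp
qed

text \<open>For \<open>coordinates k E e l\<close> this is the projection onto \<open>E\<close>
  along the common kernel of the functionals; as a sum of \<open>k\<close> rank-one maps it has norm
  at most \<open>k * 2 ^ k\<close>.\<close>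

definition coordinate_sum :: "nat \<Rightarrow> (nat \<Rightarrow> 'v::real_normed_vector) \<Rightarrow> (nat \<Rightarrow> 'v \<Rightarrow> real) \<Rightarrow> 'v \<Rightarrow> 'v" where
  "coordinate_sum k e l v = (\<Sum>i<k. l i v *\<^sub>R e i)"

lemma coordinate_sum:
  assumes el: "coordinates k E e l" and E: "subspace E"
  shows "linear (coordinate_sum k e l)" "coordinate_sum k e l v \<in> E"
    "norm (coordinate_sum k e l v) \<le> real k * 2 ^ k * norm v"
    "v \<in> E \<Longrightarrow> coordinate_sum k e l v = v"
    "coordinate_sum k e l v = 0 \<longleftrightarrow> (\<forall>i<k. l i v = 0)"
proof -
  let ?p = "coordinate_sum k e l"
  show lin: "linear ?p" unfolding coordinate_sum_def
    by (intro linearI) (simp_all add: linear_add[OF coordinatesD(3)[OF el]] linear_scale[OF coordinatesD(3)[OF el]]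
        scaleR_add_left sum.distrib scaleR_sum_right)
  show "?p v \<in> E" unfolding coordinate_sum_def
    by (auto intro!: subspace_sum[OF E] subspace_scale[OF E] coordinatesD(1)[OF el])
  have "norm (?p v) \<le> (\<Sum>i<k. norm (l i v *\<^sub>R e i))" unfolding coordinate_sum_def by (rule norm_sum)
  also have "\<dots> \<le> (\<Sum>i<k. 2 ^ k * norm v)" using coordinatesD(2,4)[OF el] by (intro sum_mono) auto
  finally show "norm (?p v) \<le> real k * 2 ^ k * norm v" by simp
  show "v \<in> E \<Longrightarrow> ?p v = v" unfolding coordinate_sum_def by (rule coordinatesD(6)[OF el])
  show "?p v = 0 \<longleftrightarrow> (\<forall>i<k. l i v = 0)"
  proof
    assume z: "?p v = 0"
    show "\<forall>i<k. l i v = 0"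
    proof (intro allI impI)
      fix i assume i: "i < k"
      note li = coordinatesD(3)[OF el i]
      have "l i (?p v) = (\<Sum>j<k. l j v * l i (e j))"
        unfolding coordinate_sum_def by (simp add: linear_sum[OF li] linear_scale[OF li])
      also have "\<dots> = (\<Sum>j<k. if j = i then l j v else 0)"
        using coordinatesD(5)[OF el i] by (intro sum.cong) auto
      also have "\<dots> = l i v" using i by simp
      finally show "l i v = 0" using z linear_0[OF li] by simp
    qed
  qed (simp add: coordinate_sum_def)
qed

lemma coordinate_le_norm_sum:
  assumes el: "coordinates k E e l" and j: "j < k"
  shows "\<bar>c j\<bar> \<le> 2 ^ k * norm (\<Sum>i<k. c i *\<^sub>R e i)"
proof -
  note lj = coordinatesD(3)[OF el j]
  have "l j (\<Sum>i<k. c i *\<^sub>R e i) = (\<Sum>i<k. c i * l j (e i))"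
    by (simp add: linear_sum[OF lj] linear_scale[OF lj])
  also have "\<dots> = (\<Sum>i<k. if i = j then c i else 0)"
    using coordinatesD(5)[OF el j] by (intro sum.cong) auto
  also have "\<dots> = c j" using j by simp
  finally show ?thesis using coordinatesD(4)[OF el j, of "\<Sum>i<k. c i *\<^sub>R e i"] by simp
qed

lemma norm_sum_le_coordinates:
  assumes el: "coordinates k E e l" and c: "\<And>i. i < k \<Longrightarrow> \<bar>c i\<bar> \<le> \<epsilon>"
  shows "norm (\<Sum>i<k. c i *\<^sub>R e i) \<le> real k * \<epsilon>"
proof -
  have "norm (\<Sum>i<k. c i *\<^sub>R e i) \<le> (\<Sum>i<k. norm (c i *\<^sub>R e i))" by (rule norm_sum)
  also have "\<dots> \<le> (\<Sum>i<k. \<epsilon>)" using c coordinatesD(2)[OF el] by (intro sum_mono) auto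
  finally show ?thesis by simp
qed

text \<open>The coordinate projection onto \<open>E'\<close> is injective on \<open>E\<close>: a
  nonzero vector of its kernel has relative distance at least \<open>1 / (k * 2 ^ k + 1)\<close>
  from every vector of \<open>E'\<close>.\<close>

lemma near_has_dim:
  fixes E E' :: "'v::real_normed_vector set"
  assumes n: "near \<epsilon> E E'" and E': "has_dim E' k" and E: "subspace E" and \<epsilon>: "(real k * 2 ^ k + 1) * \<epsilon> < 1"
  obtains i where "i \<le> k" "has_dim E i"
proof -
  obtain e l where el: "coordinates k E' e l" by (rule bounded_coordinates[OF E'])
  define p where "p = coordinate_sum k e l"
  note p = coordinate_sum[OF el has_dim_subspace[OF E'], folded p_def]
  have inj: "v = 0" if v: "v \<in> E" "p v = 0" for v
  proof -
    obtain v' where v': "v' \<in> E'" "norm (v - v') \<le> \<epsilon> * norm v" using n v(1) by (rule nearE)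
    have "p (v - v') = - v'" using v p(4)[OF v'(1)] linear_diff[OF p(1)] by simp
    then have "norm v' \<le> real k * 2 ^ k * norm (v - v')" using p(3)[of "v - v'"] by simp
    moreover have "norm v \<le> norm v' + norm (v - v')" using norm_triangle_ineq[of v' "v - v'"] by simp
    ultimately have "norm v \<le> (real k * 2 ^ k + 1) * norm (v - v')" by (simp add: algebra_simps)
    also have "\<dots> \<le> (real k * 2 ^ k + 1) * (\<epsilon> * norm v)" using v' by (intro mult_left_mono) auto
    also have "\<dots> = ((real k * 2 ^ k + 1) * \<epsilon>) * norm v" by simp
    finally have "(1 - (real k * 2 ^ k + 1) * \<epsilon>) * norm v \<le> 0" by (simp add: algebra_simps)
    then show "v = 0" using \<epsilon> by (simp add: mult_le_0_iff)
  qed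
  have im: "p ` E \<subseteq> E'" using p(2) by blast
  show ?thesis by (rule has_dim_inj[OF p(1) E _ E' im], rule inj) (simp_all add: that)
qed

lemma near_has_dim_eq:
  fixes E E' :: "'v::real_normed_vector set"
  assumes n: "near \<epsilon> E E'" "near \<epsilon> E' E" and E': "has_dim E' k" and E: "subspace E"
    and \<epsilon>: "0 \<le> \<epsilon>" "(real k * 2 ^ k + 1) * \<epsilon> < 1"
  shows "has_dim E k"
proof -
  obtain i where i: "i \<le> k" "has_dim E i" using near_has_dim[OF n(1) E' E \<epsilon>(2)] .
  have "real i * 2 ^ i \<le> real k * 2 ^ k" using i by (intro mult_mono power_increasing) auto
  then have "(real i * 2 ^ i + 1) * \<epsilon> \<le> (real k * 2 ^ k + 1) * \<epsilon>" using \<epsilon> by (intro mult_right_mono) auto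
  then obtain j where "j \<le> i" "has_dim E' j"
    using near_has_dim[OF n(2) i(2) has_dim_subspace[OF E']] \<epsilon>(2) by (metis order.strict_trans1)
  then show ?thesis using has_dim_unique[OF E'] i by (metis le_antisym)
qed

section \<open>Limits of subspaces converging at a geometric rate\<close>

definition limit_space :: "(nat \<Rightarrow> 'v::real_normed_vector set) \<Rightarrow> 'v set" where
  "limit_space G = {v. \<exists>g. (\<forall>n. g n \<in> G n) \<and> g \<longlonglongrightarrow> v}"

lemma subspace_limit_space:
  assumes G: "\<And>n. subspace (G n)"
  shows "subspace (limit_space G)"
  unfolding subspace_def
proof (intro conjI ballI allI)
  show "0 \<in> limit_space G" unfolding limit_space_def
    using subspace_0[OF G] by (intro CollectI exI[of _ "\<lambda>_. 0"]) auto
  fix x y assume "x \<in> limit_space G" "y \<in> limit_space G"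
  then obtain g h where *: "\<forall>n. g n \<in> G n" "g \<longlonglongrightarrow> x" "\<forall>n. h n \<in> G n" "h \<longlonglongrightarrow> y"
    unfolding limit_space_def by blast
  then show "x + y \<in> limit_space G" unfolding limit_space_def
    using subspace_add[OF G] by (intro CollectI exI[of _ "\<lambda>n. g n + h n"]) (auto intro: tendsto_add)
next
  fix c x assume "x \<in> limit_space G"
  then obtain g where *: "\<forall>n. g n \<in> G n" "g \<longlonglongrightarrow> x" unfolding limit_space_def by blast
  then show "c *\<^sub>R x \<in> limit_space G" unfolding limit_space_def
    using subspace_scale[OF G] by (intro CollectI exI[of _ "\<lambda>n. c *\<^sub>R g n"]) (auto intro: tendsto_intros)
qed

context
  fixes G :: "nat \<Rightarrow> 'v::banach set" and c \<tau> C :: real and N :: nat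
  assumes G: "\<And>n. subspace (G n)"
    and n1: "\<And>n. n \<ge> N \<Longrightarrow> near (c * \<tau> ^ n) (G n) (G (Suc n))"
    and n2: "\<And>n. n \<ge> N \<Longrightarrow> near (c * \<tau> ^ n) (G (Suc n)) (G n)"
    and c: "0 < c" and \<tau>: "0 < \<tau>" "\<tau> < 1" and C: "C = 2 * c / (1 - \<tau>)" and N: "C * \<tau> ^ N \<le> 1"
begin

lemma limit_C: "C * (1 - \<tau>) = 2 * c" "0 < C" "n \<ge> N \<Longrightarrow> C * \<tau> ^ n \<le> 1"
proof -
  show "C * (1 - \<tau>) = 2 * c" using \<tau> by (simp add: C)
  show C0: "0 < C" using c \<tau> by (simp add: C)
  assume "n \<ge> N"
  then have "C * \<tau> ^ n \<le> C * \<tau> ^ N" using \<tau> C0 by (intro mult_left_mono power_decreasing) auto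
  then show "C * \<tau> ^ n \<le> 1" using N by simp
qed

text \<open>The bound telescopes exactly: since \<open>C * (1 - \<tau>) = 2 * c\<close>, passing
  from \<open>Suc n\<close> down to \<open>n\<close> adds \<open>2 * c * \<tau> ^ n\<close>, where
  the factor 2 pays for \<open>norm h' \<le> 2 * norm g\<close>.\<close>

lemma limit_space_near_aux:
  assumes "n \<ge> N" "n \<le> m" "g \<in> G m"
  shows "\<exists>h\<in>G n. norm (g - h) \<le> C * (\<tau> ^ n - \<tau> ^ m) * norm g"
  using assms(2,1)
proof (induction n rule: inc_induct)
  case base
  then show ?case using assms(3) by (intro bexI[of _ g]) auto
next
  case (step n)
  then obtain h' where h': "h' \<in> G (Suc n)" "norm (g - h') \<le> C * (\<tau> ^ Suc n - \<tau> ^ m) * norm g" by auto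
  obtain h where h: "h \<in> G n" "norm (h' - h) \<le> c * \<tau> ^ n * norm h'"
    using n2[OF step.prems] h'(1) by (rule nearE)
  have "C * (\<tau> ^ Suc n - \<tau> ^ m) \<le> C * \<tau> ^ Suc n" using limit_C(2) \<tau> by (intro mult_left_mono) auto
  also have "\<dots> \<le> 1" using limit_C(3)[of "Suc n"] step.prems by simp
  finally have "norm (g - h') \<le> 1 * norm g"
    using h'(2) by (meson mult_right_mono norm_ge_zero order_trans)
  moreover have "norm h' \<le> norm g + norm (g - h')" using norm_triangle_ineq4[of g "g - h'"] by simp
  ultimately have "norm h' \<le> 2 * norm g" by simp
  then have "c * \<tau> ^ n * norm h' \<le> c * \<tau> ^ n * (2 * norm g)" using c \<tau> by (intro mult_left_mono) auto
  also have "\<dots> = C * (1 - \<tau>) * \<tau> ^ n * norm g" by (simp add: limit_C(1))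
  finally have "norm (h' - h) \<le> C * (1 - \<tau>) * \<tau> ^ n * norm g" using h(2) by simp
  moreover have "norm (g - h) \<le> norm (g - h') + norm (h' - h)"
    using norm_triangle_ineq[of "g - h'" "h' - h"] by simp
  ultimately have "norm (g - h) \<le> C * (\<tau> ^ n - \<tau> ^ m) * norm g" using h'(2) by (simp add: algebra_simps)
  then show ?case using h(1) by blast
qed

lemma near_limit_space2:
  assumes n: "n \<ge> N"
  shows "near (2 * C * \<tau> ^ n) (limit_space G) (G n)"
  unfolding near_def
proof
  fix v assume "v \<in> limit_space G"
  then obtain g where g: "\<And>n. g n \<in> G n" "g \<longlonglongrightarrow> v" unfolding limit_space_def by blast
  show "\<exists>h\<in>G n. norm (v - h) \<le> 2 * C * \<tau> ^ n * norm v"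
  proof (cases "v = 0")
    case True
    then show ?thesis using subspace_0[OF G] by (intro bexI[of _ 0]) auto
  next
    case False
    \<comment> \<open>The third leaves room for the distance to \<open>g m\<close> and for the
      growth of its norm: \<open>1/3 + 4/3 \<le> 2\<close>.\<close>
    then have "0 < C * \<tau> ^ n * norm v / 3" using limit_C(2) \<tau> by simp
    then have "\<forall>\<^sub>F m in sequentially. dist (g m) v < C * \<tau> ^ n * norm v / 3" using g(2) by (rule tendstoD[rotated])
    then obtain m where m: "m \<ge> n" "norm (v - g m) < C * \<tau> ^ n * norm v / 3"
      unfolding eventually_sequentially by (metis dist_commute dist_norm nle_le)
    obtain h where h: "h \<in> G n" "norm (g m - h) \<le> C * (\<tau> ^ n - \<tau> ^ m) * norm (g m)"
      using limit_space_near_aux[OF n m(1) g(1)] by blast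
    have Cn: "C * \<tau> ^ n \<le> 1" using limit_C(3)[OF n] .
    have "C * \<tau> ^ n * norm v \<le> 1 * norm v" using Cn by (intro mult_right_mono) auto
    moreover have "norm (g m) \<le> norm v + norm (v - g m)" using norm_triangle_ineq4[of v "v - g m"] by simp
    ultimately have gm: "norm (g m) \<le> 4/3 * norm v" using m by simp
    have "C * (\<tau> ^ n - \<tau> ^ m) * norm (g m) \<le> C * \<tau> ^ n * (4/3 * norm v)"
      using limit_C(2) \<tau> gm by (intro mult_mono mult_left_mono) auto
    moreover have "norm (v - h) \<le> norm (v - g m) + norm (g m - h)"
      using norm_triangle_ineq[of "v - g m" "g m - h"] by simp
    ultimately have "norm (v - h) \<le> C * \<tau> ^ n * norm v / 3 + C * \<tau> ^ n * (4/3 * norm v)"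
      using m(2) h(2) by linarith
    also have "\<dots> = 5/3 * (C * \<tau> ^ n * norm v)" by simp
    also have "\<dots> \<le> 2 * (C * \<tau> ^ n * norm v)" using limit_C(2) \<tau> by (intro mult_right_mono) auto
    finally have "norm (v - h) \<le> 2 * C * \<tau> ^ n * norm v" by simp
    then show ?thesis using h(1) by blast
  qed
qed

text \<open>Following approximants from \<open>G n\<close> to \<open>G (Suc n)\<close> and onwards
  gives increments that decay geometrically, so completeness of the space supplies the limit
  vector.\<close>

lemma near_limit_space1:
  assumes n: "n \<ge> N"
  shows "near (C * \<tau> ^ n) (G n) (limit_space G)"
  unfolding near_def
proof
  fix g assume g: "g \<in> G n"
  have "\<forall>m x. \<exists>y. m \<ge> N \<longrightarrow> x \<in> G m \<longrightarrow> y \<in> G (Suc m) \<and> norm (x - y) \<le> c * \<tau> ^ m * norm x"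
    using n1 unfolding near_def by blast
  then obtain f where f: "\<And>m x. m \<ge> N \<Longrightarrow> x \<in> G m \<Longrightarrow>
      f m x \<in> G (Suc m) \<and> norm (x - f m x) \<le> c * \<tau> ^ m * norm x" by metis
  define s where "s = rec_nat g (\<lambda>j x. f (n + j) x)"
  have s0: "s 0 = g" and sS: "\<And>j. s (Suc j) = f (n + j) (s j)" by (simp_all add: s_def)
  have sG: "s j \<in> G (n + j)" for j
    using g f n by (induction j) (auto simp: s0 sS)
  have step: "norm (s j - s (Suc j)) \<le> c * \<tau> ^ (n + j) * norm (s j)" for j
    using f[of "n + j" "s j"] sG n sS by simp
  have *: "norm (s j) \<le> 2 * norm g" if "norm (g - s j) \<le> C * (\<tau> ^ n - \<tau> ^ (n + j)) * norm g" for j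
    proof -
      have "C * (\<tau> ^ n - \<tau> ^ (n + j)) \<le> C * \<tau> ^ n" using limit_C(2) \<tau> by (intro mult_left_mono) auto
      also have "\<dots> \<le> 1" using limit_C(3)[OF n] .
      finally have "norm (g - s j) \<le> 1 * norm g"
        using that by (meson mult_right_mono norm_ge_zero order_trans)
      then show ?thesis using norm_triangle_ineq4[of g "g - s j"] by simp
    qed
  have bound: "norm (g - s j) \<le> C * (\<tau> ^ n - \<tau> ^ (n + j)) * norm g" for j
    proof (induction j)
      case 0 then show ?case by (simp add: s0)
    next
      case (Suc j)
      have "norm (s j - s (Suc j)) \<le> c * \<tau> ^ (n + j) * (2 * norm g)"
        using order_trans[OF step mult_left_mono[OF *[OF Suc]]] c \<tau> by simp
      also have "\<dots> = C * (1 - \<tau>) * \<tau> ^ (n + j) * norm g" by (simp add: limit_C(1))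
      finally have "norm (s j - s (Suc j)) \<le> C * (1 - \<tau>) * \<tau> ^ (n + j) * norm g" .
      moreover have "norm (g - s (Suc j)) \<le> norm (g - s j) + norm (s j - s (Suc j))"
        using norm_triangle_ineq[of "g - s j" "s j - s (Suc j)"] by simp
      ultimately show ?case using Suc by (simp add: algebra_simps)
    qed
  note ns = *[OF bound]
  have "norm (s (Suc j) - s j) \<le> 2 * c * norm g * \<tau> ^ j" for j
  proof -
    have "norm (s (Suc j) - s j) \<le> c * \<tau> ^ (n + j) * (2 * norm g)"
      using order_trans[OF step mult_left_mono[OF ns]] c \<tau> by (simp add: norm_minus_commute)
    also have "\<dots> \<le> c * \<tau> ^ j * (2 * norm g)"
      using c \<tau> by (intro mult_right_mono mult_left_mono power_decreasing) auto
    finally show ?thesis by (simp add: mult_ac)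
  qed
  moreover have "summable (\<lambda>j. 2 * c * norm g * \<tau> ^ j)"
    using \<tau> by (intro summable_mult summable_geometric) auto
  ultimately have "summable (\<lambda>j. s (Suc j) - s j)"
    using summable_comparison_test'[of "\<lambda>j. 2 * c * norm g * \<tau> ^ j" 0 "\<lambda>j. s (Suc j) - s j"] by blast
  then have "(\<lambda>J. \<Sum>j<J. s (Suc j) - s j) \<longlonglongrightarrow> (\<Sum>j. s (Suc j) - s j)" by (rule summable_LIMSEQ)
  then have "(\<lambda>J. (s J - s 0) + s 0) \<longlonglongrightarrow> (\<Sum>j. s (Suc j) - s j) + s 0"
    unfolding sum_lessThan_telescope by (intro tendsto_add tendsto_const)
  then have v: "s \<longlonglongrightarrow> (\<Sum>j. s (Suc j) - s j) + s 0" (is "_ \<longlonglongrightarrow> ?v") by simp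
  \<comment> \<open>A witness for \<open>limit_space\<close> needs a member at every index; those
    before \<open>n\<close> are filled with \<open>0\<close>, which does not affect the
    limit.\<close>
  define g' where "g' m = (if m \<ge> n then s (m - n) else 0)" for m
  have "g' m \<in> G m" for m using sG[of "m - n"] subspace_0[OF G] by (auto simp: g'_def)
  moreover have "g' \<longlonglongrightarrow> ?v"
    by (rule LIMSEQ_offset[of _ n]) (simp add: g'_def v)
  ultimately have "?v \<in> limit_space G" unfolding limit_space_def by blast
  moreover have "norm (g - ?v) \<le> C * \<tau> ^ n * norm g"
  proof (rule LIMSEQ_le_const2)
    show "(\<lambda>j. norm (g - s j)) \<longlonglongrightarrow> norm (g - ?v)" by (intro tendsto_intros v)
    have "C * (\<tau> ^ n - \<tau> ^ (n + j)) * norm g \<le> C * \<tau> ^ n * norm g" for j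
      using limit_C(2) \<tau> by (intro mult_right_mono mult_left_mono) auto
    then show "\<exists>N. \<forall>j\<ge>N. norm (g - s j) \<le> C * \<tau> ^ n * norm g"
      using bound order_trans by blast
  qed
  ultimately show "\<exists>h\<in>limit_space G. norm (g - h) \<le> C * \<tau> ^ n * norm g" by blast
qed

end

text \<open>Near-minimisers of the distance to \<open>G n\<close>, within \<open>1 / Suc n\<close>,
  replace nearest points, which need not exist.\<close>

lemma limit_space_mem:
  assumes G: "\<And>n. subspace (G n)" and v: "\<And>e. e > 0 \<Longrightarrow> \<forall>\<^sub>F n in sequentially. \<exists>h\<in>G n. norm (v - h) \<le> e"
  shows "v \<in> limit_space G"
proof -
  have ne: "G n \<noteq> {}" for n using subspace_0[OF G] by blast
  have "(\<lambda>n. infdist v (G n)) \<longlonglongrightarrow> 0"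
  proof (rule tendstoI)
    fix e :: real assume "0 < e"
    then have "\<forall>\<^sub>F n in sequentially. \<exists>h\<in>G n. norm (v - h) \<le> e/2" by (intro v) simp
    then show "\<forall>\<^sub>F n in sequentially. dist (infdist v (G n)) 0 < e"
    proof eventually_elim
      case (elim n)
      then obtain h where "h \<in> G n" "norm (v - h) \<le> e/2" by blast
      then have "infdist v (G n) \<le> e/2" using infdist_le[of h "G n" v] by (simp add: dist_norm)
      then show ?case using \<open>0 < e\<close> infdist_nonneg[of v "G n"] by simp
    qed
  qed
  moreover have "\<exists>h\<in>G n. norm (v - h) < infdist v (G n) + 1 / real (Suc n)" for n
  proof -
    have "(INF a\<in>G n. dist v a) < infdist v (G n) + 1 / real (Suc n)"
      unfolding infdist_notempty[OF ne] by simp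
    then show ?thesis using ne
      by (subst (asm) cINF_less_iff) (auto simp: dist_norm intro!: bdd_belowI2[of _ 0])
  qed
  then obtain h where h: "\<And>n. h n \<in> G n" "\<And>n. norm (v - h n) < infdist v (G n) + 1 / real (Suc n)" by metis
  moreover have "(\<lambda>n. 1 / real (Suc n)) \<longlonglongrightarrow> 0" using LIMSEQ_Suc[OF lim_1_over_n] by simp
  ultimately have "(\<lambda>n. infdist v (G n) + 1 / real (Suc n)) \<longlonglongrightarrow> 0" using tendsto_add by fastforce
  then have "(\<lambda>n. h n - v) \<longlonglongrightarrow> 0"
    by (rule Lim_null_comparison[rotated])
      (use h(2) in \<open>auto simp: norm_minus_commute intro!: always_eventually less_imp_le\<close>)
  then have "h \<longlonglongrightarrow> v" by (simp add: LIM_zero_iff)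
  then show ?thesis unfolding limit_space_def using h(1) by blast
qed

lemma closed_limit_space:
  fixes \<tau> :: real
  assumes G: "\<And>n. subspace (G n)" and \<tau>: "0 < \<tau>" "\<tau> < 1"
    and n: "\<forall>\<^sub>F n in sequentially. near (C * \<tau> ^ n) (limit_space G) (G n)"
  shows "closed (limit_space G)"
proof -
  have "v \<in> limit_space G" if v: "v \<in> closure (limit_space G)" for v
  proof (rule limit_space_mem[OF G])
    fix e :: real assume e: "0 < e"
    then obtain l where l: "l \<in> limit_space G" "norm (v - l) < e/2"
      using v unfolding closure_approachable by (metis dist_commute dist_norm half_gt_zero)
    have "(\<lambda>n. C * \<tau> ^ n * norm l) \<longlonglongrightarrow> C * 0 * norm l"
      using \<tau> by (intro tendsto_intros LIMSEQ_power_zero) auto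
    moreover have "C * 0 * norm l < e/2" using e by simp
    ultimately have "\<forall>\<^sub>F n in sequentially. C * \<tau> ^ n * norm l < e/2"
      by (rule order_tendstoD(2))
    then show "\<forall>\<^sub>F n in sequentially. \<exists>h\<in>G n. norm (v - h) \<le> e"
      using n
    proof eventually_elim
      case (elim n)
      obtain h where h: "h \<in> G n" "norm (l - h) \<le> C * \<tau> ^ n * norm l"
        using elim(2) l(1) by (rule nearE)
      have "norm (v - h) \<le> norm (v - l) + norm (l - h)" using norm_triangle_ineq[of "v - l" "l - h"] by simp
      then have "norm (v - h) \<le> e" using h l elim by simp
      then show ?case using h by blast
    qed
  qed
  then show ?thesis using closure_subset_eq by blast
qed

subsection \<open>Gelfand numbers\<close>

lemma norm_on_le:
  fixes B :: "'v::real_normed_vector \<Rightarrow>\<^sub>L 'v"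
  assumes "0 \<le> \<eta>" "G \<noteq> {}" "\<And>g. g \<in> G \<Longrightarrow> norm (B g) \<le> \<eta> * norm g"
  shows "norm_on G B \<le> \<eta>"
  unfolding norm_on_def
proof (rule cSUP_least)
  fix g assume "g \<in> G"
  then show "norm (B g) / norm g \<le> \<eta>"
    using assms(1) assms(3)[of g] by (cases "g = 0") (simp_all add: divide_le_eq)
qed fact

lemma le_norm_on:
  fixes B :: "'v::real_normed_vector \<Rightarrow>\<^sub>L 'v"
  assumes "g \<in> G"
  shows "norm (B g) \<le> norm_on G B * norm g"
proof (cases "g = 0")
  case False
  have "norm (B v) / norm v \<le> norm B" for v
    using norm_blinfun[of B v] by (cases "v = 0") (simp_all add: divide_le_eq)
  then have "norm (B g) / norm g \<le> norm_on G B"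
    unfolding norm_on_def by (intro cSUP_upper[OF assms] bdd_aboveI2)
  then show ?thesis using False by (simp add: divide_le_eq)
qed simp

lemma norm_on_nonneg:
  fixes B :: "'v::real_normed_vector \<Rightarrow>\<^sub>L 'v"
  assumes "subspace G"
  shows "0 \<le> norm_on G B"
proof -
  have "norm (B v) / norm v \<le> norm B" for v
    using norm_blinfun[of B v] by (cases "v = 0") (simp_all add: divide_le_eq)
  then have "norm (B 0) / norm (0::'v) \<le> norm_on G B"
    unfolding norm_on_def by (intro cSUP_upper[OF subspace_0[OF assms]] bdd_aboveI2)
  then show ?thesis by simp
qed

lemma gelfand_le:
  fixes B :: "'v::real_normed_vector \<Rightarrow>\<^sub>L 'v"
  assumes "closed G" "has_codim G (q - 1)" "0 \<le> \<eta>"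
    and "\<And>g. g \<in> G \<Longrightarrow> norm (B g) \<le> \<eta> * norm g"
  shows "gelfand_number q B \<le> \<eta>"
proof -
  have sG: "subspace G" using assms(2) by (rule has_codim_subspace)
  have "gelfand_number q B \<le> norm_on G B"
    unfolding gelfand_number_def using assms sG norm_on_nonneg
    by (intro cINF_lower bdd_belowI2[of _ 0]) auto
  also have "\<dots> \<le> \<eta>" using assms subspace_0[OF sG] by (intro norm_on_le) auto
  finally show ?thesis .
qed

lemma closed_codim_nonempty:
  assumes "enat j \<le> edim (UNIV :: 'v::real_normed_vector set)"
  shows "{F :: 'v set. subspace F \<and> closed F \<and> has_codim F j} \<noteq> {}"
  using closed_codim_subspace_exists[OF closed_UNIV has_codim_0 _ assms] by blast

lemma gelfand_lessE:
  fixes B :: "'v::real_normed_vector \<Rightarrow>\<^sub>L 'v"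
  assumes "gelfand_number q B < \<eta>" "enat (q - 1) \<le> edim (UNIV :: 'v set)"
  obtains G where "subspace G" "closed G" "has_codim G (q - 1)"
    "\<And>g. g \<in> G \<Longrightarrow> norm (B g) \<le> \<eta> * norm g"
proof -
  have "\<exists>F\<in>{F :: 'v set. subspace F \<and> closed F \<and> has_codim F (q - 1)}. norm_on F B < \<eta>"
    using assms(1) unfolding gelfand_number_def
    by (subst (asm) cINF_less_iff[OF closed_codim_nonempty[OF assms(2)]])
      (auto intro!: bdd_belowI2[of _ 0] norm_on_nonneg)
  then obtain F :: "'v set" where F: "subspace F" "closed F" "has_codim F (q - 1)" "norm_on F B < \<eta>" by blast
  have "norm (B g) \<le> \<eta> * norm g" if "g \<in> F" for g
    using le_norm_on[OF that, of B] F(4) by (meson less_imp_le mult_right_mono norm_ge_zero order_trans)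
  then show ?thesis using that F by blast
qed

lemma gelfand_ge:
  fixes B :: "'v::real_normed_vector \<Rightarrow>\<^sub>L 'v"
  assumes "enat (q - 1) \<le> edim (UNIV :: 'v set)"
    and "\<And>G. subspace G \<Longrightarrow> closed G \<Longrightarrow> has_codim G (q - 1) \<Longrightarrow>
      \<exists>g\<in>G. g \<noteq> 0 \<and> m * norm g \<le> norm (B g)"
  shows "m \<le> gelfand_number q B"
  unfolding gelfand_number_def
proof (rule cINF_greatest[OF closed_codim_nonempty[OF assms(1)]])
  fix G :: "'v set" assume "G \<in> {F. subspace F \<and> closed F \<and> has_codim F (q - 1)}"
  then obtain g where g: "g \<in> G" "g \<noteq> 0" "m * norm g \<le> norm (B g)" using assms(2) by blast
  have "m * norm g \<le> norm_on G B * norm g" using g(3) le_norm_on[OF g(1), of B] by simp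
  then show "m \<le> norm_on G B" using g(2) by simp
qed

lemma gelfand_nonneg:
  fixes B :: "'v::real_normed_vector \<Rightarrow>\<^sub>L 'v"
  assumes "enat (q - 1) \<le> edim (UNIV :: 'v set)"
  shows "0 \<le> gelfand_number q B"
  unfolding gelfand_number_def
  by (rule cINF_greatest[OF closed_codim_nonempty[OF assms]]) (auto intro: norm_on_nonneg)

lemma gelfand_compose_left:
  fixes B A :: "'v::real_normed_vector \<Rightarrow>\<^sub>L 'v"
  assumes q: "enat (q - 1) \<le> edim (UNIV :: 'v set)"
  shows "gelfand_number q (A o\<^sub>L B) \<le> norm A * gelfand_number q B"
proof (rule field_le_epsilon)
  fix e :: real assume e: "0 < e"
  \<comment> \<open>The denominator is \<open>norm A + 1\<close> because \<open>A\<close> may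
    vanish.\<close>
  let ?\<eta> = "gelfand_number q B + e / (norm A + 1)"
  have n1: "0 < norm A + 1" by (simp add: add_nonneg_pos)
  then have pos: "0 < e / (norm A + 1)" using e by simp
  then have "gelfand_number q B < ?\<eta>" by simp
  then obtain G where G: "subspace G" "closed G" "has_codim G (q - 1)"
    "\<And>g. g \<in> G \<Longrightarrow> norm (B g) \<le> ?\<eta> * norm g" using gelfand_lessE[OF _ q] by metis
  have "0 \<le> ?\<eta>" using gelfand_nonneg[OF q, of B] pos by simp
  then have "gelfand_number q (A o\<^sub>L B) \<le> norm A * ?\<eta>"
  proof (intro gelfand_le[OF G(2,3)])
    fix g assume "g \<in> G"
    have "norm (A (B g)) \<le> norm A * norm (B g)" by (rule norm_blinfun)
    also have "\<dots> \<le> norm A * (?\<eta> * norm g)" using G(4)[OF \<open>g \<in> G\<close>] by (rule mult_left_mono) simp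
    finally show "norm (blinfun_apply (A o\<^sub>L B) g) \<le> norm A * ?\<eta> * norm g" by simp
  qed simp
  also have "\<dots> = norm A * gelfand_number q B + e * (norm A / (norm A + 1))" by (simp add: distrib_left)
  also have "e * (norm A / (norm A + 1)) \<le> e * 1" using e n1 by (intro mult_left_mono) auto
  finally show "gelfand_number q (A o\<^sub>L B) \<le> norm A * gelfand_number q B + e" by simp
qed

text \<open>The preimage under \<open>B\<close> of a good subspace for \<open>A\<close> competes for
  the product, except that its codimension may be too small; it is then shrunk to codimension
  \<open>q - 1\<close>.\<close>

lemma gelfand_compose_right:
  fixes B A :: "'v::real_normed_vector \<Rightarrow>\<^sub>L 'v"
  assumes q: "enat (q - 1) \<le> edim (UNIV :: 'v set)"
  shows "gelfand_number q (A o\<^sub>L B) \<le> norm B * gelfand_number q A"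
proof (rule field_le_epsilon)
  fix e :: real assume e: "0 < e"
  let ?\<eta> = "gelfand_number q A + e / (norm B + 1)"
  have n1: "0 < norm B + 1" by (simp add: add_nonneg_pos)
  then have pos: "0 < e / (norm B + 1)" using e by simp
  then have "gelfand_number q A < ?\<eta>" by simp
  then obtain G where G: "subspace G" "closed G" "has_codim G (q - 1)"
    "\<And>g. g \<in> G \<Longrightarrow> norm (A g) \<le> ?\<eta> * norm g" using gelfand_lessE[OF _ q] by metis
  have linB: "linear (blinfun_apply B)" by (simp add: blinfun.bounded_linear_right bounded_linear.linear)
  obtain i where i: "i \<le> q - 1" "has_codim (B -` G) i" by (rule has_codim_vimage[OF linB G(3)])
  have "closed (B -` G)" using G(2) by (intro closed_vimage) (auto intro: continuous_intros)
  then obtain G' where G': "G' \<subseteq> B -` G" "closed G'" "has_codim G' (q - 1)"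
    using closed_codim_subspace_exists[OF _ i(2,1) q] by blast
  have p: "0 \<le> ?\<eta>" using gelfand_nonneg[OF q, of A] pos by simp
  have "gelfand_number q (A o\<^sub>L B) \<le> norm B * ?\<eta>"
  proof (rule gelfand_le[OF G'(2,3)])
    show "0 \<le> norm B * ?\<eta>" using p by simp
    fix g assume "g \<in> G'"
    then have "norm (A (B g)) \<le> ?\<eta> * norm (B g)" using G' G(4) by blast
    also have "\<dots> \<le> ?\<eta> * (norm B * norm g)" using p norm_blinfun by (intro mult_left_mono)
    finally show "norm (blinfun_apply (A o\<^sub>L B) g) \<le> norm B * ?\<eta> * norm g" by (simp add: mult_ac)
  qed
  also have "\<dots> = norm B * gelfand_number q A + e * (norm B / (norm B + 1))" by (simp add: distrib_left)
  also have "e * (norm B / (norm B + 1)) \<le> e * 1" using e n1 by (intro mult_left_mono) auto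
  finally show "gelfand_number q (A o\<^sub>L B) \<le> norm B * gelfand_number q A + e" by simp
qed

text \<open>One subspace serves both operators, so Gelfand numbers are 1-Lipschitz in the operator
  norm; this lets the gap persist at nearby base points.\<close>

lemma gelfand_diff:
  fixes B A :: "'v::real_normed_vector \<Rightarrow>\<^sub>L 'v"
  assumes q: "enat (q - 1) \<le> edim (UNIV :: 'v set)"
  shows "gelfand_number q A \<le> gelfand_number q B + norm (A - B)"
proof (rule field_le_epsilon)
  fix e :: real assume e: "0 < e"
  let ?\<eta> = "gelfand_number q B + e"
  have "gelfand_number q B < ?\<eta>" using e by simp
  then obtain G where G: "subspace G" "closed G" "has_codim G (q - 1)"
    "\<And>g. g \<in> G \<Longrightarrow> norm (B g) \<le> ?\<eta> * norm g" using gelfand_lessE[OF _ q] by metis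
  have "gelfand_number q A \<le> ?\<eta> + norm (A - B)"
  proof (rule gelfand_le[OF G(2,3)])
    show "0 \<le> ?\<eta> + norm (A - B)" using gelfand_nonneg[OF q, of B] e by simp
    fix g assume "g \<in> G"
    have "norm (A g) \<le> norm (B g) + norm (blinfun_apply (A - B) g)"
      using norm_triangle_ineq[of "B g" "blinfun_apply (A - B) g"] by (simp add: blinfun.diff_left)
    also have "\<dots> \<le> ?\<eta> * norm g + norm (A - B) * norm g"
      using G(4)[OF \<open>g \<in> G\<close>] norm_blinfun[of "A - B" g] by (rule add_mono)
    finally show "norm (A g) \<le> (?\<eta> + norm (A - B)) * norm g" by (simp add: distrib_right)
  qed
  then show "gelfand_number q A \<le> gelfand_number q B + norm (A - B) + e" by simp
qed

text \<open>If \<open>B\<close> contracted some vector \<open>h\<close> of the complement strongly, then \<open>G\<close> together with the line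
  through \<open>h\<close> would be a competitor of codimension \<open>k - 1\<close> for the Gelfand number.\<close>

lemma gelfand_le_complement:
  fixes B :: "'v::real_normed_vector \<Rightarrow>\<^sub>L 'v"
  assumes k: "1 \<le> k" and G: "closed G" "has_codim G k"
    and small: "\<And>g. g \<in> G \<Longrightarrow> norm (B g) \<le> \<eta> * norm g" and \<eta>: "0 \<le> \<eta>"
    and ang: "angle_bound P H G" and H: "subspace H" and P: "0 \<le> P" and h: "h \<in> H"
  shows "gelfand_number k B * norm h \<le> P * norm (B h) + (1 + P) * \<eta> * norm h"
proof (cases "h = 0")
  case False
  have sG: "subspace G" using G(2) by (rule has_codim_subspace)
  have hG: "h \<notin> G" using angle_boundD[OF ang h subspace_neg[OF sG]] False by force
  let ?m = "(1 + P) * \<eta> + P * norm (B h) / norm h"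
  have "gelfand_number k B \<le> ?m"
  proof (rule gelfand_le)
    show "closed {g + t *\<^sub>R h | g t. g \<in> G}" using closed_add_line[OF sG G(1)] .
    show "has_codim {g + t *\<^sub>R h | g t. g \<in> G} (k - 1)" using has_codim_add_line[OF _ hG, of "k - 1"] G(2) k by simp
    show "0 \<le> ?m" using P \<eta> by simp
    fix x assume "x \<in> {g + t *\<^sub>R h | g t. g \<in> G}"
    then obtain g t where x: "x = g + t *\<^sub>R h" "g \<in> G" by blast
    have th: "t *\<^sub>R h \<in> H" using subspace_scale[OF H h] .
    have 1: "norm (t *\<^sub>R h) \<le> P * norm x" using angle_boundD[OF ang th x(2)] x(1) by (simp add: add.commute)
    have 2: "norm g \<le> (1 + P) * norm x" using angle_bound_snd[OF ang th x(2)] x(1) by (simp add: add.commute)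
    have "norm (B x) \<le> norm (B g) + \<bar>t\<bar> * norm (B h)"
      unfolding x(1) blinfun.add_right blinfun.scaleR_right
      using norm_triangle_ineq[of "B g" "t *\<^sub>R B h"] by simp
    moreover have "norm (B g) \<le> \<eta> * ((1 + P) * norm x)"
      using order_trans[OF small[OF x(2)] mult_left_mono[OF 2 \<eta>]] .
    moreover have "\<bar>t\<bar> \<le> P * norm x / norm h" using 1 False by (simp add: field_simps)
    then have "\<bar>t\<bar> * norm (B h) \<le> P * norm x / norm h * norm (B h)"
      by (rule mult_right_mono) simp
    ultimately show "norm (B x) \<le> ?m * norm x" by (simp add: algebra_simps)
  qed
  then have "gelfand_number k B * norm h \<le> ?m * norm h" by (rule mult_right_mono) simp
  also have "\<dots> = P * norm (B h) + (1 + P) * \<eta> * norm h" using False by (simp add: field_simps)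
  finally show ?thesis .
qed simp

text \<open>In \<open>v = h + g\<close> both \<open>B v\<close> and \<open>B g\<close> are small,
  hence so is \<open>B h\<close>, and expansion on \<open>H\<close> makes \<open>h\<close> itself
  small. The bound \<open>r\<close> in place of \<open>norm v\<close> serves vectors known only
  through an estimate of their norm.\<close>

lemma slow_vector_near_slow_space:
  fixes B :: "'v::real_normed_vector \<Rightarrow>\<^sub>L 'v"
  assumes c: "complementary H G"
    and fast: "\<And>h. h \<in> H \<Longrightarrow> \<mu> * norm h \<le> norm (B h)"
    and slow: "\<And>g. g \<in> G \<Longrightarrow> norm (B g) \<le> \<eta> * norm g"
    and v: "norm (B v) \<le> \<eta> * r" "norm v \<le> r"
    and \<mu>: "0 < \<mu>" and \<eta>: "0 \<le> \<eta>" "\<eta> \<le> \<mu> / 2"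
  shows "\<exists>g\<in>G. norm (v - g) \<le> (4 * \<eta> / \<mu>) * r"
proof -
  obtain h g where hg: "h \<in> H" "g \<in> G" "v = h + g" using complementaryD(4)[OF c] by blast
  have g: "norm g \<le> r + norm h" using norm_triangle_ineq4[of v h] hg v(2) by simp
  have "B h = B v - B g" by (simp add: hg blinfun.add_right)
  then have "norm (B h) \<le> norm (B v) + norm (B g)"
    using norm_triangle_ineq4 by metis
  also have "\<dots> \<le> \<eta> * r + \<eta> * (r + norm h)"
    using v(1) order_trans[OF slow[OF hg(2)] mult_left_mono[OF g \<eta>(1)]] by (rule add_mono)
  finally have "\<mu> * norm h \<le> 2 * \<eta> * r + \<eta> * norm h" using fast[OF hg(1)] by (simp add: algebra_simps)
  moreover have "\<eta> * norm h \<le> \<mu> / 2 * norm h" using \<eta> by (intro mult_right_mono) auto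
  ultimately have "\<mu> * norm h \<le> 4 * \<eta> * r" by simp
  then have "norm h \<le> (4 * \<eta> / \<mu>) * r" using \<mu> by (simp add: field_simps)
  then show ?thesis using hg by (intro bexI[of _ g]) auto
qed

text \<open>Dual to the preceding estimate, with the error measured after applying \<open>B\<close>:
  the component \<open>g\<close> is at most of order \<open>norm (B v) / \<mu>\<close>, and
  \<open>B\<close> multiplies it by at most \<open>\<eta>\<close>.\<close>

lemma fast_image_near:
  fixes B :: "'v::real_normed_vector \<Rightarrow>\<^sub>L 'v"
  assumes c: "complementary H G"
    and fast: "\<And>h. h \<in> H \<Longrightarrow> \<mu> * norm h \<le> norm (B h)"
    and slow: "\<And>g. g \<in> G \<Longrightarrow> norm (B g) \<le> \<eta> * norm g"
    and v: "\<mu> * norm v \<le> norm (B v)"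
    and \<mu>: "0 < \<mu>" and \<eta>: "0 \<le> \<eta>" "\<eta> \<le> \<mu> / 2"
  shows "\<exists>h\<in>H. norm (B v - B h) \<le> (4 * \<eta> / \<mu>) * norm (B v)"
proof -
  obtain h g where hg: "h \<in> H" "g \<in> G" "v = h + g" using complementaryD(4)[OF c] by blast
  have Bg: "B g = B v - B h" by (simp add: hg blinfun.add_right)
  have "norm g \<le> norm v + norm h" using norm_triangle_ineq4[of v h] hg by simp
  moreover have "norm v \<le> norm (B v) / \<mu>" "norm h \<le> norm (B h) / \<mu>"
    using v fast[OF hg(1)] \<mu> by (simp_all add: field_simps)
  moreover have "norm (B h) \<le> norm (B v) + norm (B g)"
    using norm_triangle_ineq4[of "B v" "B g"] by (simp add: Bg)
  then have "norm (B h) / \<mu> \<le> (norm (B v) + norm (B g)) / \<mu>"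
    using \<mu> by (intro divide_right_mono) auto
  ultimately have "norm g \<le> norm (B v) / \<mu> + (norm (B v) + norm (B g)) / \<mu>" by simp
  then have "norm (B g) \<le> \<eta> * (norm (B v) / \<mu> + (norm (B v) + norm (B g)) / \<mu>)"
    using order_trans[OF slow[OF hg(2)] mult_left_mono[OF _ \<eta>(1)]] by blast
  also have "\<dots> = (\<eta> / \<mu>) * (2 * norm (B v)) + (\<eta> / \<mu>) * norm (B g)"
    by (simp add: add_divide_distrib distrib_left)
  also have "(\<eta> / \<mu>) * norm (B g) \<le> 1/2 * norm (B g)"
    using \<eta> \<mu> by (intro mult_right_mono) (auto simp: field_simps)
  finally have "norm (B g) \<le> (4 * \<eta> / \<mu>) * norm (B v)" by simp
  then show ?thesis using hg(1) Bg by metis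
qed

text \<open>Transversality of \<open>H\<close> and \<open>G\<close> comes for free: different growth
  rates exclude a common nonzero vector, and the dimensions then make the two spaces
  complementary.\<close>

lemma fast_images_near:
  fixes B :: "'v::real_normed_vector \<Rightarrow>\<^sub>L 'v"
  assumes G: "has_codim G k" and H: "has_dim H k"
    and fast: "\<And>h. h \<in> H \<Longrightarrow> \<mu> * norm h \<le> norm (B h)"
    and fast': "\<And>h. h \<in> H' \<Longrightarrow> \<mu> * norm h \<le> norm (B h)"
    and slow: "\<And>g. g \<in> G \<Longrightarrow> norm (B g) \<le> \<eta> * norm g"
    and \<mu>: "0 < \<mu>" and \<eta>: "0 \<le> \<eta>" "\<eta> \<le> \<mu> / 2"
  shows "near (4 * \<eta> / \<mu>) (blinfun_apply B ` H') (blinfun_apply B ` H)"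
proof -
  have "v = 0" if "v \<in> H" "v \<in> G" for v
  proof -
    have "\<mu> * norm v \<le> \<mu> / 2 * norm v"
      using fast[OF that(1)] slow[OF that(2)] mult_right_mono[OF \<eta>(2) norm_ge_zero[of v]] by linarith
    then show ?thesis using \<mu> by simp
  qed
  then have c: "complementary H G" using complementary_if_trivial_inter[OF G H] by blast
  show ?thesis unfolding near_def using fast_image_near[OF c fast slow fast' \<mu> \<eta>] by blast
qed

subsection \<open>The Hausdorff metric on closed subspaces\<close>

lemma dist_to_set_lessE:
  assumes "dist_to_set v S < ennreal r"
  obtains s where "s \<in> S" "dist v s < r"
  using assms unfolding dist_to_set_def INF_less_iff by (auto simp: ennreal_less_iff)

lemma near_if_sphere_dist:
  assumes E: "subspace E" and E': "subspace E'"
    and d: "(SUP e \<in> unit_sphere E. dist_to_set e (unit_sphere E')) < ennreal \<epsilon>"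
  shows "near \<epsilon> E E'"
  unfolding near_def
proof
  fix g assume g: "g \<in> E"
  show "\<exists>g'\<in>E'. norm (g - g') \<le> \<epsilon> * norm g"
  proof (cases "g = 0")
    case True
    then show ?thesis using subspace_0[OF E'] by (intro bexI[of _ 0]) auto
  next
    case False
    have "(1 / norm g) *\<^sub>R g \<in> unit_sphere E"
      using False subspace_scale[OF E g] by (simp add: unit_sphere_def)
    then have "dist_to_set ((1 / norm g) *\<^sub>R g) (unit_sphere E') < ennreal \<epsilon>"
      using d by (meson SUP_upper le_less_trans)
    then obtain s where s: "s \<in> unit_sphere E'" "dist ((1 / norm g) *\<^sub>R g) s < \<epsilon>" by (rule dist_to_set_lessE)
    have "norm (g - norm g *\<^sub>R s) = norm (norm g *\<^sub>R ((1 / norm g) *\<^sub>R g - s))"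
      using False by (simp add: scaleR_diff_right)
    also have "\<dots> = norm g * dist ((1 / norm g) *\<^sub>R g) s" by (simp add: dist_norm)
    also have "\<dots> \<le> norm g * \<epsilon>" using s(2) by (intro mult_left_mono) auto
    finally show ?thesis using s(1) subspace_scale[OF E', of s "norm g"]
      by (intro bexI[of _ "norm g *\<^sub>R s"]) (auto simp: unit_sphere_def mult.commute)
  qed
qed

lemma near_if_grass_dist:
  assumes "subspace E" "subspace E'" "grass_dist E E' < ennreal \<epsilon>"
  shows "near \<epsilon> E E'" "near \<epsilon> E' E"
  using assms near_if_sphere_dist unfolding grass_dist_def by auto

text \<open>Normalising the approximant moves it by at most its distance to \<open>e\<close> once
  more, which is the factor 2; \<open>\<epsilon> < 1\<close> keeps it nonzero.\<close>

lemma sphere_dist_if_near: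
  assumes n: "near \<epsilon> E E'" and E': "subspace E'" and \<epsilon>: "\<epsilon> < 1"
  shows "(SUP e \<in> unit_sphere E. dist_to_set e (unit_sphere E')) \<le> ennreal (2 * \<epsilon>)"
proof (rule SUP_least)
  fix e assume "e \<in> unit_sphere E"
  then have e: "e \<in> E" "norm e = 1" by (auto simp: unit_sphere_def)
  obtain g where g: "g \<in> E'" "norm (e - g) \<le> \<epsilon> * norm e" using n e(1) by (rule nearE)
  have d1: "\<bar>1 - norm g\<bar> \<le> norm (e - g)" using norm_triangle_ineq3[of e g] e by simp
  then have g0: "norm g > 0" using g(2) e(2) \<epsilon> by (auto simp: abs_le_iff)
  let ?s = "(1 / norm g) *\<^sub>R g"
  have "?s \<in> unit_sphere E'" using g0 subspace_scale[OF E' g(1)] by (simp add: unit_sphere_def)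
  moreover have "dist e ?s \<le> 2 * \<epsilon>"
  proof -
    have "g - ?s = (1 - 1 / norm g) *\<^sub>R g" by (simp add: scaleR_diff_left)
    then have "norm (g - ?s) = \<bar>(1 - 1 / norm g) * norm g\<bar>" by (simp add: abs_mult)
    also have "(1 - 1 / norm g) * norm g = norm g - 1" using g0 by (simp add: field_simps)
    finally have "norm (g - ?s) \<le> norm (e - g)" using d1 by simp
    moreover have "dist e ?s \<le> norm (e - g) + norm (g - ?s)"
      unfolding dist_norm using norm_triangle_ineq[of "e - g" "g - ?s"] by simp
    ultimately show ?thesis using g e by simp
  qed
  ultimately show "dist_to_set e (unit_sphere E') \<le> ennreal (2 * \<epsilon>)"
    unfolding dist_to_set_def by (intro INF_lower2[of ?s]) (auto intro: ennreal_leI)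
qed

lemma grass_dist_if_near:
  assumes "near \<epsilon> E E'" "near \<epsilon> E' E" "subspace E" "subspace E'" "\<epsilon> < 1"
  shows "grass_dist E E' \<le> ennreal (2 * \<epsilon>)"
  unfolding grass_dist_def using assms by (simp add: sphere_dist_if_near)

subsection \<open>Determinant estimates\<close>

lemma abs_det_le:
  fixes A :: "real mat"
  assumes A: "A \<in> carrier_mat k k" and b: "\<And>i j. i < k \<Longrightarrow> j < k \<Longrightarrow> \<bar>A $$ (i, j)\<bar> \<le> b"
  shows "\<bar>Determinant.det A\<bar> \<le> fact k * b ^ k"
proof -
  let ?P = "{p. p permutes {0..<k}}"
  have "\<bar>signof p * (\<Prod>i = 0..<k. A $$ (i, p i))\<bar> \<le> b ^ k" if p: "p \<in> ?P" for p
  proof -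
    have "\<bar>\<Prod>i = 0..<k. A $$ (i, p i)\<bar> = (\<Prod>i = 0..<k. \<bar>A $$ (i, p i)\<bar>)" by (rule abs_prod)
    also have "\<dots> \<le> (\<Prod>i = 0..<k. b)"
    proof (rule prod_mono)
      fix i assume i: "i \<in> {0..<k}"
      then have "p i \<in> {0..<k}" using p permutes_in_image[of p "{0..<k}" i] by simp
      then show "0 \<le> \<bar>A $$ (i, p i)\<bar> \<and> \<bar>A $$ (i, p i)\<bar> \<le> b" using i b by simp
    qed
    finally show ?thesis by (simp add: abs_mult sign_def)
  qed
  then have "\<bar>Determinant.det A\<bar> \<le> (\<Sum>p\<in>?P. b ^ k)"
    unfolding det_def'[OF A] by (intro order_trans[OF sum_abs] sum_mono)
  also have "\<dots> = fact k * b ^ k" by (simp add: card_permutations[OF refl])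
  finally show ?thesis .
qed

lemma abs_adj_mat_le:
  fixes A :: "real mat"
  assumes A: "A \<in> carrier_mat k k" and b: "\<And>i j. i < k \<Longrightarrow> j < k \<Longrightarrow> \<bar>A $$ (i, j)\<bar> \<le> b"
    and ij: "i < k" "j < k"
  shows "\<bar>adj_mat A $$ (i, j)\<bar> \<le> fact (k - 1) * b ^ (k - 1)"
proof -
  have "\<bar>adj_mat A $$ (i, j)\<bar> = \<bar>Determinant.det (mat_delete A j i)\<bar>"
    using A ij unfolding adj_mat_def cofactor_def by (simp add: abs_mult power_abs)
  also have "\<dots> \<le> fact (k - 1) * b ^ (k - 1)"
  proof (rule abs_det_le)
    show "mat_delete A j i \<in> carrier_mat (k - 1) (k - 1)" by (rule mat_delete_carrier[OF A])
    fix p q assume "p < k - 1" "q < k - 1"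
    then show "\<bar>mat_delete A j i $$ (p, q)\<bar> \<le> b" using A b by (simp add: mat_delete_def)
  qed
  finally show ?thesis .
qed

lemma mat_mult_index:
  fixes A B :: "real mat"
  assumes "A \<in> carrier_mat k k" "B \<in> carrier_mat k k" "i < k" "j < k"
  shows "(A * B) $$ (i, j) = (\<Sum>p<k. A $$ (i, p) * B $$ (p, j))"
  using assms by (auto simp: scalar_prod_def atLeast0LessThan intro!: sum.cong)

text \<open>Applying the adjugate to the image of \<open>c\<close> returns \<open>det A\<close>
  times \<open>c\<close>. So an almost annihilated vector with a large coordinate forces a small
  determinant.\<close>

lemma abs_det_le_if_small_image:
  fixes A :: "real mat"
  assumes A: "A \<in> carrier_mat k k" and b: "\<And>i j. i < k \<Longrightarrow> j < k \<Longrightarrow> \<bar>A $$ (i, j)\<bar> \<le> b"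
    and small: "\<And>i. i < k \<Longrightarrow> \<bar>\<Sum>j<k. A $$ (i, j) * c j\<bar> \<le> \<epsilon>" and j: "j < k"
  shows "\<bar>Determinant.det A\<bar> * \<bar>c j\<bar> \<le> fact k * b ^ (k - 1) * \<epsilon>"
proof -
  let ?d = "Determinant.det A" and ?B = "adj_mat A"
  note adj = adj_mat[OF A]
  have "(\<Sum>q<k. ?B $$ (j, q) * A $$ (q, p)) = (if p = j then ?d else 0)" if "p < k" for p
    using mat_mult_index[OF adj(1) A j that] adj(3) j that by (auto simp: index_mat)
  then have "?d * c j = (\<Sum>p<k. (\<Sum>q<k. ?B $$ (j, q) * A $$ (q, p)) * c p)"
    using j by (simp add: if_distrib[of "\<lambda>x. x * _"] sum.delta cong: if_cong)
  also have "\<dots> = (\<Sum>q<k. ?B $$ (j, q) * (\<Sum>p<k. A $$ (q, p) * c p))"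
    unfolding sum_distrib_left sum_distrib_right by (subst sum.swap) (simp add: mult.assoc)
  finally have eq: "?d * c j = (\<Sum>q<k. ?B $$ (j, q) * (\<Sum>p<k. A $$ (q, p) * c p))" .
  have "\<bar>?d\<bar> * \<bar>c j\<bar> \<le> (\<Sum>q<k. \<bar>?B $$ (j, q) * (\<Sum>p<k. A $$ (q, p) * c p)\<bar>)"
    unfolding abs_mult[symmetric] eq by (rule sum_abs)
  also have "\<dots> \<le> (\<Sum>q<k. fact (k - 1) * b ^ (k - 1) * \<epsilon>)"
  proof (rule sum_mono)
    fix q assume "q \<in> {..<k}"
    then have q: "q < k" by simp
    have "0 \<le> fact (k - 1) * b ^ (k - 1)" using abs_adj_mat_le[OF A b j q] by linarith
    then show "\<bar>?B $$ (j, q) * (\<Sum>p<k. A $$ (q, p) * c p)\<bar> \<le> fact (k - 1) * b ^ (k - 1) * \<epsilon>"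
      unfolding abs_mult using abs_adj_mat_le[OF A b j q] small[OF q] by (intro mult_mono) auto
  qed
  also have "\<dots> = fact k * b ^ (k - 1) * \<epsilon>" using j by (simp add: fact_reduce)
  finally show ?thesis .
qed

text \<open>The columns of the adjugate are mapped to multiples of unit vectors, so they are bounded by
  \<open>\<bar>det A\<bar> / \<delta>\<close>; combine this with \<open>det (adj A) = det A ^ (k - 1)\<close>.\<close>

lemma abs_det_ge_if_expanding:
  fixes A :: "real mat"
  assumes A: "A \<in> carrier_mat k k" and k: "1 \<le> k" and \<delta>: "0 < \<delta>"
    and exp: "\<And>c \<epsilon> j. (\<And>i. i < k \<Longrightarrow> \<bar>\<Sum>j<k. A $$ (i, j) * c j\<bar> \<le> \<epsilon>) \<Longrightarrow> j < k \<Longrightarrow> \<delta> * \<bar>c j\<bar> \<le> \<epsilon>"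
  shows "\<delta> ^ k / fact k \<le> \<bar>Determinant.det A\<bar>"
proof -
  let ?d = "Determinant.det A" and ?B = "adj_mat A"
  note adj = adj_mat[OF A]
  have d: "?d \<noteq> 0"
  proof
    assume "?d = 0"
    then obtain v where v: "v \<in> carrier_vec k" "v \<noteq> 0\<^sub>v k" "A *\<^sub>v v = 0\<^sub>v k"
      using det_0_iff_vec_prod_zero_field[OF A] by blast
    have "(\<Sum>j<k. A $$ (i, j) * v $ j) = 0" if i: "i < k" for i
    proof -
      have "(A *\<^sub>v v) $ i = (\<Sum>j<k. A $$ (i, j) * v $ j)"
        using A v(1) i by (auto simp: scalar_prod_def atLeast0LessThan intro!: sum.cong)
      then show ?thesis using v(3) i by simp
    qed
    then have "\<delta> * \<bar>v $ j\<bar> \<le> 0" if "j < k" for j using exp[of "\<lambda>j. v $ j" 0 j] that by simp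
    then have "v $ j = 0" if "j < k" for j using \<delta> that by (simp add: mult_le_0_iff)
    then have "v = 0\<^sub>v k" using v(1) by (intro eq_vecI) auto
    then show False using v(2) by simp
  qed
  have "\<bar>?B $$ (p, q)\<bar> \<le> \<bar>?d\<bar> / \<delta>" if pq: "p < k" "q < k" for p q
  proof -
    have "(\<Sum>j<k. A $$ (i, j) * ?B $$ (j, q)) = (if i = q then ?d else 0)" if "i < k" for i
      using mat_mult_index[OF A adj(1) that pq(2)] adj(2) that pq by (auto simp: index_mat)
    then have "\<delta> * \<bar>?B $$ (p, q)\<bar> \<le> \<bar>?d\<bar>" using exp[of "\<lambda>j. ?B $$ (j, q)" "\<bar>?d\<bar>" p] pq by simp
    then show ?thesis using \<delta> by (simp add: field_simps)
  qed
  then have "\<bar>Determinant.det ?B\<bar> \<le> fact k * (\<bar>?d\<bar> / \<delta>) ^ k" by (rule abs_det_le[OF adj(1)])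
  moreover have "?d * Determinant.det ?B = ?d ^ k"
    using det_mult[OF A adj(1)] adj(2) by simp
  then have "\<bar>?d\<bar> * \<bar>Determinant.det ?B\<bar> = \<bar>?d\<bar> ^ k" unfolding abs_mult[symmetric] power_abs[symmetric] by simp
  \<comment> \<open>The entrywise bound on the adjugate brings back the same power of
    \<open>?d\<close> on the right, and it cancels because \<open>?d \<noteq> 0\<close>.\<close>
  ultimately have "\<bar>?d\<bar> ^ k \<le> \<bar>?d\<bar> * (fact k * (\<bar>?d\<bar> / \<delta>) ^ k)"
    using mult_left_mono[of "\<bar>Determinant.det ?B\<bar>" _ "\<bar>?d\<bar>"] by simp
  also have "\<dots> = \<bar>?d\<bar> ^ k * (\<bar>?d\<bar> * fact k / \<delta> ^ k)" by (simp add: power_divide)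
  finally have "\<bar>?d\<bar> ^ k * 1 \<le> \<bar>?d\<bar> ^ k * (\<bar>?d\<bar> * fact k / \<delta> ^ k)" by simp
  moreover have "0 < \<bar>?d\<bar> ^ k" using d by simp
  ultimately have "1 \<le> \<bar>?d\<bar> * fact k / \<delta> ^ k" by (simp only: mult_le_cancel_left_pos)
  then show ?thesis using \<delta> by (simp add: field_simps)
qed

subsection \<open>Injective cocycles over a compact base\<close>

text \<open>Monotonicity in the constant lets the maximum over a finite subcover serve
  everywhere.\<close>

lemma compact_UNIV_uniform:
  fixes P :: "real \<Rightarrow> 'x::topological_space \<Rightarrow> bool"
  assumes comp: "compact (UNIV :: 'x set)"
    and loc: "\<And>x. \<exists>c. \<forall>\<^sub>F y in nhds x. P c y"
    and mono: "\<And>c c' y. P c y \<Longrightarrow> c \<le> c' \<Longrightarrow> P c' y"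
  obtains c where "\<And>y. P c y"
proof -
  have "\<forall>x. \<exists>c U. open U \<and> x \<in> U \<and> (\<forall>y\<in>U. P c y)"
    using loc unfolding eventually_nhds by blast
  then obtain c U where U: "\<And>x. open (U x)" "\<And>x. x \<in> U x" "\<And>x y. y \<in> U x \<Longrightarrow> P (c x) y" by metis
  have "UNIV \<subseteq> (\<Union>x\<in>UNIV. U x)" using U(2) by blast
  then obtain D where D: "finite D" "UNIV \<subseteq> (\<Union>x\<in>D. U x)"
    using compactE_image[OF comp, of UNIV U] U(1) by (metis subset_UNIV)
  have "P (Max (c ` D)) y" for y
  proof -
    obtain x where x: "x \<in> D" "y \<in> U x" using D(2) by blast
    have "c x \<le> Max (c ` D)" using D(1) x(1) by simp
    then show ?thesis using mono[OF U(3)[OF x(2)]] by blast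
  qed
  then show ?thesis using that by blast
qed

lemma grass_continuous_near:
  assumes "grass_continuous E" "0 < \<epsilon>"
  shows "\<forall>\<^sub>F y in nhds x. near \<epsilon> (E y) (E x) \<and> near \<epsilon> (E x) (E y)"
proof -
  have s: "subspace (E y)" for y using assms(1) unfolding grass_continuous_def closed_subspaces_def by blast
  have "\<forall>\<^sub>F y in nhds x. grass_dist (E y) (E x) < ennreal \<epsilon>"
    using assms unfolding grass_continuous_def by blast
  then show ?thesis by eventually_elim (use near_if_grass_dist[OF s s] in blast)
qed

lemma grass_continuousI:
  assumes E: "\<And>x. subspace (E x)" "\<And>x. closed (E x)"
    and c: "\<And>x \<epsilon>. 0 < \<epsilon> \<Longrightarrow> \<forall>\<^sub>F y in nhds x. near \<epsilon> (E y) (E x) \<and> near \<epsilon> (E x) (E y)"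
  shows "grass_continuous E"
  unfolding grass_continuous_def closed_subspaces_def
proof (intro conjI allI impI)
  fix x and \<epsilon> :: real assume e: "0 < \<epsilon>"
  define d where "d = min (1/2) (\<epsilon>/3)"
  have d: "0 < d" "d < 1" "2 * d < \<epsilon>" using e by (auto simp: d_def)
  show "\<forall>\<^sub>F y in nhds x. grass_dist (E y) (E x) < ennreal \<epsilon>"
    using c[OF d(1), of x]
  proof eventually_elim
    case (elim y)
    then have "grass_dist (E y) (E x) \<le> ennreal (2 * d)"
      using grass_dist_if_near E(1) d(2) by blast
    also have "\<dots> < ennreal \<epsilon>" using d e by (simp add: ennreal_lessI)
    finally show ?case .
  qed
qed (use E in auto)

text \<open>In finite dimension injectivity gives a lower bound: preimages of a coordinate basis of
  the image determine a bounded inverse. The summand \<open>1\<close> keeps the constant positive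
  also for \<open>k = 0\<close>.\<close>

lemma expansion_bound_exists:
  fixes B :: "'v::real_normed_vector \<Rightarrow>\<^sub>L 'v"
  assumes E: "has_dim E k" and inj: "inj (blinfun_apply B)"
  obtains c where "0 < c" "\<And>e. e \<in> E \<Longrightarrow> norm e \<le> c * norm (B e)"
proof -
  have lin: "linear (blinfun_apply B)" by (simp add: blinfun.bounded_linear_right bounded_linear.linear)
  have "has_dim (blinfun_apply B ` E) k"
    by (rule has_dim_image[OF lin E]) (use inj linear_injective_0[OF lin] in blast)
  then obtain e l where el: "coordinates k (blinfun_apply B ` E) e l" by (rule bounded_coordinates)
  have "\<forall>i. \<exists>f. i < k \<longrightarrow> f \<in> E \<and> B f = e i" using coordinatesD(1)[OF el] by fastforce
  then obtain f where f: "\<And>i. i < k \<Longrightarrow> B (f i) = e i" by metis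
  let ?c = "1 + (\<Sum>i<k. 2 ^ k * norm (f i))"
  have pos: "0 < ?c" by (intro add_pos_nonneg sum_nonneg) auto
  have "norm v \<le> ?c * norm (B v)" if v: "v \<in> E" for v
  proof -
    let ?w = "B v"
    have "B (\<Sum>i<k. l i ?w *\<^sub>R f i) = (\<Sum>i<k. l i ?w *\<^sub>R e i)"
      by (simp add: blinfun.sum_right blinfun.scaleR_right f)
    also have "\<dots> = ?w" by (rule coordinatesD(6)[OF el]) (use v in blast)
    finally have "v = (\<Sum>i<k. l i ?w *\<^sub>R f i)" using inj by (metis injD)
    then have "norm v \<le> (\<Sum>i<k. norm (l i ?w *\<^sub>R f i))" using norm_sum by metis
    also have "\<dots> \<le> (\<Sum>i<k. 2 ^ k * norm ?w * norm (f i))"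
      using coordinatesD(4)[OF el] by (intro sum_mono) (auto intro: mult_right_mono)
    also have "\<dots> = (\<Sum>i<k. 2 ^ k * norm (f i)) * norm ?w" by (simp add: sum_distrib_left sum_distrib_right mult_ac)
    also have "\<dots> \<le> ?c * norm ?w" by (intro mult_right_mono) auto
    finally show ?thesis .
  qed
  then show ?thesis using that pos by blast
qed

lemma expansion_bound_near:
  fixes B B' :: "'v::real_normed_vector \<Rightarrow>\<^sub>L 'v"
  assumes exp: "\<And>e. e \<in> E \<Longrightarrow> norm e \<le> c * norm (B e)"
    and n: "near \<epsilon> E' E" and B: "norm (B' - B) \<le> \<epsilon>"
    and c: "0 \<le> c" and \<epsilon>: "0 \<le> \<epsilon>" "\<epsilon> * (1 + c * (1 + norm B)) \<le> 1/2" and e: "e \<in> E'"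
  shows "norm e \<le> 2 * c * norm (B' e)"
proof -
  obtain e0 where e0: "e0 \<in> E" "norm (e - e0) \<le> \<epsilon> * norm e" using n e by (rule nearE)
  have "B e0 = B' e - blinfun_apply (B' - B) e - B (e - e0)"
    by (simp add: blinfun.diff_left blinfun.diff_right)
  then have "norm (B e0) \<le> norm (B' e) + norm (blinfun_apply (B' - B) e) + norm (B (e - e0))"
    using norm_triangle_ineq4[of "B' e - blinfun_apply (B' - B) e" "B (e - e0)"]
      norm_triangle_ineq4[of "B' e" "blinfun_apply (B' - B) e"] by simp
  moreover have "norm (blinfun_apply (B' - B) e) \<le> \<epsilon> * norm e"
    using norm_blinfun[of "B' - B" e] mult_right_mono[OF B norm_ge_zero[of e]] by linarith
  moreover have "norm (B (e - e0)) \<le> norm B * (\<epsilon> * norm e)"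
    using norm_blinfun[of B "e - e0"] mult_left_mono[OF e0(2) norm_ge_zero[of B]] by linarith
  ultimately have "norm (B e0) \<le> norm (B' e) + (\<epsilon> * norm e + norm B * (\<epsilon> * norm e))" by linarith
  then have "norm e0 \<le> c * (norm (B' e) + (\<epsilon> * norm e + norm B * (\<epsilon> * norm e)))"
    using order_trans[OF exp[OF e0(1)] mult_left_mono[OF _ c]] by blast
  moreover have "norm e \<le> norm e0 + norm (e - e0)" using norm_triangle_ineq[of e0 "e - e0"] by simp
  ultimately have "norm e \<le> c * norm (B' e) + (\<epsilon> * (1 + c * (1 + norm B))) * norm e"
    using e0(2) by (simp add: algebra_simps)
  also have "(\<epsilon> * (1 + c * (1 + norm B))) * norm e \<le> 1/2 * norm e" using \<epsilon>(2) by (intro mult_right_mono) auto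
  finally show ?thesis by simp
qed

locale injective_cocycle =
  fixes T :: "'x::topological_space \<Rightarrow> 'x"
    and A :: "'x \<Rightarrow> nat \<Rightarrow> 'v::banach \<Rightarrow>\<^sub>L 'v"
    and k :: nat
  assumes comp: "compact (UNIV :: 'x set)"
    and homeo: "\<exists>S. homeomorphism UNIV UNIV T S"
    and k1: "1 \<le> k" and k_dim: "enat k \<le> edim (UNIV :: 'v set)"
    and cocyc: "continuous_cocycle T A"
    and injA: "\<And>x n. inj (blinfun_apply (A x n))"
begin

abbreviation ap where "ap x n v \<equiv> blinfun_apply (A x n) v"

lemma A_0: "ap x 0 v = v"
  using cocyc unfolding continuous_cocycle_def cocycle_def by (simp add: id_blinfun.rep_eq)

lemma A_add_blinfun: "A x (n + m) = A ((T ^^ m) x) n o\<^sub>L A x m"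
  using cocyc unfolding continuous_cocycle_def cocycle_def by blast

lemma A_add: "ap x (n + m) v = ap ((T ^^ m) x) n (ap x m v)"
  by (simp add: A_add_blinfun)

lemma A_Suc: "ap x (Suc n) v = ap ((T ^^ n) x) 1 (ap x n v)"
  using A_add[of x 1 n] by simp

lemma A_Suc': "ap x (Suc n) v = ap (T x) n (ap x 1 v)"
  using A_add[of x n 1] by simp

lemma linear_A: "linear (blinfun_apply (A x n))"
  by (simp add: blinfun.bounded_linear_right bounded_linear.linear)

lemma A_eq_0: "ap x n v = 0 \<Longrightarrow> v = 0"
  using injA linear_injective_0[OF linear_A] by blast

lemma cont_A:
  assumes "0 < \<epsilon>"
  shows "\<forall>\<^sub>F y in nhds x. norm (A y n - A x n) < \<epsilon>"
proof -
  have "continuous_on UNIV (\<lambda>x. A x n)" using cocyc unfolding continuous_cocycle_def by blast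
  then have "((\<lambda>x. A x n) \<longlongrightarrow> A x n) (nhds x)"
    unfolding continuous_on_def using tendsto_at_iff_tendsto_nhds[of "\<lambda>x. A x n" x] by simp
  from tendstoD[OF this assms] show ?thesis by (simp add: dist_norm)
qed

lemma k_dim': "enat (k - 1) \<le> edim (UNIV :: 'v set)"
proof -
  have "enat (k - 1) \<le> enat k" by simp
  then show ?thesis using k_dim by (rule order_trans)
qed

lemma A_bounded:
  obtains M where "1 \<le> M" "\<And>x. norm (A x 1) \<le> M"
proof -
  have "\<exists>c. \<forall>\<^sub>F y in nhds x. norm (A y 1) \<le> c" for x
  proof -
    have "\<forall>\<^sub>F y in nhds x. norm (A y 1 - A x 1) < 1" by (rule cont_A) simp
    then have "\<forall>\<^sub>F y in nhds x. norm (A y 1) \<le> norm (A x 1) + 1"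
    proof eventually_elim
      case (elim y)
      then show ?case using norm_triangle_ineq[of "A x 1" "A y 1 - A x 1"] by simp
    qed
    then show ?thesis by blast
  qed
  then obtain c where "\<And>y. norm (A y 1) \<le> c" using compact_UNIV_uniform[OF comp, of "\<lambda>c y. norm (A y 1) \<le> c"] order_trans by metis
  then show ?thesis using that[of "max 1 c"] by (simp add: le_max_iff_disj)
qed

text \<open>Injectivity bounds the cocycle below on each fibre \<open>E x\<close> because the fibre
  is finite-dimensional; continuity of \<open>E\<close> and \<open>A\<close> then spreads the bound
  over a neighbourhood.\<close>

lemma uniform_expansion:
  assumes E: "grass_continuous E" "\<And>x. has_dim (E x) k"
  obtains c where "0 < c" "\<And>x e. e \<in> E x \<Longrightarrow> norm e \<le> c * norm (ap x 1 e)"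
proof -
  let ?P = "\<lambda>c y. \<forall>e\<in>E y. norm e \<le> c * norm (ap y 1 e)"
  have "\<exists>c. \<forall>\<^sub>F y in nhds x. ?P c y" for x
  proof -
    obtain c where c: "0 < c" "\<And>e. e \<in> E x \<Longrightarrow> norm e \<le> c * norm (ap x 1 e)"
      using expansion_bound_exists[OF E(2) injA] by metis
    let ?q = "1 + c * (1 + norm (A x 1))"
    define \<epsilon> where "\<epsilon> = 1 / (2 * ?q)"
    have q: "0 < ?q" using c by (intro add_pos_nonneg) auto
    then have \<epsilon>: "0 < \<epsilon>" "\<epsilon> * ?q \<le> 1/2" by (simp_all add: \<epsilon>_def)
    have "\<forall>\<^sub>F y in nhds x. ?P (2 * c) y"
      using grass_continuous_near[OF E(1) \<epsilon>(1), of x] cont_A[OF \<epsilon>(1), of 1 x]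
    proof eventually_elim
      case (elim y)
      show ?case
      proof
        fix e assume "e \<in> E y"
        with elim \<epsilon> c show "norm e \<le> 2 * c * norm (ap y 1 e)"
          by (intro expansion_bound_near[of "E x" c "A x 1" \<epsilon> "E y"]) auto
      qed
    qed
    then show ?thesis by blast
  qed
  moreover have "?P c y \<Longrightarrow> c \<le> c' \<Longrightarrow> ?P c' y" for c c' y
    by (meson mult_right_mono norm_ge_zero order_trans)
  ultimately obtain c where c: "\<And>y. ?P c y" using compact_UNIV_uniform[OF comp, of ?P] by blast
  have "?P (max 1 c) y" for y
    using c[of y] by (meson max.cobounded2 mult_right_mono norm_ge_zero order_trans)
  then show ?thesis using that[of "max 1 c"] by simp
qed

lemma uniform_angle:
  fixes E F :: "'x \<Rightarrow> 'v set"
  assumes E: "grass_continuous E" "\<And>x. has_dim (E x) k" and F: "grass_continuous F"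
    and c: "\<And>x. complementary (E x) (F x)"
  obtains P where "1 \<le> P" "\<And>x. angle_bound P (E x) (F x)"
proof -
  let ?P = "\<lambda>P y. angle_bound P (E y) (F y)"
  have "\<exists>c. \<forall>\<^sub>F y in nhds x. ?P c y" for x
  proof -
    have F': "subspace (F x)" "closed (F x)" using F unfolding grass_continuous_def closed_subspaces_def by blast+
    obtain P where "angle_bound P (E x) (F x)"
      using angle_bound_exists[OF E(2)[of x] F'] complementary_eq_0[OF c[of x]] unfolding angle_bound_def by blast
    then have P: "angle_bound (max 1 P) (E x) (F x)" by (rule angle_bound_mono) simp
    define \<epsilon> where "\<epsilon> = 1 / (8 * max 1 P)"
    have m: "max 1 P > 0" by simp
    then have \<epsilon>: "0 < \<epsilon>" "max 1 P * \<epsilon> \<le> 1/8" unfolding \<epsilon>_def by (auto simp: divide_simps)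
    have "\<forall>\<^sub>F y in nhds x. ?P (2 * max 1 P) y"
      using grass_continuous_near[OF E(1) \<epsilon>(1), of x] grass_continuous_near[OF F \<epsilon>(1), of x]
    proof eventually_elim
      case (elim y)
      then show ?case using angle_bound_near[OF P _ _ _ less_imp_le[OF \<epsilon>(1)] \<epsilon>(2)] by simp
    qed
    then show ?thesis by blast
  qed
  then obtain c where c: "\<And>y. ?P c y"
    using compact_UNIV_uniform[OF comp, of ?P] angle_bound_mono by metis
  then have "?P (max 1 c) y" for y by (rule angle_bound_mono) simp
  then show ?thesis using that[of "max 1 c"] by simp
qed

text \<open>Clears the quotient and the normalisation once and for all. Injectivity keeps the
  denominator nonzero, and if the sphere of \<open>F\<close> is empty the supremum in
  \<open>ennreal\<close> is \<open>0\<close>.\<close>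

lemma ratio_bound_iff:
  assumes "subspace E" "subspace F" "0 \<le> r"
  shows "(SUP (u, v) \<in> unit_sphere E \<times> unit_sphere F. ennreal (norm (ap x n v) / norm (ap x n u))) \<le> ennreal r
    \<longleftrightarrow> (\<forall>u\<in>E. \<forall>v\<in>F. norm (ap x n v) * norm u \<le> r * (norm (ap x n u) * norm v))"
    (is "?L \<longleftrightarrow> ?R")
proof
  assume L: ?L
  have unit: "norm (ap x n v) / norm (ap x n u) \<le> r" if "u \<in> unit_sphere E" "v \<in> unit_sphere F" for u v
  proof -
    have "ennreal (norm (ap x n v) / norm (ap x n u)) \<le>
        (SUP (u, v) \<in> unit_sphere E \<times> unit_sphere F. ennreal (norm (ap x n v) / norm (ap x n u)))"
      using that by (intro SUP_upper2[of "(u, v)"]) auto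
    then show ?thesis using L assms(3) by (meson ennreal_le_iff order_trans)
  qed
  show ?R
  proof (intro ballI)
    fix u v assume uv: "u \<in> E" "v \<in> F"
    show "norm (ap x n v) * norm u \<le> r * (norm (ap x n u) * norm v)"
    proof (cases "u = 0 \<or> v = 0")
      case True
      then show ?thesis using assms(3) by auto
    next
      case False
      let ?u = "(1 / norm u) *\<^sub>R u" and ?v = "(1 / norm v) *\<^sub>R v"
      have "norm (ap x n ?v) / norm (ap x n ?u) \<le> r"
        using False uv subspace_scale assms(1,2) by (intro unit) (auto simp: unit_sphere_def)
      then have "(norm (ap x n v) / norm v) / (norm (ap x n u) / norm u) \<le> r"
        by (simp add: blinfun.scaleR_right divide_simps)
      moreover have "0 < norm (ap x n u)" using False A_eq_0 by auto
      ultimately show ?thesis using False by (simp add: field_simps)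
    qed
  qed
next
  assume R: ?R
  show ?L
  proof (rule SUP_least)
    fix p assume "p \<in> unit_sphere E \<times> unit_sphere F"
    then obtain u v where p: "p = (u, v)" "u \<in> E" "norm u = 1" "v \<in> F" "norm v = 1"
      by (auto simp: unit_sphere_def)
    have "u \<noteq> 0" using p(3) by auto
    then have "0 < norm (ap x n u)" using A_eq_0 by auto
    moreover have "norm (ap x n v) \<le> r * norm (ap x n u)" using R[rule_format, OF p(2,4)] p(3,5) by simp
    ultimately have "norm (ap x n v) / norm (ap x n u) \<le> r" by (simp add: divide_le_eq)
    then show "(case p of (u, v) \<Rightarrow> ennreal (norm (ap x n v) / norm (ap x n u))) \<le> ennreal r"
      by (simp add: p(1) ennreal_leI)
  qed
qed

section \<open>From a dominated splitting to the gap\<close>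

lemma expansion_funpow:
  assumes E: "\<And>x v. v \<in> E x \<Longrightarrow> ap x 1 v \<in> E (T x)"
    and q: "0 < q" "\<And>x e. e \<in> E x \<Longrightarrow> norm e \<le> q * norm (ap x 1 e)" and e: "e \<in> E x"
  shows "ap x n e \<in> E ((T ^^ n) x)" "norm e \<le> q ^ n * norm (ap x n e)"
proof -
  show *: "ap x n e \<in> E ((T ^^ n) x)" for n
  proof (induction n)
    case (Suc n)
    then show ?case using E[OF Suc] A_Suc[of x n e] by simp
  qed (simp add: A_0 e)
  show "norm e \<le> q ^ n * norm (ap x n e)"
  proof (induction n)
    case (Suc n)
    have "q ^ n * norm (ap x n e) \<le> q ^ n * (q * norm (ap x (Suc n) e))"
      using q(2)[OF *] q(1) A_Suc[of x n e] by (intro mult_left_mono) simp_all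
    then show ?case using Suc by (simp add: mult_ac)
  qed (simp add: A_0)
qed

text \<open>Two mismatches separate domination from the gap: the Gelfand numbers on the left live at
  time \<open>n\<close>, one at \<open>x\<close> and one at \<open>T x\<close>, the right one at
  \<open>x\<close> and time \<open>n + 1\<close>. Each mismatch costs one factor \<open>q\<close>,
  the uniform lower bound of the cocycle on \<open>E\<close>.\<close>

lemma gap_if_dominated:
  assumes split: "continuous_equivariant_splitting T A E F" and dimE: "\<And>x. edim (E x) = enat k"
    and K: "0 < K" and \<tau>: "0 < \<tau>" "\<tau> < 1"
    and dom: "\<And>x n. 1 \<le> n \<Longrightarrow>
      (SUP (u, v) \<in> unit_sphere (E x) \<times> unit_sphere (F x). ennreal (norm (ap x n v) / norm (ap x n u)))
        \<le> ennreal (K * \<tau> ^ n)"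
  shows "\<exists>K \<tau> :: real. K > 0 \<and> 0 < \<tau> \<and> \<tau> < 1 \<and>
    (\<forall>x. \<forall>n\<ge>1. max (gelfand_number (k + 1) (A x n)) (gelfand_number (k + 1) (A (T x) n))
      < K * \<tau> ^ n * gelfand_number k (A x (n + 1)))"
proof -
  have gE: "grass_continuous E" and gF: "grass_continuous F" and c: "\<And>x. complementary (E x) (F x)"
    and eqv: "\<And>x n. 1 \<le> n \<Longrightarrow> blinfun_apply (A x n) ` E x = E ((T ^^ n) x)"
    using split unfolding continuous_equivariant_splitting_def by blast+
  have sE: "subspace (E x)" and sF: "subspace (F x)" for x using complementaryD[OF c] by blast+
  have dE: "has_dim (E x) k" for x using dimE edim_eq_iff_has_dim[OF sE] by blast
  have clF: "closed (F x)" for x using gF unfolding grass_continuous_def closed_subspaces_def by blast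
  have codF: "has_codim (F x) (k + 1 - 1)" for x using c[of x] dE[of x] has_codim_iff by (metis add_diff_cancel_right')
  obtain q where q: "0 < q" "\<And>x e. e \<in> E x \<Longrightarrow> norm e \<le> q * norm (ap x 1 e)"
    using uniform_expansion[OF gE dE] by blast
  have r: "norm (ap x n v) * norm u \<le> K * \<tau> ^ n * (norm (ap x n u) * norm v)"
    if "1 \<le> n" "u \<in> E x" "v \<in> F x" for x n u v
    using dom[OF that(1), of x] that(2,3) K \<tau> ratio_bound_iff[OF sE sF] by simp
  have E1: "ap x 1 v \<in> E (T x)" if "v \<in> E x" for x v
    using eqv[of 1 x] that by auto
  have En: "ap x n e \<in> E ((T ^^ n) x)" and expn: "norm e \<le> q ^ n * norm (ap x n e)" if "e \<in> E x" for x n e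
    using expansion_funpow[of E q e x n] E1 q that by blast+
  \<comment> \<open>Domination compares each vector of \<open>F x\<close> with every single
    \<open>e\<close>, so the growth of any one \<open>e\<close> bounds the norm on
    \<open>F x\<close>.\<close>
  have up: "gelfand_number (k + 1) (A x n) * norm e \<le> K * \<tau> ^ n * norm (ap x n e)"
    if "1 \<le> n" "e \<in> E x" for x n e
  proof (cases "e = 0")
    case False
    have "gelfand_number (k + 1) (A x n) \<le> K * \<tau> ^ n * norm (ap x n e) / norm e"
    proof (rule gelfand_le[OF clF codF])
      fix g assume "g \<in> F x"
      from r[OF that this] show "norm (ap x n g) \<le> K * \<tau> ^ n * norm (ap x n e) / norm e * norm g"
        using False by (simp add: field_simps)
    qed (use K \<tau> in simp)
    then show ?thesis using False by (simp add: field_simps)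
  qed simp
  have ge: "m \<le> gelfand_number k (A x n)" if "\<And>e. e \<in> E x \<Longrightarrow> m * norm e \<le> norm (ap x n e)" for m x n
  proof (rule gelfand_ge[OF k_dim'])
    fix G :: "'v set" assume "has_codim G (k - 1)"
    then obtain e where "e \<in> E x" "e \<in> G" "e \<noteq> 0" using has_dim_codim_inter[OF _ dE, of G "k - 1" x] k1 by auto
    then show "\<exists>g\<in>G. g \<noteq> 0 \<and> m * norm g \<le> norm (ap x n g)" using that by blast
  qed
  \<comment> \<open>Positivity upgrades the final estimate to the strict inequality of the gap, at
    the price of doubling the constant.\<close>
  have pos: "0 < gelfand_number k (A x n)" for x n
  proof -
    have "1 / q ^ n \<le> gelfand_number k (A x n)"
      using expn q(1) by (intro ge) (simp add: field_simps)
    moreover have "0 < 1 / q ^ n" using q(1) by simp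
    ultimately show ?thesis by (rule less_le_trans[rotated])
  qed
  have g1: "gelfand_number (k + 1) (A x n) / (K * q * \<tau> ^ n) \<le> gelfand_number k (A x (n + 1))" if n: "1 \<le> n" for x n
  proof (rule ge)
    fix e assume e: "e \<in> E x"
    have "norm (ap x n e) \<le> q * norm (ap x (n + 1) e)" using q(2)[OF En[OF e]] A_Suc[of x n e] by simp
    then have "K * \<tau> ^ n * norm (ap x n e) \<le> K * \<tau> ^ n * (q * norm (ap x (n + 1) e))"
      using K \<tau> by (intro mult_left_mono) auto
    then have "gelfand_number (k + 1) (A x n) * norm e \<le> (K * q * \<tau> ^ n) * norm (ap x (n + 1) e)"
      using up[OF n e] by (simp add: mult_ac)
    then show "gelfand_number (k + 1) (A x n) / (K * q * \<tau> ^ n) * norm e \<le> norm (ap x (n + 1) e)"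
      using K q(1) \<tau> by (simp add: divide_le_eq mult_ac)
  qed
  \<comment> \<open>At \<open>T x\<close> the estimate is applied to \<open>ap x 1 e\<close>, and
    returning to \<open>e\<close> costs the factor \<open>q\<close>.\<close>
  have g2: "gelfand_number (k + 1) (A (T x) n) / (K * q * \<tau> ^ n) \<le> gelfand_number k (A x (n + 1))" if n: "1 \<le> n" for x n
  proof (rule ge)
    fix e assume e: "e \<in> E x"
    have e1: "ap x 1 e \<in> E (T x)" using En[OF e, of 1] by simp
    have "gelfand_number (k + 1) (A (T x) n) * norm e \<le> gelfand_number (k + 1) (A (T x) n) * (q * norm (ap x 1 e))"
      using gelfand_nonneg[of "k + 1"] k_dim q(2)[OF e] by (intro mult_left_mono) auto
    also have "\<dots> \<le> q * (K * \<tau> ^ n * norm (ap x (n + 1) e))"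
      using mult_left_mono[OF up[OF n e1], of q] q(1) A_Suc'[of x n e] by (simp add: mult_ac)
    finally show "gelfand_number (k + 1) (A (T x) n) / (K * q * \<tau> ^ n) * norm e \<le> norm (ap x (n + 1) e)"
      using K q(1) \<tau> by (simp add: divide_le_eq mult_ac)
  qed
  have "max (gelfand_number (k + 1) (A x n)) (gelfand_number (k + 1) (A (T x) n))
      < (2 * K * q) * \<tau> ^ n * gelfand_number k (A x (n + 1))" if "1 \<le> n" for x n
  proof -
    let ?d = "K * q * \<tau> ^ n"
    have d: "0 < ?d" using K q(1) \<tau> by simp
    have "gelfand_number (k + 1) (A x n) \<le> ?d * gelfand_number k (A x (n + 1))"
      "gelfand_number (k + 1) (A (T x) n) \<le> ?d * gelfand_number k (A x (n + 1))"
      using g1[OF that, of x] g2[OF that, of x] d by (simp_all add: divide_le_eq mult_ac)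
    moreover have "0 < ?d * gelfand_number k (A x (n + 1))" using d pos by (rule mult_pos_pos)
    ultimately have "max (gelfand_number (k + 1) (A x n)) (gelfand_number (k + 1) (A (T x) n))
        < 2 * (?d * gelfand_number k (A x (n + 1)))" by simp
    then show ?thesis by (simp add: mult_ac)
  qed
  then show ?thesis using K q(1) \<tau> by (intro exI[of _ "2 * K * q"] exI[of _ \<tau>]) auto
qed

end

subsection \<open>The slow spaces of a cocycle with a gap\<close>

lemma geometric_eventually_le:
  fixes \<tau> :: real
  assumes "0 < \<tau>" "\<tau> < 1" "0 < b"
  shows "\<forall>\<^sub>F n in sequentially. a * \<tau> ^ n \<le> b"
proof -
  have "(\<lambda>n. a * \<tau> ^ n) \<longlonglongrightarrow> a * 0" using assms by (intro tendsto_intros LIMSEQ_power_zero) auto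
  then have "\<forall>\<^sub>F n in sequentially. a * \<tau> ^ n < b" using assms by (intro order_tendstoD(2)) auto
  then show ?thesis by eventually_elim simp
qed

lemma geometric_eventually_le_one:
  fixes \<tau> :: real
  assumes "0 < \<tau>" "\<tau> < 1"
  shows "\<forall>\<^sub>F n in sequentially. a * \<tau> ^ n \<le> 1"
  using assms by (rule geometric_eventually_le) simp

lemma closed_geometric_approx:
  fixes \<tau> :: real and G :: "'v::real_normed_vector set"
  assumes G: "closed G" and \<tau>: "0 < \<tau>" "\<tau> < 1"
    and v: "\<forall>\<^sub>F n in sequentially. \<exists>g\<in>G. norm (v - g) \<le> a * \<tau> ^ n"
  shows "v \<in> G"
proof -
  have "\<exists>g\<in>G. dist g v < e" if "0 < e" for e
  proof -
    have "\<forall>\<^sub>F n in sequentially. \<exists>g\<in>G. dist g v < e"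
      using v geometric_eventually_le[OF \<tau> half_gt_zero[OF that], of a]
    proof eventually_elim
      case (elim n)
      then obtain g where "g \<in> G" "norm (v - g) \<le> a * \<tau> ^ n" by blast
      then show ?case using elim that by (intro bexI[of _ g]) (auto simp: dist_norm norm_minus_commute)
    qed
    then show ?thesis using eventually_happens' sequentially_bot by blast
  qed
  then have "v \<in> closure G" unfolding closure_approachable by blast
  then show ?thesis using G by simp
qed

text \<open>Common scheme for the equivariance of slow and fast spaces: a vector of \<open>H\<close>
  is approximated in the finite-time spaces \<open>X n\<close>, whose images approach the closed set
  \<open>G\<close>, and both errors vanish geometrically.\<close>

lemma image_subset_if_near:
  fixes B :: "'v::real_normed_vector \<Rightarrow>\<^sub>L 'v" and \<tau> :: real
  assumes G: "closed G" and \<tau>: "0 < \<tau>" "\<tau> < 1" and D: "0 < D" and C: "0 < C"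
    and near: "\<forall>\<^sub>F n in sequentially. near (D * \<tau> ^ n) H (X n)"
    and img: "\<forall>\<^sub>F n in sequentially. \<forall>f\<in>X n. \<exists>g\<in>G. norm (B f - g) \<le> C * \<tau> ^ n * norm f"
    and v: "v \<in> H"
  shows "B v \<in> G"
proof (rule closed_geometric_approx[OF G \<tau>])
  show "\<forall>\<^sub>F n in sequentially. \<exists>g\<in>G. norm (B v - g) \<le> (norm B * D * norm v + C * (2 * norm v)) * \<tau> ^ n"
    using geometric_eventually_le_one[OF \<tau>, of D] near img
  proof eventually_elim
    case (elim n)
    obtain f where f: "f \<in> X n" "norm (v - f) \<le> D * \<tau> ^ n * norm v" using elim(2) v by (rule nearE)
    have "D * \<tau> ^ n * norm v \<le> 1 * norm v" using elim(1) by (intro mult_right_mono) auto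
    then have nf: "norm f \<le> 2 * norm v" using norm_triangle_ineq4[of v "v - f"] f(2) by simp
    obtain g where g: "g \<in> G" "norm (B f - g) \<le> C * \<tau> ^ n * norm f" using elim(3) f(1) by blast
    have "norm (B v - B f) \<le> norm B * (D * \<tau> ^ n * norm v)"
      using norm_blinfun[of B "v - f"] mult_left_mono[OF f(2) norm_ge_zero[of B]] by (simp add: blinfun.diff_right)
    moreover have "C * \<tau> ^ n * norm f \<le> C * \<tau> ^ n * (2 * norm v)" using nf C \<tau> by (intro mult_left_mono) auto
    ultimately have "norm (B v - g) \<le> norm B * (D * \<tau> ^ n * norm v) + C * \<tau> ^ n * (2 * norm v)"
      using g(2) norm_triangle_ineq[of "B v - B f" "B f - g"] by simp
    also have "\<dots> = (norm B * D * norm v + C * (2 * norm v)) * \<tau> ^ n" by (simp add: algebra_simps)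
    finally show ?case using g(1) by blast
  qed
qed

text \<open>The constant and the starting time do not depend on \<open>x\<close>; continuity of the
  limit spaces rests on this.\<close>

lemma limit_space_near_uniform:
  fixes G :: "'x \<Rightarrow> nat \<Rightarrow> 'v::banach set" and \<tau> :: real
  assumes G: "\<And>x n. subspace (G x n)" and q: "0 < q" and \<tau>: "0 < \<tau>" "\<tau> < 1"
    and n: "\<forall>\<^sub>F n in sequentially. \<forall>x. near (q * \<tau> ^ n) (G x n) (G x (Suc n)) \<and> near (q * \<tau> ^ n) (G x (Suc n)) (G x n)"
  obtains C where "0 < C" "\<forall>\<^sub>F n in sequentially. \<forall>x. near (C * \<tau> ^ n) (G x n) (limit_space (G x)) \<and>
    near (C * \<tau> ^ n) (limit_space (G x)) (G x n)"
proof -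
  define C where "C = 2 * q / (1 - \<tau>)"
  have C: "0 < C" using q \<tau> by (simp add: C_def)
  obtain N where N: "\<And>n. n \<ge> N \<Longrightarrow> C * \<tau> ^ n \<le> 1 \<and>
      (\<forall>x. near (q * \<tau> ^ n) (G x n) (G x (Suc n)) \<and> near (q * \<tau> ^ n) (G x (Suc n)) (G x n))"
    using eventually_conj[OF geometric_eventually_le_one[OF \<tau>, of C] n]
    unfolding eventually_sequentially by blast
  have n1: "near (q * \<tau> ^ n) (G x n) (G x (Suc n))" and n2: "near (q * \<tau> ^ n) (G x (Suc n)) (G x n)"
    if "n \<ge> N" for x n using N[OF that] by blast+
  have NN: "C * \<tau> ^ N \<le> 1" using N[of N] by simp
  have "near (2 * C * \<tau> ^ n) (limit_space (G x)) (G x n)" "near (2 * C * \<tau> ^ n) (G x n) (limit_space (G x))"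
    if "n \<ge> N" for x n
  proof -
    show "near (2 * C * \<tau> ^ n) (limit_space (G x)) (G x n)"
      by (rule near_limit_space2[where G = "G x", OF G n1 n2 q \<tau> C_def NN that])
    have "near (C * \<tau> ^ n) (G x n) (limit_space (G x))"
      by (rule near_limit_space1[where G = "G x", OF G n1 n2 q \<tau> C_def NN that])
    then show "near (2 * C * \<tau> ^ n) (G x n) (limit_space (G x))"
      by (rule near_mono) (use C \<tau> in \<open>intro mult_right_mono, auto\<close>)
  qed
  then have "\<forall>\<^sub>F n in sequentially. \<forall>x. near (2 * C * \<tau> ^ n) (G x n) (limit_space (G x)) \<and>
    near (2 * C * \<tau> ^ n) (limit_space (G x)) (G x n)"
    unfolding eventually_sequentially by blast
  moreover have "0 < 2 * C" using C by simp
  ultimately show ?thesis using that by blast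
qed

locale gapped_cocycle = injective_cocycle T A k
  for T :: "'x::topological_space \<Rightarrow> 'x" and A :: "'x \<Rightarrow> nat \<Rightarrow> 'v::banach \<Rightarrow>\<^sub>L 'v" and k +
  fixes S :: "'x \<Rightarrow> 'x" and K \<tau> M :: real
  assumes S: "homeomorphism UNIV UNIV T S"
    and K: "0 < K" and \<tau>: "0 < \<tau>" "\<tau> < 1"
    and gap: "\<And>x n. 1 \<le> n \<Longrightarrow> gelfand_number (k + 1) (A x n) < K * \<tau> ^ n * gelfand_number k (A x (n + 1))"
      "\<And>x n. 1 \<le> n \<Longrightarrow> gelfand_number (k + 1) (A (T x) n) < K * \<tau> ^ n * gelfand_number k (A x (n + 1))"
    and M: "1 \<le> M" "\<And>x. norm (A x 1) \<le> M"
begin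

lemma S_inverse: "S (T x) = x" "T (S x) = x"
  using S by (auto simp: homeomorphism_def)

lemma T_funpow_S: "(T ^^ n) ((S ^^ n) x) = x"
  by (induction n arbitrary: x) (simp_all add: funpow_swap1 S_inverse)

lemma eventually_S:
  assumes "\<forall>\<^sub>F z in nhds ((S ^^ n) x). Q z"
  shows "\<forall>\<^sub>F y in nhds x. Q ((S ^^ n) y)"
proof -
  have "continuous_on UNIV S" using S by (simp add: homeomorphism_def)
  then have "continuous_on UNIV (S ^^ n)"
  proof (induction n)
    case (Suc n)
    have "continuous_on UNIV (S \<circ> (S ^^ n))"
      by (rule continuous_on_compose[OF Suc.IH[OF Suc.prems]]) (rule continuous_on_subset[OF Suc.prems], simp)
    then show ?case by simp
  qed (simp add: continuous_on_id' id_def)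
  then have "filterlim (S ^^ n) (nhds ((S ^^ n) x)) (nhds x)"
    unfolding continuous_on_def using tendsto_at_iff_tendsto_nhds[of "S ^^ n" x] by simp
  then show ?thesis using assms unfolding filterlim_iff by blast
qed

section \<open>Growth of the Gelfand numbers along orbits\<close>

abbreviation c where "c x n \<equiv> gelfand_number k (A x n)"

lemma c_nonneg: "0 \<le> c x n"
  using gelfand_nonneg[OF k_dim'] .

lemma c_Suc: "c x (n + 1) \<le> M * c x n"
proof -
  have "c x (n + 1) \<le> norm (A ((T ^^ n) x) 1) * c x n"
    using gelfand_compose_left[OF k_dim', of "A ((T ^^ n) x) 1" "A x n"] A_add_blinfun[of x 1 n]
    by (simp add: add.commute)
  also have "\<dots> \<le> M * c x n" using M(2) c_nonneg by (intro mult_right_mono)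
  finally show ?thesis .
qed

lemma c_Suc': "c x (n + 1) \<le> M * c (T x) n"
proof -
  have "c x (n + 1) \<le> norm (A x 1) * c (T x) n"
    using gelfand_compose_right[OF k_dim', of "A (T x) n" "A x 1"] A_add_blinfun[of x n 1] by simp
  also have "\<dots> \<le> M * c (T x) n" using M(2) c_nonneg by (intro mult_right_mono)
  finally show ?thesis .
qed

text \<open>The gap is strict and its left side is nonnegative.\<close>

lemma c_Suc_pos: 
  assumes "1 \<le> n"
  shows "0 < c x (n + 1)"
proof -
  have "0 \<le> gelfand_number (k + 1) (A x n)" using gelfand_nonneg[of "k + 1" "A x n"] k_dim by simp
  then have "0 < K * \<tau> ^ n * c x (n + 1)" using gap(1)[OF assms, of x] by simp
  moreover have "0 < K * \<tau> ^ n" using K \<tau> by simp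
  ultimately show ?thesis by (rule zero_less_mult_pos)
qed

lemma c_pos: "1 \<le> n \<Longrightarrow> 0 < c x n"
  using c_Suc_pos[of n x] c_Suc[of x n] M(1) c_nonneg[of x n] by (cases "c x n = 0") auto

lemma norm_A1: "norm (ap x 1 v) \<le> M * norm v"
  using norm_blinfun[of "A x 1" v] mult_right_mono[OF M(2)[of x] norm_ge_zero[of v]] by linarith

text \<open>At time \<open>n\<close> the gap gives the constant \<open>K * M\<close>; at time
  \<open>n + 1\<close> the missing factor \<open>\<tau>\<close> has to be compensated, hence the
  quotient.\<close>

definition L where "L = K * M / \<tau>"

lemma L: "0 < L" "K * M \<le> L"
proof -
  show "0 < L" using K M \<tau> by (simp add: L_def)
  have "K * M * \<tau> \<le> K * M * 1" using K M \<tau> by (intro mult_left_mono) auto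
  then show "K * M \<le> L" using \<tau> by (simp add: L_def le_divide_eq)
qed

definition slow where
  "slow x n G \<longleftrightarrow> closed G \<and> has_codim G k \<and> (\<forall>g\<in>G. norm (ap x n g) \<le> L * \<tau> ^ n * c x n * norm g)"

lemma slowD:
  assumes "slow x n G"
  shows "closed G" "has_codim G k" "subspace G" "g \<in> G \<Longrightarrow> norm (ap x n g) \<le> L * \<tau> ^ n * c x n * norm g"
  using assms has_codim_subspace unfolding slow_def by blast+

text \<open>The index shift of the gap at work: a bound by \<open>c x (n + 1)\<close> at time
  \<open>n\<close> controls time \<open>n\<close> through \<open>c_Suc\<close> and time
  \<open>n + 1\<close> through one more application of the cocycle.\<close>

lemma slow_if_gap:
  assumes G: "closed G" "has_codim G k" and g: "\<And>g. g \<in> G \<Longrightarrow> norm (ap x n g) \<le> K * \<tau> ^ n * c x (n + 1) * norm g"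
  shows "slow x n G" "slow x (n + 1) G"
proof -
  have "K * \<tau> ^ n * c x (n + 1) \<le> K * \<tau> ^ n * (M * c x n)"
    using c_Suc K \<tau> by (intro mult_left_mono) auto
  also have "\<dots> = (K * M) * (\<tau> ^ n * c x n)" by simp
  also have "\<dots> \<le> L * (\<tau> ^ n * c x n)" using L \<tau> c_nonneg by (intro mult_right_mono) auto
  finally have "K * \<tau> ^ n * c x (n + 1) \<le> L * \<tau> ^ n * c x n" by simp
  then have "norm (ap x n h) \<le> L * \<tau> ^ n * c x n * norm h" if "h \<in> G" for h
    using g[OF that] by (meson mult_right_mono norm_ge_zero order_trans)
  then show "slow x n G" unfolding slow_def using G by blast
  have "norm (ap x (n + 1) h) \<le> L * \<tau> ^ (n + 1) * c x (n + 1) * norm h" if "h \<in> G" for h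
  proof -
    have "norm (ap x (n + 1) h) \<le> M * norm (ap x n h)" using A_Suc[of x n h] norm_A1 by simp
    also have "\<dots> \<le> M * (K * \<tau> ^ n * c x (n + 1) * norm h)" using g[OF that] M by (intro mult_left_mono) auto
    also have "\<dots> = L * \<tau> ^ (n + 1) * c x (n + 1) * norm h" using \<tau> by (simp add: L_def)
    finally show ?thesis .
  qed
  then show "slow x (n + 1) G" unfolding slow_def using G by blast
qed

lemma gelfand_Suc_lessE:
  fixes B :: "'v \<Rightarrow>\<^sub>L 'v"
  assumes "gelfand_number (k + 1) B < \<eta>"
  obtains G where "closed G" "has_codim G k" "\<And>g. g \<in> G \<Longrightarrow> norm (blinfun_apply B g) \<le> \<eta> * norm g"
proof -
  have "enat (k + 1 - 1) \<le> edim (UNIV :: 'v set)" using k_dim by simp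
  then obtain G where "closed G" "has_codim G (k + 1 - 1)" "\<And>g. g \<in> G \<Longrightarrow> norm (blinfun_apply B g) \<le> \<eta> * norm g"
    using gelfand_lessE[OF assms] by metis
  then show ?thesis using that by simp
qed

lemma slow_exists:
  assumes "1 \<le> n"
  obtains G where "slow x n G" "slow x (n + 1) G"
    "\<And>g. g \<in> G \<Longrightarrow> norm (ap x n g) \<le> K * \<tau> ^ n * c x (n + 1) * norm g"
proof -
  obtain G where G: "closed G" "has_codim G k"
    "\<And>g. g \<in> G \<Longrightarrow> norm (ap x n g) \<le> K * \<tau> ^ n * c x (n + 1) * norm g"
    using gelfand_Suc_lessE[OF gap(1)[OF assms, of x]] by metis
  then show ?thesis using that slow_if_gap[OF G] by blast
qed

definition P :: real where "P = 3 ^ k"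

lemma P: "1 \<le> P" by (simp add: P_def)

lemma Riesz_P:
  assumes "closed G" "has_codim G k"
  obtains H where "has_dim H k" "complementary H G" "angle_bound P H (G :: 'v set)"
proof -
  obtain H where H: "has_dim H k" "complementary H G"
    "\<forall>h\<in>H. \<forall>g\<in>G. norm h \<le> (3 ^ k - 1) * norm (h + g)"
    using Riesz_complement[OF assms] by (elim exE conjE)
  have "angle_bound (3 ^ k - 1) H G" unfolding angle_bound_def using H(3) .
  then have "angle_bound P H G" by (rule angle_bound_mono) (simp add: P_def)
  then show ?thesis using that H by blast
qed

text \<open>This is \<open>gelfand_le_complement\<close> with the slow error absorbed: by the choice
  of \<open>n\<close> it takes up at most half of the left side.\<close>

lemma slow_complement_expands:
  assumes G: "slow x n G" and H: "subspace H" "angle_bound Q H G" and Q: "1 \<le> Q"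
    and n: "(1 + Q) * L * \<tau> ^ n \<le> 1/2" and h: "h \<in> H"
  shows "c x n * norm h \<le> 2 * Q * norm (ap x n h)"
proof -
  have "c x n * norm h \<le> Q * norm (ap x n h) + (1 + Q) * (L * \<tau> ^ n * c x n) * norm h"
    using gelfand_le_complement[OF k1 slowD(1,2)[OF G] slowD(4)[OF G] _ H(2,1) _ h] Q L \<tau> c_nonneg
    by simp
  also have "(1 + Q) * (L * \<tau> ^ n * c x n) * norm h = ((1 + Q) * L * \<tau> ^ n) * (c x n * norm h)" by simp
  also have "\<dots> \<le> 1/2 * (c x n * norm h)" using n c_nonneg by (intro mult_right_mono) auto
  finally show ?thesis by simp
qed

text \<open>Slow spaces at one time are almost unique: any vector growing as slowly as they do lies
  near each of them. A Riesz complement of \<open>G\<close> supplies the expanding space for the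
  comparison.\<close>

lemma slow_vector_near:
  assumes G: "slow x n G" and n: "1 \<le> n" "8 * P * L * \<tau> ^ n \<le> 1"
    and v: "norm (ap x n v) \<le> L * \<tau> ^ n * c x n * r" "norm v \<le> r"
  shows "\<exists>g\<in>G. norm (v - g) \<le> 8 * P * L * \<tau> ^ n * r"
proof -
  obtain H where H: "has_dim H k" "complementary H G" "angle_bound P H G" using Riesz_P[OF slowD(1,2)[OF G]] .
  \<comment> \<open>\<open>?\<mu>\<close> is the expansion rate that
    \<open>slow_complement_expands\<close> gives for the angle constant \<open>P\<close>; the
    condition on \<open>n\<close> makes \<open>?\<eta>\<close> at most half of it.\<close>
  let ?\<mu> = "c x n / (2 * P)" and ?\<eta> = "L * \<tau> ^ n * c x n"
  have cp: "0 < c x n" using c_pos n by blast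
  have PL: "P * L * \<tau> ^ n \<le> 1/8" using n by simp
  have "1 * (L * \<tau> ^ n) \<le> P * (L * \<tau> ^ n)" using P L \<tau> by (intro mult_right_mono) auto
  then have "(1 + P) * L * \<tau> ^ n \<le> 1/2" using PL by (simp add: algebra_simps)
  then have fast: "?\<mu> * norm h \<le> norm (ap x n h)" if "h \<in> H" for h
    using slow_complement_expands[OF G has_dim_subspace[OF H(1)] H(3) P _ that] P by (simp add: divide_le_eq mult_ac)
  have "?\<eta> \<le> ?\<mu> / 2"
  proof -
    have "(P * L * \<tau> ^ n) * c x n \<le> 1/8 * c x n" using PL cp by (intro mult_right_mono) auto
    then show ?thesis using P cp by (simp add: field_simps)
  qed
  moreover have "0 < ?\<mu>" "0 \<le> ?\<eta>" using cp P L \<tau> by simp_all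
  ultimately obtain g where g: "g \<in> G" "norm (v - g) \<le> (4 * ?\<eta> / ?\<mu>) * r"
    using slow_vector_near_slow_space[OF H(2) fast slowD(4)[OF G] v] by blast
  have "4 * ?\<eta> / ?\<mu> = 8 * P * L * \<tau> ^ n" using cp P by (simp add: field_simps)
  then show ?thesis using g by metis
qed

lemma slow_near:
  assumes "slow x n G" "slow x n G'" "1 \<le> n" "8 * P * L * \<tau> ^ n \<le> 1"
  shows "near (8 * P * L * \<tau> ^ n) G G'"
  unfolding near_def using slow_vector_near[OF assms(2-4) slowD(4)[OF assms(1)] order_refl] by blast

text \<open>The value at \<open>0\<close> is irrelevant and only makes every \<open>Fn x n\<close> a subspace.\<close>

definition Fn where
  "Fn x n = (if n = 0 then UNIV else SOME G. slow x n G \<and> slow x (n + 1) G)"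

lemma slow_Fn:
  assumes "1 \<le> n"
  shows "slow x n (Fn x n)" "slow x (n + 1) (Fn x n)"
proof -
  have "\<exists>G. slow x n G \<and> slow x (n + 1) G" using slow_exists[OF assms, of x] by metis
  from someI_ex[OF this] show "slow x n (Fn x n)" "slow x (n + 1) (Fn x n)"
    using assms by (simp_all add: Fn_def)
qed

lemma subspace_Fn: "subspace (Fn x n)"
  using slow_Fn(1)[of n x] slowD(3) by (cases "n = 0") (auto simp: Fn_def)

section \<open>The limiting slow spaces\<close>

definition Fs where "Fs x = limit_space (Fn x)"

text \<open>\<open>Fn x n\<close> and \<open>Fn x (Suc n)\<close> are both slow at time
  \<open>Suc n\<close>, hence close to each other; this is why \<open>Fn\<close> asks for slowness
  at two times.\<close>

lemma Fs_limit:
  obtains C where "0 < C" "\<forall>\<^sub>F n in sequentially. \<forall>x. near (C * \<tau> ^ n) (Fn x n) (Fs x) \<and> near (C * \<tau> ^ n) (Fs x) (Fn x n)"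
proof -
  define q where "q = 8 * P * L"
  have q: "0 < q" using P L by (simp add: q_def)
  have "\<forall>\<^sub>F n in sequentially. \<forall>x. near (q * \<tau> ^ n) (Fn x n) (Fn x (Suc n)) \<and> near (q * \<tau> ^ n) (Fn x (Suc n)) (Fn x n)"
    using geometric_eventually_le_one[OF \<tau>, of q] eventually_ge_at_top[of 1]
  proof eventually_elim
    case (elim n)
    have *: "q * \<tau> ^ Suc n \<le> q * \<tau> ^ n" using q \<tau> by (intro mult_left_mono power_decreasing) auto
    have sl: "slow x (Suc n) (Fn x n)" "slow x (Suc n) (Fn x (Suc n))" for x
      using slow_Fn[of n x] slow_Fn(1)[of "Suc n" x] elim by simp_all
    have "8 * P * L * \<tau> ^ Suc n \<le> 1" using * elim unfolding q_def by linarith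
    then have "near (q * \<tau> ^ Suc n) (Fn x n) (Fn x (Suc n))" "near (q * \<tau> ^ Suc n) (Fn x (Suc n)) (Fn x n)" for x
      unfolding q_def using slow_near[OF sl(1,2)] slow_near[OF sl(2,1)] by simp_all
    then show ?case using near_mono[OF _ *] by blast
  qed
  then obtain C where "0 < C" "\<forall>\<^sub>F n in sequentially. \<forall>x. near (C * \<tau> ^ n) (Fn x n) (limit_space (Fn x)) \<and>
      near (C * \<tau> ^ n) (limit_space (Fn x)) (Fn x n)"
    by (rule limit_space_near_uniform[OF subspace_Fn q \<tau>])
  then show ?thesis by (rule that[unfolded Fs_def])
qed

lemma closed_Fs: "closed (Fs x)"
proof -
  obtain D where D: "0 < D" "\<forall>\<^sub>F n in sequentially. \<forall>x. near (D * \<tau> ^ n) (Fn x n) (Fs x) \<and> near (D * \<tau> ^ n) (Fs x) (Fn x n)"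
    by (rule Fs_limit)
  have "\<forall>\<^sub>F n in sequentially. near (D * \<tau> ^ n) (limit_space (Fn x)) (Fn x n)"
    using D(2) by eventually_elim (simp add: Fs_def)
  then show ?thesis unfolding Fs_def by (rule closed_limit_space[OF subspace_Fn \<tau>])
qed

lemma subspace_Fs: "subspace (Fs x)"
  unfolding Fs_def by (rule subspace_limit_space[OF subspace_Fn])

lemma Fs_near:
  obtains C where "0 < C"
    "\<forall>\<^sub>F n in sequentially. \<forall>x G. slow x n G \<longrightarrow> near (C * \<tau> ^ n) G (Fs x) \<and> near (C * \<tau> ^ n) (Fs x) G"
    "\<forall>\<^sub>F n in sequentially. \<forall>x v r. norm (ap x n v) \<le> L * \<tau> ^ n * c x n * r \<longrightarrow> norm v \<le> r \<longrightarrow>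
      (\<exists>g\<in>Fs x. norm (v - g) \<le> C * \<tau> ^ n * r)"
proof -
  obtain D where D: "0 < D" "\<forall>\<^sub>F n in sequentially. \<forall>x. near (D * \<tau> ^ n) (Fn x n) (Fs x) \<and> near (D * \<tau> ^ n) (Fs x) (Fn x n)"
    by (rule Fs_limit)
  define q where "q = 8 * P * L"
  have q: "0 < q" using P L by (simp add: q_def)
  \<comment> \<open>Going first to \<open>Fn x n\<close> and then to \<open>Fs x\<close> costs
    \<open>q + 2 * D\<close>, the reverse route \<open>D + 2 * q\<close>; this constant covers
    both.\<close>
  define C where "C = 2 * q + 2 * D"
  have C: "0 < C" using q D by (simp add: C_def)
  have 2: "\<forall>\<^sub>F n in sequentially. \<forall>x v r. norm (ap x n v) \<le> L * \<tau> ^ n * c x n * r \<longrightarrow> norm v \<le> r \<longrightarrow>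
      (\<exists>g\<in>Fs x. norm (v - g) \<le> C * \<tau> ^ n * r)"
    using geometric_eventually_le_one[OF \<tau>, of q] eventually_ge_at_top[of 1] D(2)
  proof eventually_elim
    case (elim n)
    show ?case
    proof (intro allI impI)
      fix x v r assume v: "norm (ap x n v) \<le> L * \<tau> ^ n * c x n * r" "norm v \<le> r"
      obtain g where g: "g \<in> Fn x n" "norm (v - g) \<le> q * \<tau> ^ n * r"
        using slow_vector_near[OF slow_Fn(1) _ _ v] elim unfolding q_def by auto
      have r: "0 \<le> r" using v(2) norm_ge_zero order_trans by blast
      have "q * \<tau> ^ n * r \<le> 1 * r" using elim r by (intro mult_right_mono) auto
      then have ng: "norm g \<le> 2 * r" using norm_triangle_ineq4[of v "v - g"] v(2) g(2) by simp
      obtain f where f: "f \<in> Fs x" "norm (g - f) \<le> D * \<tau> ^ n * norm g"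
        using nearE[of "D * \<tau> ^ n" "Fn x n" "Fs x" g] elim g(1) by blast
      have "D * \<tau> ^ n * norm g \<le> D * \<tau> ^ n * (2 * r)" using ng D \<tau> by (intro mult_left_mono) auto
      then have "norm (v - f) \<le> q * \<tau> ^ n * r + D * \<tau> ^ n * (2 * r)"
        using f(2) g(2) norm_triangle_ineq[of "v - g" "g - f"] by simp
      also have "\<dots> \<le> C * \<tau> ^ n * r"
        using q r \<tau> mult_nonneg_nonneg[of "q * \<tau> ^ n" r] by (simp add: C_def algebra_simps)
      finally show "\<exists>g\<in>Fs x. norm (v - g) \<le> C * \<tau> ^ n * r" using f(1) by blast
    qed
  qed
  have "\<forall>\<^sub>F n in sequentially. \<forall>x G. slow x n G \<longrightarrow> near (C * \<tau> ^ n) G (Fs x) \<and> near (C * \<tau> ^ n) (Fs x) G"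
    using geometric_eventually_le_one[OF \<tau>, of q] geometric_eventually_le_one[OF \<tau>, of D]
      eventually_ge_at_top[of 1] D(2) 2
  proof eventually_elim
    case (elim n)
    show ?case
    proof (intro allI impI conjI)
      fix x G assume G: "slow x n G"
      show "near (C * \<tau> ^ n) G (Fs x)"
        unfolding near_def using elim(5) slowD(4)[OF G] by blast
      have "near (D * \<tau> ^ n + 2 * (q * \<tau> ^ n)) (Fs x) G"
      proof (rule near_trans_le)
        show "near (D * \<tau> ^ n) (Fs x) (Fn x n)" using elim by blast
        show "near (q * \<tau> ^ n) (Fn x n) G"
          using slow_near[OF slow_Fn(1) G] elim unfolding q_def by simp
      qed (use elim q \<tau> in auto)
      then show "near (C * \<tau> ^ n) (Fs x) G"
        by (rule near_mono) (use D \<tau> in \<open>simp add: C_def algebra_simps\<close>)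
    qed
  qed
  then show ?thesis using that C 2 by blast
qed

text \<open>The codimension passes to the limit through a common complement: a Riesz complement of
  \<open>Fn x n\<close> still complements \<open>Fs x\<close> once the gap is small against its
  uniform angle.\<close>

lemma has_codim_Fs: "has_codim (Fs x) k"
proof -
  obtain C where C: "0 < C"
    "\<forall>\<^sub>F n in sequentially. \<forall>x G. slow x n G \<longrightarrow> near (C * \<tau> ^ n) G (Fs x) \<and> near (C * \<tau> ^ n) (Fs x) G"
    by (rule Fs_near)
  have "0 < (1/8 :: real)" by simp
  from geometric_eventually_le[OF \<tau> this, of "P * C"]
  have "\<forall>\<^sub>F n in sequentially. has_codim (Fs x) k"
    using eventually_ge_at_top[of 1] C(2)
  proof eventually_elim
    case (elim n)
    have s: "slow x n (Fn x n)" using slow_Fn(1) elim by blast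
    obtain H where H: "has_dim H k" "complementary H (Fn x n)" "angle_bound P H (Fn x n)"
      using Riesz_P[OF slowD(1,2)[OF s]] .
    have "complementary H (Fs x)"
      using complementary_near[OF H subspace_Fs closed_Fs _ _ P, of "C * \<tau> ^ n"] elim s C(1) \<tau> by (simp add: mult.assoc)
    then show ?case using H(1) has_codim_iff by blast
  qed
  then show ?thesis by simp
qed

text \<open>Chosen pointwise, without continuity in \<open>x\<close>; only the angle constant
  \<open>P\<close> is uniform. The spaces enter through their images at large times, where the
  choice hardly matters.\<close>

definition Hs where "Hs x = (SOME H. has_dim H k \<and> complementary H (Fs x) \<and> angle_bound P H (Fs x))"

lemma Hs: "has_dim (Hs x) k" "complementary (Hs x) (Fs x)" "angle_bound P (Hs x) (Fs x)"
proof -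
  have "\<exists>H. has_dim H k \<and> complementary H (Fs x) \<and> angle_bound P H (Fs x)"
    using Riesz_P[OF closed_Fs has_codim_Fs] by metis
  from someI_ex[OF this] show "has_dim (Hs x) k" "complementary (Hs x) (Fs x)" "angle_bound P (Hs x) (Fs x)"
    unfolding Hs_def by blast+
qed

text \<open>The threshold for \<open>n\<close> depends on \<open>Q\<close> but neither on
  \<open>x\<close> nor on \<open>W\<close>. Slow spaces are close to \<open>Fs x\<close>, so an
  angle constant \<open>Q\<close> towards \<open>Fs x\<close> becomes \<open>2 * Q\<close> towards
  them, and the expansion estimate doubles this again.\<close>

lemma transversal_expands:
  assumes Q: "1 \<le> Q"
  shows "\<forall>\<^sub>F n in sequentially. \<forall>x W. has_dim W k \<longrightarrow> complementary W (Fs x) \<longrightarrow> angle_bound Q W (Fs x) \<longrightarrow>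
    (\<forall>w\<in>W. c x n * norm w \<le> 4 * Q * norm (ap x n w)) \<and>
    (\<forall>G. slow x n G \<longrightarrow> complementary W G \<and> angle_bound (2 * Q) W G)"
proof -
  obtain C where C: "0 < C"
    "\<forall>\<^sub>F n in sequentially. \<forall>x G. slow x n G \<longrightarrow> near (C * \<tau> ^ n) G (Fs x) \<and> near (C * \<tau> ^ n) (Fs x) G"
    by (rule Fs_near)
  have "0 < (1/2 :: real)" "0 < (1/8 :: real)" by simp_all
  from geometric_eventually_le[OF \<tau> this(1), of "(1 + 2 * Q) * L"] geometric_eventually_le[OF \<tau> this(2), of "Q * C"]
    eventually_ge_at_top[of 1] C(2)
  show ?thesis
  proof eventually_elim
    case (elim n)
    show ?case
    proof (intro allI impI)
      fix x W assume W: "has_dim W k" "complementary W (Fs x)" "angle_bound Q W (Fs x)"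
      have t: "complementary W G \<and> angle_bound (2 * Q) W G" if "slow x n G" for G
        using complementary_near[OF W slowD(3)[OF that] slowD(1)[OF that] _ _ Q, of "C * \<tau> ^ n"] elim that C(1) \<tau>
        by (simp add: mult.assoc)
      have s: "slow x n (Fn x n)" using slow_Fn(1) elim by blast
      have "c x n * norm w \<le> 2 * (2 * Q) * norm (ap x n w)" if "w \<in> W" for w
        using t[OF s] elim(1) Q by (intro slow_complement_expands[OF s has_dim_subspace[OF W(1)] _ _ _ that]) auto
      then show "(\<forall>w\<in>W. c x n * norm w \<le> 4 * Q * norm (ap x n w)) \<and>
          (\<forall>G. slow x n G \<longrightarrow> complementary W G \<and> angle_bound (2 * Q) W G)" using t by simp
    qed
  qed
qed

text \<open>A subspace slow at \<open>x\<close> for time \<open>n + 1\<close> is mapped by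
  \<open>A x 1\<close> to vectors that grow slowly at \<open>T x\<close> for time \<open>n\<close>,
  and such vectors lie near \<open>Fs (T x)\<close>.\<close>

lemma Fs_equivariant:
  assumes v: "v \<in> Fs x"
  shows "ap x 1 v \<in> Fs (T x)"
proof -
  obtain D where D: "0 < D" "\<forall>\<^sub>F n in sequentially. \<forall>x. near (D * \<tau> ^ n) (Fn x n) (Fs x) \<and> near (D * \<tau> ^ n) (Fs x) (Fn x n)"
    by (rule Fs_limit)
  obtain C where C: "0 < C"
    "\<forall>\<^sub>F n in sequentially. \<forall>x v r. norm (ap x n v) \<le> L * \<tau> ^ n * c x n * r \<longrightarrow> norm v \<le> r \<longrightarrow>
      (\<exists>g\<in>Fs x. norm (v - g) \<le> C * \<tau> ^ n * r)"
    by (rule Fs_near)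
  have near: "\<forall>\<^sub>F n in sequentially. near (D * \<tau> ^ n) (Fs x) (Fn x n)" using D(2) by eventually_elim blast
  have "\<forall>\<^sub>F n in sequentially. \<forall>f\<in>Fn x n. \<exists>g\<in>Fs (T x). norm (ap x 1 f - g) \<le> (C * M) * \<tau> ^ n * norm f"
    using eventually_ge_at_top[of 1] C(2)
  proof eventually_elim
    case (elim n)
    show ?case
    proof
      fix f assume f: "f \<in> Fn x n"
      have "norm (ap (T x) n (ap x 1 f)) = norm (ap x (n + 1) f)" using A_Suc'[of x n f] by simp
      also have "\<dots> \<le> L * \<tau> ^ (n + 1) * c x (n + 1) * norm f"
        using slowD(4)[OF slow_Fn(2)] elim(1) f by blast
      also have "\<dots> \<le> L * \<tau> ^ n * (M * c (T x) n) * norm f"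
        using L \<tau> c_Suc' c_nonneg M by (intro mult_right_mono mult_mono power_decreasing) auto
      finally have "norm (ap (T x) n (ap x 1 f)) \<le> L * \<tau> ^ n * c (T x) n * (M * norm f)" by (simp add: mult_ac)
      then obtain g where "g \<in> Fs (T x)" "norm (ap x 1 f - g) \<le> C * \<tau> ^ n * (M * norm f)"
        using elim(2) norm_A1 by blast
      then show "\<exists>g\<in>Fs (T x). norm (ap x 1 f - g) \<le> (C * M) * \<tau> ^ n * norm f" by (auto simp: mult_ac)
    qed
  qed
  from image_subset_if_near[OF closed_Fs \<tau> D(1) _ near this v] show ?thesis using C(1) M by simp
qed

lemma Fs_equivariant_funpow: "v \<in> Fs x \<Longrightarrow> ap x n v \<in> Fs ((T ^^ n) x)"
proof (induction n)
  case (Suc n)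
  then show ?case using Fs_equivariant[OF Suc.IH[OF Suc.prems]] A_Suc[of x n v] by simp
qed (simp add: A_0)

text \<open>The strictness of the gap leaves room for perturbation: a subspace with rate
  \<open>\<eta>\<close> strictly below the threshold stays slow when the base point moves a
  little.\<close>

lemma slow_persists:
  assumes n: "1 \<le> n"
  obtains G where "slow x n G" "\<forall>\<^sub>F y in nhds x. slow y n G"
proof -
  let ?u = "K * \<tau> ^ n * c x (n + 1)"
  obtain \<eta> where \<eta>: "gelfand_number (k + 1) (A x n) < \<eta>" "\<eta> < ?u"
    using dense[OF gap(1)[OF n, of x]] by blast
  obtain G where G: "closed G" "has_codim G k" "\<And>g. g \<in> G \<Longrightarrow> norm (ap x n g) \<le> \<eta> * norm g"
    using gelfand_Suc_lessE[OF \<eta>(1)] by metis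
  let ?a = "K * \<tau> ^ n"
  \<comment> \<open>\<open>d\<close> is spent once on the change of \<open>A\<close> at time
    \<open>n\<close> and \<open>?a\<close> times on the change of the Gelfand number at time
    \<open>n + 1\<close>; together this exhausts \<open>?u - \<eta>\<close>.\<close>
  define d where "d = (?u - \<eta>) / (1 + ?a)"
  have a: "0 < ?a" using K \<tau> by simp
  then have d: "0 < d" "d * (1 + ?a) = ?u - \<eta>" using \<eta> by (simp_all add: d_def add_pos_pos)
  have "\<forall>\<^sub>F y in nhds x. slow y n G"
    using cont_A[OF d(1), of n x] cont_A[OF d(1), of "n + 1" x]
  proof eventually_elim
    case (elim y)
    have "c x (n + 1) \<le> c y (n + 1) + norm (A x (n + 1) - A y (n + 1))" by (rule gelfand_diff[OF k_dim'])
    then have "c x (n + 1) \<le> c y (n + 1) + d" using elim(2) by (simp add: norm_minus_commute)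
    then have "?u \<le> ?a * (c y (n + 1) + d)" using a by (intro mult_left_mono) auto
    then have *: "\<eta> + d \<le> ?a * c y (n + 1)" using d(2) by (simp add: algebra_simps)
    have "norm (ap y n g) \<le> K * \<tau> ^ n * c y (n + 1) * norm g" if "g \<in> G" for g
    proof -
      have "norm (ap y n g) \<le> norm (ap x n g) + norm (blinfun_apply (A y n - A x n) g)"
        using norm_triangle_ineq[of "ap x n g" "blinfun_apply (A y n - A x n) g"] by (simp add: blinfun.diff_left)
      also have "norm (blinfun_apply (A y n - A x n) g) \<le> d * norm g"
        using norm_blinfun[of "A y n - A x n" g] mult_right_mono[OF less_imp_le[OF elim(1)] norm_ge_zero[of g]] by linarith
      also have "norm (ap x n g) + d * norm g \<le> (\<eta> + d) * norm g" using G(3)[OF that] by (simp add: distrib_right)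
      also have "\<dots> \<le> ?a * c y (n + 1) * norm g" using * by (intro mult_right_mono) auto
      finally show ?thesis by simp
    qed
    then show ?case by (rule slow_if_gap(1)[OF G(1,2)])
  qed
  moreover from this have "slow x n G" by (rule eventually_nhds_x_imp_x)
  ultimately show ?thesis using that by blast
qed

text \<open>For one fixed large time \<open>n\<close>, a single \<open>G\<close> is slow at
  \<open>x\<close> and at all nearby points, and each of the spaces \<open>Fs\<close> there is near
  it.\<close>

lemma continuous_Fs: "grass_continuous Fs"
proof (rule grass_continuousI[OF subspace_Fs closed_Fs])
  fix x and \<epsilon> :: real assume e: "0 < \<epsilon>"
  obtain C where C: "0 < C"
    "\<forall>\<^sub>F n in sequentially. \<forall>x G. slow x n G \<longrightarrow> near (C * \<tau> ^ n) G (Fs x) \<and> near (C * \<tau> ^ n) (Fs x) G"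
    by (rule Fs_near)
  have "\<forall>\<^sub>F n in sequentially. C * \<tau> ^ n \<le> min 1 (\<epsilon>/3) \<and> 1 \<le> n \<and>
    (\<forall>x G. slow x n G \<longrightarrow> near (C * \<tau> ^ n) G (Fs x) \<and> near (C * \<tau> ^ n) (Fs x) G)"
    using geometric_eventually_le[OF \<tau>, of "min 1 (\<epsilon>/3)" C] eventually_ge_at_top[of 1] C(2) e
    by (intro eventually_conj) simp_all
  then obtain n where n: "C * \<tau> ^ n \<le> min 1 (\<epsilon>/3)" "1 \<le> n"
    "\<And>x G. slow x n G \<Longrightarrow> near (C * \<tau> ^ n) G (Fs x) \<and> near (C * \<tau> ^ n) (Fs x) G"
    using eventually_happens' sequentially_bot by blast
  obtain G where G: "slow x n G" "\<forall>\<^sub>F y in nhds x. slow y n G" using slow_persists[OF n(2)] .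
  have small: "C * \<tau> ^ n + 2 * (C * \<tau> ^ n) \<le> \<epsilon>" "C * \<tau> ^ n \<le> 1" "0 \<le> C * \<tau> ^ n" using n(1) C(1) \<tau> by auto
  show "\<forall>\<^sub>F y in nhds x. near \<epsilon> (Fs y) (Fs x) \<and> near \<epsilon> (Fs x) (Fs y)"
    using G(2)
  proof eventually_elim
    case (elim y)
    have "near (C * \<tau> ^ n + 2 * (C * \<tau> ^ n)) (Fs y) (Fs x)"
      "near (C * \<tau> ^ n + 2 * (C * \<tau> ^ n)) (Fs x) (Fs y)"
      using n(3)[OF elim] n(3)[OF G(1)] small(2,3) near_trans_le by blast+
    then show ?case using near_mono small(1) by blast
  qed
qed

subsection \<open>The fast spaces\<close>

lemma Hs_expands: "\<forall>\<^sub>F n in sequentially. \<forall>x. \<forall>w\<in>Hs x. c x n * norm w \<le> 4 * P * norm (ap x n w)"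
  using transversal_expands[OF P] by eventually_elim (use Hs in blast)

text \<open>The rate \<open>\<sigma>\<close> stands for a Gelfand number at time
  \<open>n + 1\<close>, possibly at another base point than \<open>y\<close>. Measuring fast and
  slow growth against the same \<open>\<sigma>\<close> avoids bounding it below by
  \<open>c y n\<close>.\<close>

lemma fast_near:
  assumes G: "has_codim G k" "\<And>g. g \<in> G \<Longrightarrow> norm (ap y n g) \<le> K * \<tau> ^ n * \<sigma> * norm g"
    and H: "has_dim H k" "\<And>h. h \<in> H \<Longrightarrow> \<sigma> * norm h \<le> 8 * P * M * norm (ap y n h)"
    and H': "\<And>h. h \<in> H' \<Longrightarrow> \<sigma> * norm h \<le> 8 * P * M * norm (ap y n h)"
    and \<sigma>: "0 < \<sigma>" and n: "32 * P * M * K * \<tau> ^ n \<le> 1"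
  shows "near (32 * P * M * K * \<tau> ^ n) (blinfun_apply (A y n) ` H') (blinfun_apply (A y n) ` H)"
proof -
  let ?\<mu> = "\<sigma> / (8 * P * M)" and ?\<eta> = "K * \<tau> ^ n * \<sigma>"
  have PM: "0 < P * M" using P M by simp
  have f: "\<sigma> / (8 * P * M) * norm h \<le> norm (ap y n h)" if "\<sigma> * norm h \<le> 8 * P * M * norm (ap y n h)" for h
    using that PM by (simp add: divide_le_eq mult_ac)
  have "(32 * P * M * K * \<tau> ^ n) * \<sigma> \<le> 1 * \<sigma>" using n \<sigma> by (intro mult_right_mono) auto
  then have "16 * (P * M) * ?\<eta> \<le> \<sigma>"
    using \<sigma> PM K \<tau> mult_nonneg_nonneg[of "P * M" ?\<eta>] by (simp add: mult_ac)
  then have "?\<eta> \<le> ?\<mu> / 2" using PM by (simp add: le_divide_eq mult_ac)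
  moreover have "0 < ?\<mu>" "0 \<le> ?\<eta>" using PM \<sigma> K \<tau> by (simp_all add: mult.assoc)
  ultimately have "near (4 * ?\<eta> / ?\<mu>) (blinfun_apply (A y n) ` H') (blinfun_apply (A y n) ` H)"
    using fast_images_near[OF G(1) H(1) f[OF H(2)] f[OF H'] G(2)] by blast
  moreover have "4 * ?\<eta> / ?\<mu> = 32 * P * M * K * \<tau> ^ n" using \<sigma> PM by (simp add: field_simps)
  ultimately show ?thesis by metis
qed

definition En where "En x n = blinfun_apply (A ((S ^^ n) x) n) ` Hs ((S ^^ n) x)"

lemma has_dim_En: "has_dim (En x n) k"
  unfolding En_def by (rule has_dim_image[OF linear_A Hs(1)]) (rule A_eq_0)

lemma subspace_En: "subspace (En x n)"
  using has_dim_En by (rule has_dim_subspace)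

lemma fast_le:
  assumes "\<sigma> \<le> M * c y n" "c y n * norm h \<le> 8 * P * norm (ap y n h)"
  shows "\<sigma> * norm h \<le> 8 * P * M * norm (ap y n h)"
proof -
  have "\<sigma> * norm h \<le> M * c y n * norm h" using assms(1) by (intro mult_right_mono) auto
  also have "\<dots> = M * (c y n * norm h)" by simp
  also have "\<dots> \<le> M * (8 * P * norm (ap y n h))" using assms(2) M by (intro mult_left_mono) auto
  finally show ?thesis by (simp add: mult_ac)
qed

text \<open>Both spaces are images under the same operator \<open>A (T z) n\<close>, one of
  \<open>Hs (T z)\<close> and one of the image of \<open>Hs z\<close> under \<open>A z 1\<close>.
  The second half of the gap provides a slow space for this operator whose rate refers to
  \<open>c z (n + 1)\<close>, against which both images expand.\<close>

lemma En_near_Suc: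
  "\<forall>\<^sub>F n in sequentially. \<forall>x. near ((32 * P * M * K) * \<tau> ^ n) (En x n) (En x (Suc n)) \<and>
    near ((32 * P * M * K) * \<tau> ^ n) (En x (Suc n)) (En x n)"
  using geometric_eventually_le_one[OF \<tau>, of "32 * P * M * K"] eventually_ge_at_top[of 1] Hs_expands
    eventually_sequentially_Suc[THEN iffD2, OF Hs_expands]
proof eventually_elim
  case (elim n)
  show ?case
  proof
    fix x
    define z where "z = (S ^^ Suc n) x"
    have Tz: "T z = (S ^^ n) x" by (simp add: z_def S_inverse)
    let ?B = "A (T z) n" and ?\<sigma> = "c z (n + 1)"
    have E1: "En x n = blinfun_apply ?B ` Hs (T z)" by (simp add: En_def Tz)
    have E2: "En x (Suc n) = blinfun_apply ?B ` (blinfun_apply (A z 1) ` Hs z)"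
      unfolding En_def z_def[symmetric] image_image using A_Suc'[of z n] by simp
    obtain G where G: "closed G" "has_codim G k" "\<And>g. g \<in> G \<Longrightarrow> norm (ap (T z) n g) \<le> K * \<tau> ^ n * ?\<sigma> * norm g"
      using gelfand_Suc_lessE[OF gap(2)[OF elim(2), of z]] by metis
    have H1: "?\<sigma> * norm h \<le> 8 * P * M * norm (ap (T z) n h)" if "h \<in> Hs (T z)" for h
    proof (rule fast_le[OF c_Suc'])
      have "4 * P * norm (ap (T z) n h) \<le> 8 * P * norm (ap (T z) n h)" using P by (intro mult_right_mono) auto
      then show "c (T z) n * norm h \<le> 8 * P * norm (ap (T z) n h)" using elim(3) that order_trans by blast
    qed
    \<comment> \<open>\<open>h\<close> has already used up one step, so the expansion of
      \<open>Hs z\<close> at time \<open>Suc n\<close> applies.\<close>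
    have H2: "?\<sigma> * norm h \<le> 8 * P * M * norm (ap (T z) n h)" if h: "h \<in> blinfun_apply (A z 1) ` Hs z" for h
    proof -
      obtain e where e: "e \<in> Hs z" "h = ap z 1 e" using h by blast
      have "?\<sigma> * norm h \<le> ?\<sigma> * (M * norm e)" unfolding e(2) using norm_A1 c_nonneg by (intro mult_left_mono)
      also have "\<dots> = M * (c z (Suc n) * norm e)" by simp
      also have "\<dots> \<le> M * (4 * P * norm (ap z (Suc n) e))" using elim(4) e(1) M by (intro mult_left_mono) auto
      also have "\<dots> \<le> M * (8 * P * norm (ap z (Suc n) e))" using P M by (intro mult_left_mono mult_right_mono) auto
      finally show ?thesis using A_Suc'[of z n e] e(2) by (simp add: mult_ac)
    qed
    have d2: "has_dim (blinfun_apply (A z 1) ` Hs z) k" by (rule has_dim_image[OF linear_A Hs(1)]) (rule A_eq_0)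
    show "near ((32 * P * M * K) * \<tau> ^ n) (En x n) (En x (Suc n)) \<and>
      near ((32 * P * M * K) * \<tau> ^ n) (En x (Suc n)) (En x n)"
      unfolding E1 E2
      using fast_near[OF G(2,3) Hs(1) H1 H2 c_Suc_pos[OF elim(2)] elim(1)]
        fast_near[OF G(2,3) d2 H2 H1 c_Suc_pos[OF elim(2)] elim(1)] by blast
  qed
qed

definition Es where "Es x = limit_space (En x)"

lemma Es_limit:
  obtains C where "0 < C"
    "\<forall>\<^sub>F n in sequentially. \<forall>x. near (C * \<tau> ^ n) (En x n) (Es x) \<and> near (C * \<tau> ^ n) (Es x) (En x n)"
proof -
  have "0 < 32 * P * M * K" using P M K by simp
  then obtain C where "0 < C" "\<forall>\<^sub>F n in sequentially. \<forall>x. near (C * \<tau> ^ n) (En x n) (limit_space (En x)) \<and>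
      near (C * \<tau> ^ n) (limit_space (En x)) (En x n)"
    by (rule limit_space_near_uniform[OF subspace_En _ \<tau> En_near_Suc])
  then show ?thesis by (rule that[unfolded Es_def])
qed

lemma subspace_Es: "subspace (Es x)"
  unfolding Es_def by (rule subspace_limit_space[OF subspace_En])

lemma has_dim_Es: "has_dim (Es x) k"
proof -
  obtain C where C: "0 < C"
    "\<forall>\<^sub>F n in sequentially. \<forall>x. near (C * \<tau> ^ n) (En x n) (Es x) \<and> near (C * \<tau> ^ n) (Es x) (En x n)"
    by (rule Es_limit)
  have h: "0 < (1/2 :: real)" by simp
  have "\<forall>\<^sub>F n in sequentially. has_dim (Es x) k"
    using geometric_eventually_le[OF \<tau> h, of "(real k * 2 ^ k + 1) * C"] C(2)
  proof eventually_elim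
    case (elim n)
    show ?case
    proof (rule near_has_dim_eq[OF _ _ has_dim_En subspace_Es])
      show "near (C * \<tau> ^ n) (Es x) (En x n)" "near (C * \<tau> ^ n) (En x n) (Es x)" using elim by blast+
      show "0 \<le> C * \<tau> ^ n" using C \<tau> by simp
      have "(real k * 2 ^ k + 1) * (C * \<tau> ^ n) \<le> 1/2" using elim(1) by (simp only: mult.assoc)
      then show "(real k * 2 ^ k + 1) * (C * \<tau> ^ n) < 1" by linarith
    qed
  qed
  then show ?thesis by simp
qed

lemma closed_Es: "closed (Es x)"
  using has_dim_Es by (rule has_dim_closed)

lemma Es_equivariant:
  assumes v: "v \<in> Es x"
  shows "ap x 1 v \<in> Es (T x)"
proof -
  obtain C where C: "0 < C"
    "\<forall>\<^sub>F n in sequentially. \<forall>x. near (C * \<tau> ^ n) (En x n) (Es x) \<and> near (C * \<tau> ^ n) (Es x) (En x n)"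
    by (rule Es_limit)
  have near: "\<forall>\<^sub>F n in sequentially. near (C * \<tau> ^ n) (Es x) (En x n)" using C(2) by eventually_elim blast
  have "\<forall>\<^sub>F n in sequentially. \<forall>f\<in>En x n. \<exists>g\<in>Es (T x). norm (ap x 1 f - g) \<le> (C * M) * \<tau> ^ n * norm f"
    using eventually_sequentially_Suc[THEN iffD2, OF C(2)]
  proof eventually_elim
    case (elim n)
    show ?case
    proof
      fix f assume f: "f \<in> En x n"
      define z where "z = (S ^^ n) x"
      \<comment> \<open>Moving the endpoint by \<open>T\<close> and the time by one leads back to
        the same starting point, so the image of \<open>En x n\<close> lies exactly in
        \<open>En (T x) (Suc n)\<close>.\<close>
      have z: "(S ^^ Suc n) (T x) = z" by (simp only: z_def funpow_Suc_right o_apply S_inverse)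
      obtain h where h: "h \<in> Hs z" "f = ap z n h" using f unfolding En_def z_def by blast
      have "ap x 1 f = ap z (Suc n) h" using A_Suc[of z n h] h T_funpow_S[of n x] by (simp add: z_def)
      then have "ap x 1 f \<in> En (T x) (Suc n)" unfolding En_def z using h(1) by blast
      then obtain g where g: "g \<in> Es (T x)" "norm (ap x 1 f - g) \<le> C * \<tau> ^ Suc n * norm (ap x 1 f)"
        using elim nearE[of "C * \<tau> ^ Suc n" "En (T x) (Suc n)" "Es (T x)" "ap x 1 f"] by blast
      have "C * \<tau> ^ Suc n * norm (ap x 1 f) \<le> C * \<tau> ^ n * (M * norm f)"
        using C(1) \<tau> norm_A1 by (intro mult_mono mult_left_mono power_decreasing) auto
      then show "\<exists>g\<in>Es (T x). norm (ap x 1 f - g) \<le> (C * M) * \<tau> ^ n * norm f"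
        using g by (intro bexI[of _ g]) (simp_all add: mult_ac)
    qed
  qed
  from image_subset_if_near[OF closed_Es \<tau> C(1) _ near this v] show ?thesis using C(1) M by simp
qed

text \<open>Invariance gives only an inclusion; injectivity preserves the dimension and makes it an
  equality.\<close>

lemma Es_equivariant_funpow: "blinfun_apply (A x n) ` Es x = Es ((T ^^ n) x)"
proof (rule has_dim_subset_eq[OF _ has_dim_Es])
  show "has_dim (blinfun_apply (A x n) ` Es x) k" by (rule has_dim_image[OF linear_A has_dim_Es]) (rule A_eq_0)
  have "ap x n v \<in> Es ((T ^^ n) x)" if "v \<in> Es x" for v
  proof (induction n)
    case (Suc n)
    then show ?case using Es_equivariant[OF Suc.IH] A_Suc[of x n v] by simp
  qed (simp add: A_0 that)
  then show "blinfun_apply (A x n) ` Es x \<subseteq> Es ((T ^^ n) x)" by blast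
qed

text \<open>A fixed \<open>W\<close> is transported by the operators at \<open>z\<close> and at
  nearby \<open>y\<close>. Because \<open>A z n\<close> expands \<open>W\<close>, a small change of
  the operator is small relative to the image vectors and hence moves the image little in the sense
  of \<open>near\<close>.\<close>

lemma expands_persists:
  assumes n: "1 \<le> n" and W: "\<And>w. w \<in> W \<Longrightarrow> c z n * norm w \<le> 4 * P * norm (ap z n w)" and e: "0 < \<epsilon>"
  shows "\<forall>\<^sub>F y in nhds z. (\<forall>w\<in>W. c y n * norm w \<le> 8 * P * norm (ap y n w)) \<and>
    near \<epsilon> (blinfun_apply (A y n) ` W) (blinfun_apply (A z n) ` W) \<and>
    near \<epsilon> (blinfun_apply (A z n) ` W) (blinfun_apply (A y n) ` W)"
proof -
  have cz: "0 < c z n" using c_pos[OF n] .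
  \<comment> \<open>The first bound preserves the expansion, with \<open>8 * P\<close> instead of
    \<open>4 * P\<close>; the second makes the images \<open>\<epsilon>\<close>-close.\<close>
  define d where "d = min (c z n / (8 * (4 * P + 1))) (\<epsilon> * c z n / (16 * P))"
  have d: "0 < d" "d \<le> c z n / (8 * (4 * P + 1))" "d \<le> \<epsilon> * c z n / (16 * P)"
    using cz e P by (simp_all add: d_def)
  have d1: "d * (8 * (4 * P + 1)) \<le> c z n" using d(2) P by (simp add: le_divide_eq)
  have d2: "d * (16 * P) \<le> \<epsilon> * c z n" using d(3) P by (simp add: le_divide_eq)
  have "d * (8 * 1) \<le> d * (8 * (4 * P + 1))" using d P by (intro mult_left_mono) auto
  then have d3: "d \<le> c z n / 8" using d1 by simp
  show ?thesis
    using cont_A[OF d(1), of n z]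
  proof eventually_elim
    case (elim y)
    have diff: "norm (ap y n w - ap z n w) \<le> d * norm w" for w
      using norm_blinfun[of "A y n - A z n" w] mult_right_mono[OF less_imp_le[OF elim] norm_ge_zero[of w]]
      by (simp add: blinfun.diff_left)
    have cy1: "c y n \<le> c z n + d" using gelfand_diff[OF k_dim', of "A y n" "A z n"] elim by simp
    have W': "c z n * norm w \<le> 8 * P * norm (ap y n w) - (1/4) * c z n * norm w" if w: "w \<in> W" for w
    proof -
      have "norm (ap z n w) \<le> norm (ap y n w) + d * norm w"
        using norm_triangle_ineq4[of "ap y n w" "ap y n w - ap z n w"] diff[of w] by simp
      then have "4 * P * norm (ap z n w) \<le> 4 * P * (norm (ap y n w) + d * norm w)"
        using P by (intro mult_left_mono) auto
      then have "c z n * norm w \<le> 4 * P * norm (ap y n w) + 4 * P * d * norm w"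
        using W[OF w] by (simp add: algebra_simps)
      moreover have "(d * (8 * (4 * P + 1))) * norm w \<le> c z n * norm w"
        using d1 by (intro mult_right_mono) auto
      moreover have "0 \<le> d * norm w" using d by simp
      ultimately have "8 * (c z n * norm w) \<le> 32 * P * norm (ap y n w) + c z n * norm w" by (simp add: algebra_simps)
      moreover have "0 \<le> c z n * norm w" using cz by simp
      moreover have "0 \<le> P * norm (ap y n w)" using P by simp
      ultimately show ?thesis by (simp add: algebra_simps)
    qed
    have a: "c y n * norm w \<le> 8 * P * norm (ap y n w)" if w: "w \<in> W" for w
    proof -
      have "c y n * norm w \<le> (c z n + 1/8 * c z n) * norm w" using cy1 d3 by (intro mult_right_mono) auto
      moreover have "0 \<le> c z n * norm w" using cz by simp
      ultimately show ?thesis using W'[OF w] by (simp add: algebra_simps)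
    qed
    have small: "norm (ap y n w - ap z n w) \<le> \<epsilon> * b" if "c z n * norm w \<le> 16 * P * b" for w b
    proof -
      have "c z n * (d * norm w) \<le> d * (16 * P) * b" using mult_left_mono[OF that, of d] d by (simp add: mult_ac)
      also have "\<dots> \<le> \<epsilon> * c z n * b"
      proof -
        have "0 \<le> 16 * P * b" using order_trans[OF mult_nonneg_nonneg[OF less_imp_le[OF cz] norm_ge_zero] that] .
        then have "0 \<le> b" using P by (simp add: zero_le_mult_iff)
        then show ?thesis using d2 by (intro mult_right_mono) auto
      qed
      finally have "c z n * (d * norm w) \<le> c z n * (\<epsilon> * b)" by (simp add: mult_ac)
      then have "d * norm w \<le> \<epsilon> * b" using cz by simp
      then show ?thesis using diff[of w] by simp
    qed
    have "near \<epsilon> (blinfun_apply (A y n) ` W) (blinfun_apply (A z n) ` W)"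
      unfolding near_def
    proof
      fix u assume "u \<in> blinfun_apply (A y n) ` W"
      then obtain w where w: "w \<in> W" "u = ap y n w" by blast
      have "0 \<le> c z n * norm w" "0 \<le> P * norm (ap y n w)" using cz P by simp_all
      then have "norm (ap y n w - ap z n w) \<le> \<epsilon> * norm (ap y n w)"
        using W'[OF w(1)] by (intro small) (simp add: algebra_simps)
      then show "\<exists>g'\<in>blinfun_apply (A z n) ` W. norm (u - g') \<le> \<epsilon> * norm u" using w by blast
    qed
    moreover have "near \<epsilon> (blinfun_apply (A z n) ` W) (blinfun_apply (A y n) ` W)"
      unfolding near_def
    proof
      fix u assume "u \<in> blinfun_apply (A z n) ` W"
      then obtain w where w: "w \<in> W" "u = ap z n w" by blast
      have "0 \<le> P * norm (ap z n w)" using P by simp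
      then have "norm (ap y n w - ap z n w) \<le> \<epsilon> * norm (ap z n w)"
        using W[OF w(1)] by (intro small) (simp add: algebra_simps)
      then show "\<exists>g'\<in>blinfun_apply (A y n) ` W. norm (u - g') \<le> \<epsilon> * norm u" using w by (metis imageI norm_minus_commute)
    qed
    ultimately show ?case using a by blast
  qed
qed

lemma near_trans4:
  assumes "near a G1 G2" "near a G2 G3" "near a G3 G4" "near a G4 G5" "0 \<le> a" "5 * a \<le> 1"
  shows "near (7 * a) G1 G5"
proof -
  have "near (a + 2 * a) G1 G3" using near_trans_le[OF assms(1,2)] assms(5,6) by simp
  from near_trans_le[OF this assms(3)] have "near (5 * a) G1 G4" using assms(5,6) by simp
  from near_trans_le[OF this assms(4)] show ?thesis using assms(5,6) by simp
qed

text \<open>Since \<open>Hs\<close> is not continuous, \<open>En y n\<close> and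
  \<open>En x n\<close> are linked through the image of the fixed \<open>Hs z\<close> under
  \<open>A z' n\<close>: it is near \<open>En y n\<close> because both are fast at
  \<open>z'\<close>, and near \<open>En x n\<close> by continuity of the cocycle.\<close>

lemma continuous_Es: "grass_continuous Es"
proof (rule grass_continuousI[OF subspace_Es closed_Es])
  fix x and \<epsilon> :: real assume e: "0 < \<epsilon>"
  define a where "a = min (1/5) (\<epsilon>/7)"
  have a: "0 < a" "5 * a \<le> 1" "7 * a \<le> \<epsilon>" using e by (auto simp: a_def)
  obtain C where C: "0 < C"
    "\<forall>\<^sub>F n in sequentially. \<forall>x. near (C * \<tau> ^ n) (En x n) (Es x) \<and> near (C * \<tau> ^ n) (Es x) (En x n)"
    by (rule Es_limit)
  have "\<forall>\<^sub>F n in sequentially. C * \<tau> ^ n \<le> a \<and> 32 * P * M * K * \<tau> ^ n \<le> a \<and> 1 \<le> n \<and>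
    (\<forall>x. near (C * \<tau> ^ n) (En x n) (Es x) \<and> near (C * \<tau> ^ n) (Es x) (En x n)) \<and>
    (\<forall>x. \<forall>w\<in>Hs x. c x n * norm w \<le> 4 * P * norm (ap x n w))"
    by (intro eventually_conj geometric_eventually_le[OF \<tau> a(1)] eventually_ge_at_top C(2) Hs_expands)
  then obtain n where n: "C * \<tau> ^ n \<le> a" "32 * P * M * K * \<tau> ^ n \<le> a" "1 \<le> n"
    "\<And>x. near (C * \<tau> ^ n) (En x n) (Es x)" "\<And>x. near (C * \<tau> ^ n) (Es x) (En x n)"
    "\<And>x w. w \<in> Hs x \<Longrightarrow> c x n * norm w \<le> 4 * P * norm (ap x n w)"
    using eventually_happens' sequentially_bot by blast
  define z where "z = (S ^^ n) x"
  let ?W = "Hs z"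
  have "\<forall>\<^sub>F z' in nhds z. (\<forall>w\<in>?W. c z' n * norm w \<le> 8 * P * norm (ap z' n w)) \<and>
    near a (blinfun_apply (A z' n) ` ?W) (blinfun_apply (A z n) ` ?W) \<and>
    near a (blinfun_apply (A z n) ` ?W) (blinfun_apply (A z' n) ` ?W)"
    using expands_persists[OF n(3) n(6) a(1)] .
  then have "\<forall>\<^sub>F y in nhds x. (\<forall>w\<in>?W. c ((S ^^ n) y) n * norm w \<le> 8 * P * norm (ap ((S ^^ n) y) n w)) \<and>
    near a (blinfun_apply (A ((S ^^ n) y) n) ` ?W) (blinfun_apply (A z n) ` ?W) \<and>
    near a (blinfun_apply (A z n) ` ?W) (blinfun_apply (A ((S ^^ n) y) n) ` ?W)"
    unfolding z_def by (rule eventually_S)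
  then show "\<forall>\<^sub>F y in nhds x. near \<epsilon> (Es y) (Es x) \<and> near \<epsilon> (Es x) (Es y)"
  proof eventually_elim
    case (elim y)
    define z' where "z' = (S ^^ n) y"
    let ?\<sigma> = "c z' (n + 1)" and ?V = "blinfun_apply (A z' n) ` ?W"
    obtain G where G: "closed G" "has_codim G k" "\<And>g. g \<in> G \<Longrightarrow> norm (ap z' n g) \<le> K * \<tau> ^ n * ?\<sigma> * norm g"
      using gelfand_Suc_lessE[OF gap(1)[OF n(3), of z']] by metis
    have H1: "?\<sigma> * norm h \<le> 8 * P * M * norm (ap z' n h)" if "h \<in> Hs z'" for h
    proof (rule fast_le[OF c_Suc])
      have "4 * P * norm (ap z' n h) \<le> 8 * P * norm (ap z' n h)" using P by (intro mult_right_mono) auto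
      then show "c z' n * norm h \<le> 8 * P * norm (ap z' n h)" using n(6)[OF that] by linarith
    qed
    have H2: "?\<sigma> * norm h \<le> 8 * P * M * norm (ap z' n h)" if "h \<in> ?W" for h
      by (rule fast_le[OF c_Suc]) (use elim that in \<open>simp add: z'_def\<close>)
    have q1: "32 * P * M * K * \<tau> ^ n \<le> 1" using n(2) a by simp
    have V: "near a (En y n) ?V" "near a ?V (En y n)"
      using near_mono[OF fast_near[OF G(2,3) Hs(1) H1 H2 c_Suc_pos[OF n(3)] q1] n(2)]
        near_mono[OF fast_near[OF G(2,3) Hs(1) H2 H1 c_Suc_pos[OF n(3)] q1] n(2)]
      unfolding En_def z'_def[symmetric] by blast+
    have Ex: "near a ?V (En x n)" "near a (En x n) ?V"
      using elim unfolding En_def z'_def z_def[symmetric] by blast+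
    have "near (7 * a) (Es y) (Es x)"
      by (rule near_trans4[OF near_mono[OF n(5) n(1)] V(1) Ex(1) near_mono[OF n(4) n(1)] less_imp_le[OF a(1)] a(2)])
    moreover have "near (7 * a) (Es x) (Es y)"
      by (rule near_trans4[OF near_mono[OF n(5) n(1)] Ex(2) V(2) near_mono[OF n(4) n(1)] less_imp_le[OF a(1)] a(2)])
    ultimately show ?case using near_mono a(3) by blast
  qed
qed

subsection \<open>Transversality\<close>

definition Q where "Q = real k * 2 ^ k"

lemma Q: "1 \<le> Q" "real k \<le> Q"
proof -
  have *: "(1 :: real) \<le> 2 ^ k" by simp
  have "1 * 1 \<le> real k * 2 ^ k" using k1 * by (intro mult_mono) auto
  then show "1 \<le> Q" by (simp add: Q_def)
  have "real k * 1 \<le> real k * 2 ^ k" using * by (intro mult_left_mono) auto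
  then show "real k \<le> Q" by (simp add: Q_def)
qed

section \<open>Determinants of the cocycle from the complements to the fast spaces\<close>

definition EB where "EB x = (SOME e. \<exists>l. coordinates k (Es x) e l)"
definition EL where "EL x = (SOME l. coordinates k (Es x) (EB x) l)"
definition HB where "HB x = (SOME e. \<exists>l. coordinates k (Hs x) e l)"
definition HL where "HL x = (SOME l. coordinates k (Hs x) (HB x) l)"

lemma coordinates_Es: "coordinates k (Es x) (EB x) (EL x)"
proof -
  have "\<exists>e l. coordinates k (Es x) e l" using bounded_coordinates[OF has_dim_Es] by blast
  then have "\<exists>l. coordinates k (Es x) (EB x) l" unfolding EB_def by (rule someI_ex)
  then show ?thesis unfolding EL_def by (rule someI_ex)
qed

lemma coordinates_Hs: "coordinates k (Hs x) (HB x) (HL x)"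
proof -
  have "\<exists>e l. coordinates k (Hs x) e l" using bounded_coordinates[OF Hs(1)] by blast
  then have "\<exists>l. coordinates k (Hs x) (HB x) l" unfolding HB_def by (rule someI_ex)
  then show ?thesis unfolding HL_def by (rule someI_ex)
qed

lemma subspace_Hs: "subspace (Hs x)"
  using Hs(1) by (rule has_dim_subspace)

definition pE where "pE x = coordinate_sum k (EB x) (EL x)"

lemmas pE = coordinate_sum[OF coordinates_Es subspace_Es, folded pE_def Q_def]

text \<open>Matrix of \<open>pE\<close> after \<open>A x n\<close>, from \<open>Hs x\<close> to
  \<open>Es\<close> at the endpoint, in the chosen bases. The projection enters because
  \<open>A x n\<close> maps \<open>Hs x\<close> only near \<open>Es\<close>.\<close>

definition U where
  "U x n = Matrix.mat k k (\<lambda>(i, j). EL ((T ^^ n) x) i (ap x n (HB x j)))"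

abbreviation dU where "dU x n \<equiv> \<bar>Determinant.det (U x n)\<bar>"

lemma U_carrier: "U x n \<in> carrier_mat k k"
  unfolding U_def by simp

lemma U_index: "i < k \<Longrightarrow> j < k \<Longrightarrow> U x n $$ (i, j) = EL ((T ^^ n) x) i (ap x n (HB x j))"
  unfolding U_def by simp

lemma linear_EL: "i < k \<Longrightarrow> linear (EL x i)"
  using coordinatesD(3)[OF coordinates_Es] .

lemma sum_U:
  assumes "i < k"
  shows "(\<Sum>j<k. U x n $$ (i, j) * t j) = EL ((T ^^ n) x) i (ap x n (\<Sum>j<k. t j *\<^sub>R HB x j))"
proof -
  note l = linear_EL[OF assms, of "(T ^^ n) x"]
  have "EL ((T ^^ n) x) i (ap x n (\<Sum>j<k. t j *\<^sub>R HB x j))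
      = (\<Sum>j<k. t j * EL ((T ^^ n) x) i (ap x n (HB x j)))"
    by (simp add: blinfun.sum_right blinfun.scaleR_right linear_sum[OF l] linear_scale[OF l])
  then show ?thesis using assms by (simp add: U_index mult.commute)
qed

text \<open>\<open>En\<close> is indexed by its endpoint, so at \<open>(T ^^ n) x\<close> it is
  exactly the image of \<open>Hs x\<close>.\<close>

lemma An_near_Es:
  obtains C where "0 < C"
    "\<forall>\<^sub>F n in sequentially. \<forall>x. \<forall>h\<in>Hs x. \<exists>e\<in>Es ((T ^^ n) x). norm (ap x n h - e) \<le> C * \<tau> ^ n * norm (ap x n h)"
proof -
  obtain C where C: "0 < C"
    "\<forall>\<^sub>F n in sequentially. \<forall>x. near (C * \<tau> ^ n) (En x n) (Es x) \<and> near (C * \<tau> ^ n) (Es x) (En x n)"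
    by (rule Es_limit)
  have ST: "(S ^^ n) ((T ^^ n) x) = x" for n x
    by (induction n arbitrary: x) (simp_all add: funpow_swap1 S_inverse)
  have "\<forall>\<^sub>F n in sequentially. \<forall>x. \<forall>h\<in>Hs x. \<exists>e\<in>Es ((T ^^ n) x). norm (ap x n h - e) \<le> C * \<tau> ^ n * norm (ap x n h)"
    using C(2)
  proof eventually_elim
    case (elim n)
    show ?case
    proof (intro allI ballI)
      fix x h assume "h \<in> Hs x"
      then have "ap x n h \<in> En ((T ^^ n) x) n" unfolding En_def ST by blast
      moreover have "near (C * \<tau> ^ n) (En ((T ^^ n) x) n) (Es ((T ^^ n) x))" using elim by blast
      ultimately show "\<exists>e\<in>Es ((T ^^ n) x). norm (ap x n h - e) \<le> C * \<tau> ^ n * norm (ap x n h)"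
        unfolding near_def by blast
    qed
  qed
  then show ?thesis using that C(1) by blast
qed

text \<open>As \<open>pE\<close> fixes \<open>Es\<close>, its error at a vector equals its error at
  the difference to any \<open>e\<close> in \<open>Es\<close>; hence the factor
  \<open>1 + Q\<close>. The last bound makes \<open>pE\<close> injective on the images for large
  \<open>n\<close>.\<close>

lemma pE_near:
  obtains D where "0 < D"
    "\<forall>\<^sub>F n in sequentially. \<forall>x. \<forall>h\<in>Hs x. norm (ap x n h - pE ((T ^^ n) x) (ap x n h)) \<le> D * \<tau> ^ n * norm (ap x n h)"
    "\<forall>\<^sub>F n in sequentially. \<forall>x. \<forall>h\<in>Hs x. norm (ap x n h) \<le> 2 * norm (pE ((T ^^ n) x) (ap x n h))"
proof -
  obtain C where C: "0 < C"
    "\<forall>\<^sub>F n in sequentially. \<forall>x. \<forall>h\<in>Hs x. \<exists>e\<in>Es ((T ^^ n) x). norm (ap x n h - e) \<le> C * \<tau> ^ n * norm (ap x n h)"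
    by (rule An_near_Es)
  define D where "D = (1 + Q) * C"
  have D: "0 < D" using C Q by (simp add: D_def)
  have 1: "\<forall>\<^sub>F n in sequentially. \<forall>x. \<forall>h\<in>Hs x. norm (ap x n h - pE ((T ^^ n) x) (ap x n h)) \<le> D * \<tau> ^ n * norm (ap x n h)"
    using C(2)
  proof eventually_elim
    case (elim n)
    show ?case
    proof (intro allI ballI)
      fix x h assume h: "h \<in> Hs x"
      let ?v = "ap x n h" and ?y = "(T ^^ n) x"
      obtain e where e: "e \<in> Es ?y" "norm (?v - e) \<le> C * \<tau> ^ n * norm ?v" using elim h by blast
      have "?v - pE ?y ?v = (?v - e) - pE ?y (?v - e)"
        using pE(4)[OF e(1)] linear_diff[OF pE(1)] by simp
      also have "norm \<dots> \<le> norm (?v - e) + Q * norm (?v - e)"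
        using norm_triangle_ineq4[of "?v - e" "pE ?y (?v - e)"] pE(3)[of ?y "?v - e"] by simp
      also have "\<dots> = (1 + Q) * norm (?v - e)" by (simp add: algebra_simps)
      also have "\<dots> \<le> (1 + Q) * (C * \<tau> ^ n * norm ?v)" using e(2) Q by (intro mult_left_mono) auto
      finally show "norm (?v - pE ?y ?v) \<le> D * \<tau> ^ n * norm ?v" by (simp add: D_def mult_ac)
    qed
  qed
  have h: "0 < (1/2::real)" by simp
  have "\<forall>\<^sub>F n in sequentially. \<forall>x. \<forall>h\<in>Hs x. norm (ap x n h) \<le> 2 * norm (pE ((T ^^ n) x) (ap x n h))"
    using 1 geometric_eventually_le[OF \<tau> h, of D]
  proof eventually_elim
    case (elim n)
    show ?case
    proof (intro allI ballI)
      fix x h assume "h \<in> Hs x"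
      let ?v = "ap x n h" and ?y = "(T ^^ n) x"
      have "norm (?v - pE ?y ?v) \<le> D * \<tau> ^ n * norm ?v" using elim \<open>h \<in> Hs x\<close> by blast
      also have "\<dots> \<le> 1/2 * norm ?v" using elim(2) by (intro mult_right_mono) auto
      finally show "norm ?v \<le> 2 * norm (pE ?y ?v)" using norm_triangle_ineq[of "pE ?y ?v" "?v - pE ?y ?v"] by simp
    qed
  qed
  then show ?thesis using that D 1 by blast
qed

lemma pE_An_image:
  assumes "\<forall>h\<in>Hs x. norm (ap x n h) \<le> 2 * norm (pE ((T ^^ n) x) (ap x n h))"
  shows "(\<lambda>h. pE ((T ^^ n) x) (ap x n h)) ` Hs x = Es ((T ^^ n) x)"
proof (rule has_dim_subset_eq[OF has_dim_image has_dim_Es])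
  show "linear (\<lambda>h. pE ((T ^^ n) x) (ap x n h))"
    using linear_compose[OF linear_A[of x n] pE(1)] by (simp add: o_def)
  show "has_dim (Hs x) k" by (rule Hs)
  fix h assume "h \<in> Hs x" "pE ((T ^^ n) x) (ap x n h) = 0"
  then have "norm (ap x n h) \<le> 0" using assms by force
  then show "h = 0" using A_eq_0 by simp
qed (use pE(2) in blast)

text \<open>The frame \<open>r\<close> consists of the vectors in the image of \<open>Hs x\<close>
  that \<open>pE\<close> sends to the basis \<open>EB\<close>. Its coordinates are therefore given
  by the functionals \<open>EL\<close>, although the frame itself may lie outside
  \<open>Es\<close>.\<close>

lemma frame_exists:
  obtains D where "0 < D"
    "\<forall>\<^sub>F n in sequentially. \<forall>x. \<exists>r. (\<forall>j<k. norm (r j - EB ((T ^^ n) x) j) \<le> D * \<tau> ^ n) \<and>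
      (\<forall>h\<in>Hs x. ap x n h = (\<Sum>i<k. EL ((T ^^ n) x) i (ap x n h) *\<^sub>R r i))"
proof -
  obtain D where D: "0 < D"
    "\<forall>\<^sub>F n in sequentially. \<forall>x. \<forall>h\<in>Hs x. norm (ap x n h - pE ((T ^^ n) x) (ap x n h)) \<le> D * \<tau> ^ n * norm (ap x n h)"
    "\<forall>\<^sub>F n in sequentially. \<forall>x. \<forall>h\<in>Hs x. norm (ap x n h) \<le> 2 * norm (pE ((T ^^ n) x) (ap x n h))"
    by (rule pE_near)
  have "\<forall>\<^sub>F n in sequentially. \<forall>x. \<exists>r. (\<forall>j<k. norm (r j - EB ((T ^^ n) x) j) \<le> 2 * D * \<tau> ^ n) \<and>
      (\<forall>h\<in>Hs x. ap x n h = (\<Sum>i<k. EL ((T ^^ n) x) i (ap x n h) *\<^sub>R r i))"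
    using D(2,3)
  proof eventually_elim
    case (elim n)
    show ?case
    proof
      fix x
      let ?y = "(T ^^ n) x"
      have im: "(\<lambda>h. pE ?y (ap x n h)) ` Hs x = Es ?y" using elim(2) by (intro pE_An_image) blast
      have "\<forall>j. \<exists>h. j < k \<longrightarrow> h \<in> Hs x \<and> pE ?y (ap x n h) = EB ?y j"
        using im coordinatesD(1)[OF coordinates_Es[of ?y]] by (metis (no_types, lifting) imageE)
      then obtain g where g: "\<And>j. j < k \<Longrightarrow> g j \<in> Hs x" "\<And>j. j < k \<Longrightarrow> pE ?y (ap x n (g j)) = EB ?y j" by metis
      define r where "r j = ap x n (g j)" for j
      have "norm (r j - EB ?y j) \<le> 2 * D * \<tau> ^ n" if j: "j < k" for j
      proof -
        have "norm (r j) \<le> 2" using elim(2) g[OF j] coordinatesD(2)[OF coordinates_Es[of ?y] j] unfolding r_def by force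
        then have "D * \<tau> ^ n * norm (r j) \<le> D * \<tau> ^ n * 2" using D(1) \<tau> by (intro mult_left_mono) auto
        moreover have "norm (r j - EB ?y j) \<le> D * \<tau> ^ n * norm (r j)"
          using elim(1) g[OF j] unfolding r_def by (metis (no_types, lifting))
        ultimately show ?thesis by simp
      qed
      moreover have "ap x n h = (\<Sum>i<k. EL ?y i (ap x n h) *\<^sub>R r i)" if h: "h \<in> Hs x" for h
      proof -
        let ?s = "\<Sum>i<k. EL ?y i (ap x n h) *\<^sub>R g i"
        have s: "?s \<in> Hs x" using g(1) by (auto intro!: subspace_sum[OF subspace_Hs] subspace_scale[OF subspace_Hs])
        have "pE ?y (ap x n ?s) = (\<Sum>i<k. EL ?y i (ap x n h) *\<^sub>R pE ?y (ap x n (g i)))"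
          by (simp add: blinfun.sum_right blinfun.scaleR_right linear_sum[OF pE(1)] linear_scale[OF pE(1)])
        also have "\<dots> = pE ?y (ap x n h)" using g(2) by (simp add: pE_def coordinate_sum_def)
        finally have "pE ?y (ap x n (h - ?s)) = 0" by (simp add: blinfun.diff_right linear_diff[OF pE(1)])
        moreover have "h - ?s \<in> Hs x" using subspace_diff[OF subspace_Hs h s] .
        ultimately have "norm (ap x n (h - ?s)) \<le> 0" using elim(2) by force
        then have "ap x n h = ap x n ?s" by (simp add: blinfun.diff_right)
        then show ?thesis by (simp add: r_def blinfun.sum_right blinfun.scaleR_right)
      qed
      ultimately show "\<exists>r. (\<forall>j<k. norm (r j - EB ?y j) \<le> 2 * D * \<tau> ^ n) \<and>
        (\<forall>h\<in>Hs x. ap x n h = (\<Sum>i<k. EL ?y i (ap x n h) *\<^sub>R r i))" by blast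
    qed
  qed
  moreover have "0 < 2 * D" using D by simp
  ultimately show ?thesis using that by blast
qed

text \<open>Only the exponential rate at one fixed \<open>x\<close> matters, so
  \<open>\<eta>\<close> and the starting time may depend on \<open>x\<close>. From some time
  \<open>N\<close> on the images of \<open>Hs x\<close> follow \<open>Es\<close>, where the cocycle
  is uniformly bounded below; the first \<open>N\<close> steps are covered by injectivity.\<close>

lemma det_U_lower:
  obtains \<eta> \<delta> where "0 < \<eta>" "\<eta> \<le> 1" "0 < \<delta>" "\<forall>\<^sub>F n in sequentially. \<eta> * \<delta> ^ n \<le> dU x n"
proof -
  obtain q where q: "0 < q" "\<And>x e. e \<in> Es x \<Longrightarrow> norm e \<le> q * norm (ap x 1 e)"
    using uniform_expansion[OF continuous_Es has_dim_Es] by blast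
  obtain C where C: "0 < C"
    "\<forall>\<^sub>F n in sequentially. \<forall>x. \<forall>h\<in>Hs x. \<exists>e\<in>Es ((T ^^ n) x). norm (ap x n h - e) \<le> C * \<tau> ^ n * norm (ap x n h)"
    by (rule An_near_Es)
  obtain D where D: "0 < D"
    "\<forall>\<^sub>F n in sequentially. \<forall>x. \<forall>h\<in>Hs x. norm (ap x n h - pE ((T ^^ n) x) (ap x n h)) \<le> D * \<tau> ^ n * norm (ap x n h)"
    "\<forall>\<^sub>F n in sequentially. \<forall>x. \<forall>h\<in>Hs x. norm (ap x n h) \<le> 2 * norm (pE ((T ^^ n) x) (ap x n h))"
    by (rule pE_near)
  have half: "0 < (1/2::real)" by simp
  have step: "\<forall>\<^sub>F n in sequentially. \<forall>h\<in>Hs x. norm (ap x n h) \<le> 2 * q * norm (ap x (Suc n) h)"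
    using C(2) geometric_eventually_le[OF \<tau> half, of "(1 + q * M) * C"]
  proof eventually_elim
    case (elim n)
    show ?case
    proof
      fix h assume "h \<in> Hs x"
      let ?v = "ap x n h" and ?y = "(T ^^ n) x"
      obtain e where e: "e \<in> Es ?y" "norm (?v - e) \<le> C * \<tau> ^ n * norm ?v" using elim \<open>h \<in> Hs x\<close> by blast
      have "norm (ap ?y 1 e) \<le> norm (ap ?y 1 ?v) + M * norm (?v - e)"
        using norm_triangle_ineq4[of "ap ?y 1 ?v" "ap ?y 1 (?v - e)"] norm_A1[of ?y "?v - e"]
        by (simp add: blinfun.diff_right)
      then have "q * norm (ap ?y 1 e) \<le> q * (norm (ap ?y 1 ?v) + M * norm (?v - e))"
        using q(1) by (intro mult_left_mono) auto
      then have "norm ?v \<le> q * norm (ap ?y 1 ?v) + (1 + q * M) * norm (?v - e)"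
        using q(2)[OF e(1)] norm_triangle_ineq[of e "?v - e"] by (simp add: algebra_simps)
      also have "(1 + q * M) * norm (?v - e) \<le> (1 + q * M) * (C * \<tau> ^ n * norm ?v)"
        using e(2) q(1) M by (intro mult_left_mono) auto
      also have "\<dots> = ((1 + q * M) * C * \<tau> ^ n) * norm ?v" by simp
      also have "\<dots> \<le> 1/2 * norm ?v" using elim(2) by (intro mult_right_mono) auto
      finally show "norm ?v \<le> 2 * q * norm (ap x (Suc n) h)" using A_Suc[of x n h] by simp
    qed
  qed
  then obtain N where N: "\<And>n h. n \<ge> N \<Longrightarrow> h \<in> Hs x \<Longrightarrow> norm (ap x n h) \<le> 2 * q * norm (ap x (Suc n) h)"
    unfolding eventually_sequentially by blast
  obtain s where s: "0 < s" "\<And>h. h \<in> Hs x \<Longrightarrow> norm h \<le> s * norm (ap x N h)"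
    using expansion_bound_exists[OF Hs(1) injA] by metis
  have grow: "norm h \<le> s * (2 * q) ^ (n - N) * norm (ap x n h)" if "h \<in> Hs x" "n \<ge> N" for h n
    using that(2)
  proof (induction n rule: dec_induct)
    case base then show ?case using s(2)[OF that(1)] by simp
  next
    case (step n)
    have "s * (2 * q) ^ (n - N) * norm (ap x n h) \<le> s * (2 * q) ^ (n - N) * (2 * q * norm (ap x (Suc n) h))"
      using N[OF step.hyps(1) that(1)] s(1) q(1) by (intro mult_left_mono) auto
    then show ?case using step by (simp add: Suc_diff_le mult_ac)
  qed
  \<comment> \<open>Forcing \<open>1 \<le> b\<close> allows the exponent \<open>n - N\<close> to be
    replaced by \<open>n\<close>.\<close>
  define b where "b = max 1 (2 * q)"
  have b: "1 \<le> b" "2 * q \<le> b" by (auto simp: b_def)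
  \<comment> \<open>\<open>2 ^ k\<close> passes from a vector of \<open>Hs x\<close> to its
    coordinates, \<open>s\<close> covers the first \<open>N\<close> steps, and
    \<open>2 * real k\<close> passes from coordinates in \<open>Es\<close> to the norm of the
    image.\<close>
  define a where "a = 2 ^ k * s * 2 * real k"
  have a: "0 < a" using s k1 by (simp add: a_def)
  have ev: "\<forall>\<^sub>F n in sequentially. (1 / (a * b ^ n)) ^ k / fact k \<le> dU x n"
    using D(3) eventually_ge_at_top[of N]
  proof eventually_elim
    case (elim n)
    show ?case
    proof (rule abs_det_ge_if_expanding[OF U_carrier k1])
      show "0 < 1 / (a * b ^ n)" using a b by simp
      fix t \<epsilon> j assume small: "\<And>i. i < k \<Longrightarrow> \<bar>\<Sum>j<k. U x n $$ (i, j) * t j\<bar> \<le> \<epsilon>" and j: "j < k"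
      let ?h = "\<Sum>j<k. t j *\<^sub>R HB x j"
      have h: "?h \<in> Hs x" using coordinatesD(1)[OF coordinates_Hs]
        by (auto intro!: subspace_sum[OF subspace_Hs] subspace_scale[OF subspace_Hs])
      have "norm (pE ((T ^^ n) x) (ap x n ?h)) \<le> real k * \<epsilon>"
        unfolding pE_def coordinate_sum_def
        by (rule norm_sum_le_coordinates[OF coordinates_Es]) (use small sum_U in simp)
      then have "norm (ap x n ?h) \<le> 2 * (real k * \<epsilon>)" using elim(1) h by force
      moreover have "(2 * q) ^ (n - N) \<le> b ^ n"
      proof -
        have "(2 * q) ^ (n - N) \<le> b ^ (n - N)" using b q by (intro power_mono) auto
        also have "\<dots> \<le> b ^ n" using b by (intro power_increasing) auto
        finally show ?thesis .
      qed
      ultimately have "s * (2 * q) ^ (n - N) * norm (ap x n ?h) \<le> s * b ^ n * (2 * (real k * \<epsilon>))"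
        using s(1) b q(1) by (intro mult_mono) auto
      then have "norm ?h \<le> s * b ^ n * (2 * (real k * \<epsilon>))" using grow[OF h elim(2)] by simp
      then have "2 ^ k * norm ?h \<le> 2 ^ k * (s * b ^ n * (2 * (real k * \<epsilon>)))" by (rule mult_left_mono) simp
      with coordinate_le_norm_sum[OF coordinates_Hs j, of t x]
      have "\<bar>t j\<bar> \<le> 2 ^ k * (s * b ^ n * (2 * (real k * \<epsilon>)))" by (rule order_trans)
      then have "\<bar>t j\<bar> \<le> a * b ^ n * \<epsilon>" by (simp add: a_def mult_ac)
      moreover have "0 < a * b ^ n" using a b by simp
      ultimately show "1 / (a * b ^ n) * \<bar>t j\<bar> \<le> \<epsilon>" by (simp add: divide_le_eq mult_ac)
    qed
  qed
  \<comment> \<open>The cap at \<open>1\<close> is used later, when a power of \<open>\<eta>\<close>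
    is bounded by \<open>\<eta>\<close> itself.\<close>
  define \<eta> where "\<eta> = min 1 (1 / (a ^ k * fact k))"
  define \<delta> where "\<delta> = 1 / b ^ k"
  have "\<forall>\<^sub>F n in sequentially. \<eta> * \<delta> ^ n \<le> dU x n"
    using ev
  proof eventually_elim
    case (elim n)
    have "\<eta> * \<delta> ^ n \<le> 1 / (a ^ k * fact k) * \<delta> ^ n" using b by (intro mult_right_mono) (auto simp: \<eta>_def \<delta>_def)
    also have "\<dots> = (1 / (a * b ^ n)) ^ k / fact k"
      by (simp add: \<delta>_def power_divide power_mult_distrib power_mult[symmetric] mult_ac)
    finally show ?case using elim by simp
  qed
  moreover have "0 < \<eta>" "\<eta> \<le> 1" "0 < \<delta>" using a b by (simp_all add: \<eta>_def \<delta>_def)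
  ultimately show ?thesis using that by blast
qed

text \<open>The idea: with \<open>y = T ^^ n x\<close>, let \<open>\<psi>\<close> be the projection onto \<open>Hs y\<close> along the kernel of
  \<open>pE \<circ> A y n\<close>, and \<open>\<Theta>\<close> the matrix of \<open>\<psi>\<close> on the frame \<open>r\<close> of \<open>A x n ` Hs x\<close>. Then
  \<open>U x (2 * n) = U y n * \<Theta> * U x n\<close>. Since \<open>\<psi>\<close> is small on slow subspaces, a common vector of
  \<open>Es y\<close> and \<open>Fs y\<close> makes \<open>\<Theta>\<close> nearly singular.\<close>

lemma det_U_doubling:
  obtains C where "0 < C"
    "\<forall>\<^sub>F n in sequentially. \<forall>x v. v \<in> Es ((T ^^ n) x) \<longrightarrow> v \<in> Fs ((T ^^ n) x) \<longrightarrow> v \<noteq> 0 \<longrightarrow>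
      dU x (n + n) \<le> C * \<tau> ^ n * (dU x n * dU ((T ^^ n) x) n)"
proof -
  obtain D where D: "0 < D"
    "\<forall>\<^sub>F n in sequentially. \<forall>x. \<exists>r. (\<forall>j<k. norm (r j - EB ((T ^^ n) x) j) \<le> D * \<tau> ^ n) \<and>
      (\<forall>h\<in>Hs x. ap x n h = (\<Sum>i<k. EL ((T ^^ n) x) i (ap x n h) *\<^sub>R r i))"
    by (rule frame_exists)
  obtain D' where D': "0 < D'"
    "\<forall>\<^sub>F n in sequentially. \<forall>x. \<forall>h\<in>Hs x. norm (ap x n h - pE ((T ^^ n) x) (ap x n h)) \<le> D' * \<tau> ^ n * norm (ap x n h)"
    "\<forall>\<^sub>F n in sequentially. \<forall>x. \<forall>h\<in>Hs x. norm (ap x n h) \<le> 2 * norm (pE ((T ^^ n) x) (ap x n h))"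
    by (rule pE_near)
  obtain C1 where C1: "0 < C1"
    "\<forall>\<^sub>F n in sequentially. \<forall>x G. slow x n G \<longrightarrow> near (C1 * \<tau> ^ n) G (Fs x) \<and> near (C1 * \<tau> ^ n) (Fs x) G"
    by (rule Fs_near)
  \<comment> \<open>Up to powers of \<open>\<tau>\<close>, \<open>C2\<close> bounds
    \<open>\<psi>\<close> on slow spaces, \<open>B\<close> bounds it everywhere, \<open>C3\<close>
    bounds its value at the nearly common vector, and \<open>b\<close> bounds the entries of
    \<open>\<Theta>\<close>.\<close>
  define C2 where "C2 = 8 * P * Q * L"
  define B where "B = 1 + 4 * P"
  define C3 where "C3 = 2 * C2 + B * (Q * D + C1)"
  define b where "b = 2 ^ k * (B * 2)"
  define C where "C = real k * (fact k * b ^ (k - 1) * (2 ^ k * C3))"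
  have pos: "0 < C2" "0 < B" "0 < C3" "0 < b"
    using P Q L D C1 by (simp_all add: C2_def B_def C3_def b_def add_pos_pos)
  then have C: "0 < C" using k1 by (simp add: C_def)
  have "\<forall>\<^sub>F n in sequentially. \<forall>x v. v \<in> Es ((T ^^ n) x) \<longrightarrow> v \<in> Fs ((T ^^ n) x) \<longrightarrow> v \<noteq> 0 \<longrightarrow>
      dU x (n + n) \<le> C * \<tau> ^ n * (dU x n * dU ((T ^^ n) x) n)"
    using D(2) D'(3) C1(2) transversal_expands[OF P] eventually_ge_at_top[of 1]
      geometric_eventually_le_one[OF \<tau>, of D] geometric_eventually_le_one[OF \<tau>, of C1]
      geometric_eventually_le_one[OF \<tau>, of C2]
  proof eventually_elim
    case (elim n)
    show ?case
    proof (intro allI impI)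
      fix x v0
      define y where "y = (T ^^ n) x"
      assume v0: "v0 \<in> Es ((T ^^ n) x)" "v0 \<in> Fs ((T ^^ n) x)" "v0 \<noteq> 0"
      obtain r where r: "\<And>j. j < k \<Longrightarrow> norm (r j - EB y j) \<le> D * \<tau> ^ n"
        "\<And>h. h \<in> Hs x \<Longrightarrow> ap x n h = (\<Sum>i<k. EL y i (ap x n h) *\<^sub>R r i)"
        using elim(1)[rule_format, of x] unfolding y_def by blast
      have nr: "norm (r j) \<le> 2" if "j < k" for j
        using norm_triangle_ineq[of "EB y j" "r j - EB y j"] r(1)[OF that] elim(6)
          coordinatesD(2)[OF coordinates_Es[of y] that] by simp
      define G where "G = Fn y n"
      have G: "slow y n G" unfolding G_def using slow_Fn(1) elim(5) by blast
      have tr: "complementary (Hs y) G" "angle_bound (2 * P) (Hs y) G"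
        and ex: "\<And>w. w \<in> Hs y \<Longrightarrow> c y n * norm w \<le> 4 * P * norm (ap y n w)"
        using elim(4)[rule_format, OF Hs(1) Hs(2) Hs(3), of y] G by blast+
      define f where "f v = pE ((T ^^ n) y) (ap y n v)" for v
      have linf: "linear f" unfolding f_def using linear_compose[OF linear_A[of y n] pE(1)] by (simp add: o_def)
      have nd: "norm (ap y n w) \<le> 2 * norm (f w)" if "w \<in> Hs y" for w
        using elim(2) that unfolding f_def by blast
      have imf: "f ` Hs y = Es ((T ^^ n) y)" unfolding f_def by (rule pE_An_image) (use elim(2) in blast)
      define Z where "Z = f -` {0}"
      have sZ: "subspace Z" unfolding Z_def by (rule linear_subspace_vimage[OF linf subspace_single_0])
      have cZ: "complementary (Hs y) Z"
        unfolding complementary_def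
      proof (intro conjI allI)
        show "Hs y \<inter> Z = {0}"
        proof (intro equalityI subsetI)
          fix w assume "w \<in> Hs y \<inter> Z"
          then have "norm (ap y n w) \<le> 0" using nd unfolding Z_def by force
          then show "w \<in> {0}" using A_eq_0 by simp
        next
          fix w assume "w \<in> {0::'v}"
          then show "w \<in> Hs y \<inter> Z" using subspace_0[OF subspace_Hs] subspace_0[OF sZ] by blast
        qed
        fix v
        have "f v \<in> Es ((T ^^ n) y)" unfolding f_def by (rule pE(2))
        then obtain w where w: "w \<in> Hs y" "f w = f v" using imf by force
        then have "v - w \<in> Z" unfolding Z_def by (simp add: linear_diff[OF linf])
        moreover have "v = w + (v - w)" by simp
        ultimately show "\<exists>e\<in>Hs y. \<exists>z\<in>Z. v = e + z" using w(1) by blast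
      qed (use subspace_Hs sZ in blast)+
      obtain \<psi> where \<psi>: "linear \<psi>" "\<And>v. \<psi> v \<in> Hs y" "\<And>v. v - \<psi> v \<in> Z"
        "\<And>v. v \<in> Z \<Longrightarrow> \<psi> v = 0" "\<And>w. w \<in> Hs y \<Longrightarrow> \<psi> w = w"
        using complementary_projection[OF cZ] by blast
      have f\<psi>: "f (\<psi> v) = f v" for v using \<psi>(3)[of v] unfolding Z_def by (simp add: linear_diff[OF linf])
      \<comment> \<open>\<open>\<psi> g\<close> and \<open>g\<close> have the same image under
        \<open>f\<close>, but \<open>\<psi> g\<close> lies in the expanding space
        \<open>Hs y\<close> whereas \<open>g\<close> grows slowly relative to
        \<open>c y n\<close>.\<close>
      have \<psi>G: "norm (\<psi> g) \<le> C2 * \<tau> ^ n * norm g" if g: "g \<in> G" for g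
      proof -
        have "c y n * norm (\<psi> g) \<le> 4 * P * norm (ap y n (\<psi> g))" by (rule ex[OF \<psi>(2)])
        also have "\<dots> \<le> 4 * P * (2 * norm (f g))" using nd[OF \<psi>(2), of g] P by (intro mult_left_mono) (auto simp: f\<psi>)
        also have "\<dots> \<le> 4 * P * (2 * (Q * norm (ap y n g)))"
          unfolding f_def using pE(3) P by (intro mult_left_mono) auto
        also have "\<dots> \<le> 4 * P * (2 * (Q * (L * \<tau> ^ n * c y n * norm g)))"
          using slowD(4)[OF G g] P Q by (intro mult_left_mono) auto
        also have "\<dots> = c y n * (C2 * \<tau> ^ n * norm g)" by (simp add: C2_def)
        finally show ?thesis using c_pos[OF elim(5), of y] by simp
      qed
      have \<psi>n: "norm (\<psi> v) \<le> B * norm v" for v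
      proof -
        obtain h g where hg: "h \<in> Hs y" "g \<in> G" "v = h + g" using complementaryD(4)[OF tr(1)] by blast
        have "\<psi> v = h + \<psi> g" using hg \<psi>(5) linear_add[OF \<psi>(1)] by simp
        then have "norm (\<psi> v) \<le> norm h + norm (\<psi> g)" using norm_triangle_ineq[of h "\<psi> g"] by simp
        moreover have "norm (\<psi> g) \<le> 1 * norm g"
          using order_trans[OF \<psi>G[OF hg(2)] mult_right_mono[OF elim(8) norm_ge_zero]] .
        moreover have "norm h \<le> 2 * P * norm v" using angle_boundD[OF tr(2) hg(1,2)] hg(3) by simp
        moreover have "norm g \<le> (1 + 2 * P) * norm v" using angle_bound_snd[OF tr(2) hg(1,2)] hg(3) by simp
        ultimately show ?thesis by (simp add: B_def algebra_simps)
      qed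
      define \<Theta> where "\<Theta> = Matrix.mat k k (\<lambda>(i, j). HL y i (\<psi> (r j)))"
      have \<Theta>: "\<Theta> \<in> carrier_mat k k" unfolding \<Theta>_def by simp
      have \<Theta>i: "\<Theta> $$ (i, j) = HL y i (\<psi> (r j))" if "i < k" "j < k" for i j unfolding \<Theta>_def using that by simp
      have \<Theta>s: "(\<Sum>j<k. \<Theta> $$ (i, j) * t j) = HL y i (\<psi> (\<Sum>j<k. t j *\<^sub>R r j))" if i: "i < k" for i t
      proof -
        note l = coordinatesD(3)[OF coordinates_Hs[of y] i]
        have "HL y i (\<psi> (\<Sum>j<k. t j *\<^sub>R r j)) = (\<Sum>j<k. t j * HL y i (\<psi> (r j)))"
          by (simp add: linear_sum[OF \<psi>(1)] linear_scale[OF \<psi>(1)] linear_sum[OF l] linear_scale[OF l])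
        then show ?thesis using i by (simp add: \<Theta>i mult.commute)
      qed
      \<comment> \<open>Inserting \<open>\<psi>\<close> at half time does not change the outcome,
        because what it removes lies in the kernel \<open>Z\<close> of \<open>f\<close>.\<close>
      have "U x (n + n) = U y n * (\<Theta> * U x n)"
      proof (rule eq_matI)
        fix i j assume "i < dim_row (U y n * (\<Theta> * U x n))" "j < dim_col (U y n * (\<Theta> * U x n))"
        then have ij: "i < k" "j < k" using U_carrier[of y n] U_carrier[of x n] by auto
        let ?z = "ap x n (HB x j)"
        have zH: "HB x j \<in> Hs x" using coordinatesD(1)[OF coordinates_Hs ij(2)] .
        have z: "?z = (\<Sum>p<k. U x n $$ (p, j) *\<^sub>R r p)" using r(2)[OF zH] ij by (simp add: U_index y_def)
        have "f (?z - \<psi> ?z) = 0" using \<psi>(3) unfolding Z_def by blast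
        then have "EL ((T ^^ n) y) i (ap y n (?z - \<psi> ?z)) = 0" using pE(5) ij(1) unfolding f_def by blast
        then have 1: "EL ((T ^^ n) y) i (ap y n ?z) = EL ((T ^^ n) y) i (ap y n (\<psi> ?z))"
          by (simp add: blinfun.diff_right linear_diff[OF linear_EL[OF ij(1)]])
        have 2: "(\<Theta> * U x n) $$ (q, j) = HL y q (\<psi> ?z)" if "q < k" for q
          unfolding mat_mult_index[OF \<Theta> U_carrier that ij(2)] \<Theta>s[OF that] z ..
        have "U x (n + n) $$ (i, j) = EL ((T ^^ n) y) i (ap y n ?z)"
          using ij by (simp add: U_index A_add funpow_add y_def)
        also have "\<dots> = EL ((T ^^ n) y) i (ap y n (\<Sum>q<k. HL y q (\<psi> ?z) *\<^sub>R HB y q))"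
          using 1 coordinatesD(6)[OF coordinates_Hs \<psi>(2)] by simp
        also have "\<dots> = (\<Sum>q<k. U y n $$ (i, q) * HL y q (\<psi> ?z))" by (rule sum_U[OF ij(1), symmetric])
        also have "\<dots> = (U y n * (\<Theta> * U x n)) $$ (i, j)"
          using mat_mult_index[OF U_carrier mult_carrier_mat[OF \<Theta> U_carrier] ij] 2 by simp
        finally show "U x (n + n) $$ (i, j) = (U y n * (\<Theta> * U x n)) $$ (i, j)" .
      qed (use U_carrier[of y n] U_carrier[of x n] U_carrier[of x "n + n"] in auto)
      then have det: "Determinant.det (U x (n + n)) = Determinant.det (U y n) * (Determinant.det \<Theta> * Determinant.det (U x n))"
        using det_mult[OF U_carrier mult_carrier_mat[OF \<Theta> U_carrier]] det_mult[OF \<Theta> U_carrier] by simp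
      define v where "v = (1 / norm v0) *\<^sub>R v0"
      have v: "v \<in> Es y" "v \<in> Fs y" "norm v = 1"
        using v0 subspace_scale[OF subspace_Es] subspace_scale[OF subspace_Fs] by (simp_all add: v_def y_def)
      define t where "t j = EL y j v" for j
      have tv: "(\<Sum>j<k. t j *\<^sub>R EB y j) = v" unfolding t_def by (rule coordinatesD(6)[OF coordinates_Es v(1)])
      \<comment> \<open>The frame vector with the same coordinates as \<open>v\<close>: it is close
        to \<open>v\<close>, and \<open>v\<close> in \<open>Fs y\<close> is close to the slow space
        \<open>G\<close>, where \<open>\<psi>\<close> is small.\<close>
      let ?\<rho> = "\<Sum>j<k. t j *\<^sub>R r j"
      have "?\<rho> - v = (\<Sum>j<k. t j *\<^sub>R (r j - EB y j))"
        unfolding tv[symmetric] by (simp add: sum_subtractf scaleR_diff_right)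
      also have "norm \<dots> \<le> (\<Sum>j<k. norm (t j *\<^sub>R (r j - EB y j)))" by (rule norm_sum)
      also have "\<dots> \<le> (\<Sum>j<k. 2 ^ k * (D * \<tau> ^ n))"
      proof (rule sum_mono)
        fix j assume "j \<in> {..<k}"
        then have j: "j < k" by simp
        have "\<bar>t j\<bar> \<le> 2 ^ k" using coordinatesD(4)[OF coordinates_Es[of y] j, of v] v(3) by (simp add: t_def)
        then show "norm (t j *\<^sub>R (r j - EB y j)) \<le> 2 ^ k * (D * \<tau> ^ n)"
          unfolding norm_scaleR using r(1)[OF j] by (intro mult_mono) auto
      qed
      finally have \<rho>1: "norm (?\<rho> - v) \<le> Q * D * \<tau> ^ n" by (simp add: Q_def mult_ac)
      obtain g where g: "g \<in> G" "norm (v - g) \<le> C1 * \<tau> ^ n * norm v"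
        using elim(3)[rule_format, OF G] v(2) nearE[of "C1 * \<tau> ^ n" "Fs y" G v] by blast
      have ng: "norm g \<le> 2" using norm_triangle_ineq4[of v "v - g"] g(2) v(3) elim(7) by simp
      have "norm (?\<rho> - g) \<le> (Q * D + C1) * \<tau> ^ n"
        using norm_triangle_ineq[of "?\<rho> - v" "v - g"] \<rho>1 g(2) v(3) by (simp add: algebra_simps)
      then have "B * norm (?\<rho> - g) \<le> B * ((Q * D + C1) * \<tau> ^ n)" using pos by (intro mult_left_mono) auto
      then have a1: "norm (\<psi> (?\<rho> - g)) \<le> B * (Q * D + C1) * \<tau> ^ n" using \<psi>n[of "?\<rho> - g"] by (simp add: mult.assoc)
      have "C2 * \<tau> ^ n * norm g \<le> C2 * \<tau> ^ n * 2" using ng pos \<tau> by (intro mult_left_mono) auto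
      then have a2: "norm (\<psi> g) \<le> 2 * C2 * \<tau> ^ n" using \<psi>G[OF g(1)] by simp
      have "\<psi> ?\<rho> = \<psi> g + \<psi> (?\<rho> - g)" by (simp add: linear_diff[OF \<psi>(1)])
      then have \<psi>\<rho>: "norm (\<psi> ?\<rho>) \<le> C3 * \<tau> ^ n"
        using norm_triangle_ineq[of "\<psi> g" "\<psi> (?\<rho> - g)"] a1 a2 by (simp add: C3_def algebra_simps)
      have small: "\<bar>\<Sum>j<k. \<Theta> $$ (i, j) * t j\<bar> \<le> 2 ^ k * (C3 * \<tau> ^ n)" if "i < k" for i
        unfolding \<Theta>s[OF that]
        using order_trans[OF coordinatesD(4)[OF coordinates_Hs that] mult_left_mono[OF \<psi>\<rho>]] by simp
      have entries: "\<bar>\<Theta> $$ (i, j)\<bar> \<le> b" if "i < k" "j < k" for i j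
      proof -
        have "\<bar>\<Theta> $$ (i, j)\<bar> \<le> 2 ^ k * norm (\<psi> (r j))"
          unfolding \<Theta>i[OF that] by (rule coordinatesD(4)[OF coordinates_Hs that(1)])
        also have "\<dots> \<le> 2 ^ k * (B * 2)"
          using order_trans[OF \<psi>n mult_left_mono[OF nr[OF that(2)]]] pos by (intro mult_left_mono) auto
        finally show ?thesis by (simp add: b_def)
      qed
      \<comment> \<open>In a basis of unit vectors a unit vector has some coordinate of size at
        least \<open>1 / k\<close>; dividing by it isolates the determinant of
        \<open>\<Theta>\<close>.\<close>
      have "\<exists>j<k. 1 \<le> real k * \<bar>t j\<bar>"
      proof (rule ccontr)
        assume a: "\<not> (\<exists>j<k. 1 \<le> real k * \<bar>t j\<bar>)"
        have "1 \<le> (\<Sum>j<k. norm (t j *\<^sub>R EB y j))" using norm_sum[of "\<lambda>j. t j *\<^sub>R EB y j" "{..<k}"] tv v(3) by simp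
        also have "\<dots> = (\<Sum>j<k. \<bar>t j\<bar>)" using coordinatesD(2)[OF coordinates_Es[of y]] by (intro sum.cong) auto
        finally have "real k * 1 \<le> real k * (\<Sum>j<k. \<bar>t j\<bar>)" by (intro mult_left_mono) auto
        also have "\<dots> = (\<Sum>j<k. real k * \<bar>t j\<bar>)" by (simp add: sum_distrib_left)
        also have "\<dots> < (\<Sum>j<k. 1)"
          using a k1 by (intro sum_strict_mono) (auto simp: not_le lessThan_empty_iff)
        finally show False by simp
      qed
      then obtain j where j: "j < k" "1 \<le> real k * \<bar>t j\<bar>" by blast
      have "\<bar>Determinant.det \<Theta>\<bar> * 1 \<le> \<bar>Determinant.det \<Theta>\<bar> * (real k * \<bar>t j\<bar>)"
        using j(2) by (rule mult_left_mono) simp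
      also have "\<dots> = real k * (\<bar>Determinant.det \<Theta>\<bar> * \<bar>t j\<bar>)" by simp
      also have "\<dots> \<le> real k * (fact k * b ^ (k - 1) * (2 ^ k * (C3 * \<tau> ^ n)))"
        by (intro mult_left_mono abs_det_le_if_small_image[OF \<Theta> entries small j(1)]) auto
      also have "\<dots> = C * \<tau> ^ n" by (simp add: C_def)
      finally have "\<bar>Determinant.det \<Theta>\<bar> \<le> C * \<tau> ^ n" by simp
      then have "\<bar>Determinant.det \<Theta>\<bar> * (dU x n * dU y n)
        \<le> C * \<tau> ^ n * (dU x n * dU y n)"
        by (rule mult_right_mono) simp
      then show "dU x (n + n) \<le> C * \<tau> ^ n * (dU x n * dU ((T ^^ n) x) n)"
        unfolding det y_def[symmetric] by (simp add: abs_mult mult_ac)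
    qed
  qed
  then show ?thesis using that C by blast
qed

lemma norm_An: "norm (ap x n v) \<le> M ^ n * norm v"
proof (induction n)
  case (Suc n)
  have "norm (ap x (Suc n) v) \<le> M * norm (ap x n v)" using norm_A1[of "(T ^^ n) x" "ap x n v"] A_Suc[of x n v] by simp
  also have "\<dots> \<le> M * (M ^ n * norm v)" using Suc M by (intro mult_left_mono) auto
  finally show ?case by simp
qed (simp add: A_0)

lemma det_U_le: "dU x n \<le> fact k * (2 ^ k * M ^ n) ^ k"
proof (rule abs_det_le[OF U_carrier])
  fix i j assume ij: "i < k" "j < k"
  have "\<bar>U x n $$ (i, j)\<bar> \<le> 2 ^ k * norm (ap x n (HB x j))"
    unfolding U_index[OF ij] by (rule coordinatesD(4)[OF coordinates_Es ij(1)])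
  also have "\<dots> \<le> 2 ^ k * (M ^ n * norm (HB x j))" using norm_An by (intro mult_left_mono) auto
  finally show "\<bar>U x n $$ (i, j)\<bar> \<le> 2 ^ k * M ^ n" using coordinatesD(2)[OF coordinates_Hs ij(2)] by simp
qed

text \<open>A common vector of \<open>Es\<close> and \<open>Fs\<close> persists along the forward orbit. By the doubling estimate
  the determinants would then decay faster than any exponential.\<close>

lemma Es_Fs_trivial:
  assumes "v \<in> Es x" "v \<in> Fs x"
  shows "v = 0"
proof (rule ccontr)
  assume "v \<noteq> 0"
  define bad where "bad y \<longleftrightarrow> (\<exists>v. v \<in> Es y \<and> v \<in> Fs y \<and> v \<noteq> 0)" for y
  have bad_x: "bad x" unfolding bad_def using assms \<open>v \<noteq> 0\<close> by blast
  have bad_T: "bad ((T ^^ n) y)" if bad: "bad y" for y n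
  proof -
    obtain w where w: "w \<in> Es y" "w \<in> Fs y" "w \<noteq> 0" using bad unfolding bad_def by blast
    have "ap y n w \<in> Es ((T ^^ n) y)" using Es_equivariant_funpow[of y n] w(1) by blast
    moreover have "ap y n w \<in> Fs ((T ^^ n) y)" using Fs_equivariant_funpow[OF w(2)] .
    moreover have "ap y n w \<noteq> 0" using A_eq_0 w(3) by blast
    ultimately show ?thesis unfolding bad_def by blast
  qed
  obtain C where C: "0 < C"
    "\<forall>\<^sub>F n in sequentially. \<forall>x v. v \<in> Es ((T ^^ n) x) \<longrightarrow> v \<in> Fs ((T ^^ n) x) \<longrightarrow> v \<noteq> 0 \<longrightarrow>
      dU x (n + n) \<le> C * \<tau> ^ n * (dU x n * dU ((T ^^ n) x) n)"
    by (rule det_U_doubling)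
  \<comment> \<open>\<open>\<sigma> ^ 2\<close> lies strictly between \<open>\<tau>\<close> and
    \<open>1\<close>, so that \<open>\<sigma> ^ (2 * n)\<close> eventually absorbs
    \<open>C * \<tau> ^ n\<close>.\<close>
  define \<sigma> where "\<sigma> = sqrt ((1 + \<tau>) / 2)"
  have \<sigma>: "0 < \<sigma>" "\<sigma> < 1" "\<sigma> ^ 2 = (1 + \<tau>) / 2" using \<tau> by (simp_all add: \<sigma>_def)
  have \<tau>\<sigma>: "0 < \<tau> / \<sigma> ^ 2" "\<tau> / \<sigma> ^ 2 < 1" using \<tau> \<sigma> by (simp_all add: divide_less_eq)
  obtain N where N: "1 \<le> N" "\<And>n y. n \<ge> N \<Longrightarrow> bad y \<Longrightarrow>
      dU y (n + n) \<le> \<sigma> ^ (2 * n) * (dU y n * dU ((T ^^ n) y) n)"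
  proof -
    have "\<forall>\<^sub>F n in sequentially. \<forall>y. bad y \<longrightarrow>
      dU y (n + n) \<le> \<sigma> ^ (2 * n) * (dU y n * dU ((T ^^ n) y) n)"
      using C(2) geometric_eventually_le_one[OF \<tau>\<sigma>, of C]
    proof eventually_elim
      case (elim n)
      show ?case
      proof (intro allI impI)
        fix y assume "bad y"
        then obtain w where w: "w \<in> Es ((T ^^ n) y)" "w \<in> Fs ((T ^^ n) y)" "w \<noteq> 0"
          using bad_T[of y n] unfolding bad_def by blast
        have "C * (\<tau> / \<sigma> ^ 2) ^ n * (\<sigma> ^ 2) ^ n \<le> 1 * (\<sigma> ^ 2) ^ n"
          using elim(2) by (rule mult_right_mono) simp
        moreover have "(\<tau> / \<sigma> ^ 2) ^ n * (\<sigma> ^ 2) ^ n = \<tau> ^ n"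
          unfolding power_mult_distrib[symmetric] using \<sigma>(1) by simp
        ultimately have "C * \<tau> ^ n \<le> \<sigma> ^ (2 * n)" by (simp only: mult.assoc mult_1 power_mult)
        then have "C * \<tau> ^ n * (dU y n * dU ((T ^^ n) y) n)
          \<le> \<sigma> ^ (2 * n) * (dU y n * dU ((T ^^ n) y) n)"
          by (rule mult_right_mono) simp
        then show "dU y (n + n) \<le> \<sigma> ^ (2 * n) * (dU y n * dU ((T ^^ n) y) n)"
          using elim(1)[rule_format, OF w] by linarith
      qed
    qed
    then obtain N where "\<And>n y. n \<ge> N \<Longrightarrow> bad y \<Longrightarrow>
      dU y (n + n) \<le> \<sigma> ^ (2 * n) * (dU y n * dU ((T ^^ n) y) n)"
      unfolding eventually_sequentially by blast
    then show ?thesis using that[of "max 1 N"] by simp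
  qed
  define B where "B = max 1 (fact k * (2 ^ k * M ^ N) ^ k)"
  have B: "1 \<le> B" "fact k * (2 ^ k * M ^ N) ^ k \<le> B" by (simp_all add: B_def)
  \<comment> \<open>Each doubling gains \<open>\<sigma>\<close> to the power of the full new length,
    so the base shrinks by \<open>\<sigma>\<close> every time. The claim ranges over all bad points
    since the second half of the orbit starts at \<open>(T ^^ n) y\<close>.\<close>
  have upper: "dU y (2 ^ j * N) \<le> (B * \<sigma> ^ j) ^ (2 ^ j * N)" if "bad y" for j y
    using that
  proof (induction j arbitrary: y)
    case 0
    have "B ^ 1 \<le> B ^ N" using B(1) N(1) by (intro power_increasing) auto
    then show ?case using order_trans[OF det_U_le B(2), of y] by simp
  next
    case (Suc j)
    let ?n = "2 ^ j * N"
    let ?b = "(B * \<sigma> ^ j) ^ ?n"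
    have n: "N \<le> ?n" by simp
    have b0: "0 \<le> ?b" using B(1) \<sigma> by simp
    have e: "2 ^ Suc j * N = ?n + ?n" by simp
    have pw: "s ^ (2 * n) * (a ^ n * a ^ n) = (a * s) ^ (n + n)" for s a :: real and n :: nat
      unfolding mult_2 power_add power_mult_distrib by (simp only: mult_ac)
    have "dU y (?n + ?n) \<le> \<sigma> ^ (2 * ?n) * (dU y ?n * dU ((T ^^ ?n) y) ?n)"
      using N(2)[OF n Suc.prems] .
    also have "\<dots> \<le> \<sigma> ^ (2 * ?n) * (?b * ?b)"
      using Suc.IH[OF Suc.prems] Suc.IH[OF bad_T[OF Suc.prems, of ?n]] b0 \<sigma>
      by (intro mult_left_mono mult_mono) auto
    also have "\<dots> = (B * \<sigma> ^ j * \<sigma>) ^ (?n + ?n)"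
      by (rule pw)
    also have "B * \<sigma> ^ j * \<sigma> = B * \<sigma> ^ Suc j" by simp
    finally show ?case unfolding e .
  qed
  obtain \<eta> \<delta> where \<eta>: "0 < \<eta>" "\<eta> \<le> 1" "0 < \<delta>"
    "\<forall>\<^sub>F n in sequentially. \<eta> * \<delta> ^ n \<le> dU x n"
    by (rule det_U_lower)
  obtain N' where N': "\<And>n. n \<ge> N' \<Longrightarrow> \<eta> * \<delta> ^ n \<le> dU x n"
    using \<eta>(4) unfolding eventually_sequentially by blast
  \<comment> \<open>Once \<open>B * \<sigma> ^ j\<close> is below
    \<open>\<eta> * (\<delta> / 2)\<close>, the two bounds contradict each other at time
    \<open>2 ^ j * N\<close>.\<close>
  have "\<forall>\<^sub>F j in sequentially. False"
    using geometric_eventually_le[OF \<sigma>(1,2) mult_pos_pos[OF \<eta>(1) half_gt_zero[OF \<eta>(3)]], of B] eventually_ge_at_top[of N']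
  proof eventually_elim
    case (elim j)
    let ?n = "2 ^ j * N"
    have "j < 2 ^ j" by (rule less_exp)
    also have "2 ^ j * 1 \<le> 2 ^ j * N" using N(1) by (intro mult_left_mono) auto
    finally have n: "N' \<le> ?n" "1 \<le> ?n" using elim(2) N(1) by simp_all
    have "\<eta> * \<delta> ^ ?n \<le> (B * \<sigma> ^ j) ^ ?n" using N'[OF n(1)] upper[OF bad_x, of j] by linarith
    also have "\<dots> \<le> (\<eta> * (\<delta> / 2)) ^ ?n" using elim(1) B(1) \<sigma> by (intro power_mono) auto
    also have "\<dots> = \<eta> ^ ?n * (\<delta> ^ ?n * (1/2) ^ ?n)" by (simp add: power_mult_distrib power_divide)
    also have "\<dots> \<le> \<eta> * (\<delta> ^ ?n * (1/2))"
    proof (rule mult_mono)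
      have "\<eta> ^ ?n \<le> \<eta> ^ 1" using \<eta> n by (intro power_decreasing) auto
      then show "\<eta> ^ ?n \<le> \<eta>" by simp
      have "(1/2 :: real) ^ ?n \<le> (1/2) ^ 1" using n by (intro power_decreasing) auto
      then show "\<delta> ^ ?n * (1/2) ^ ?n \<le> \<delta> ^ ?n * (1/2)" using \<eta>(3) by (intro mult_left_mono) auto
    qed (use \<eta> in auto)
    finally have "\<eta> * \<delta> ^ ?n \<le> \<eta> * \<delta> ^ ?n / 2" by simp
    moreover have "0 < \<eta> * \<delta> ^ ?n" using \<eta> by simp
    ultimately show False by linarith
  qed
  then show False by simp
qed

subsection \<open>Domination\<close>

lemma complementary_Es_Fs: "complementary (Es x) (Fs x)"
  using complementary_if_trivial_inter[OF has_codim_Fs has_dim_Es] Es_Fs_trivial by blast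

text \<open>A vector \<open>f\<close> of \<open>Fs x\<close> is merely near the slow space, and its
  component \<open>h\<close> in \<open>Es x\<close> may grow fast. Equivariance disposes of it:
  \<open>ap x n f\<close> stays in \<open>Fs\<close> and \<open>ap x n h\<close> in
  \<open>Es\<close>, so the angle bound estimates the former by their difference, the image of a
  slow vector.\<close>

lemma Es_Fs_dominated:
  obtains K' where "0 < K'"
    "\<And>x n e f. e \<in> Es x \<Longrightarrow> f \<in> Fs x \<Longrightarrow> norm (ap x n f) * norm e \<le> K' * \<tau> ^ n * (norm (ap x n e) * norm f)"
proof -
  obtain R where R: "1 \<le> R" "\<And>x. angle_bound R (Es x) (Fs x)"
    using uniform_angle[OF continuous_Es has_dim_Es continuous_Fs complementary_Es_Fs] by blast
  obtain q where q: "0 < q" "\<And>x e. e \<in> Es x \<Longrightarrow> norm e \<le> q * norm (ap x 1 e)"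
    using uniform_expansion[OF continuous_Es has_dim_Es] by blast
  define D where "D = (1 + R) * (1 + 2 * R) * L * (4 * R)"
  have D: "0 < D" using R L by (simp add: D_def)
  have "\<forall>\<^sub>F n in sequentially. \<forall>x. \<forall>e\<in>Es x. \<forall>f\<in>Fs x.
      norm (ap x n f) * norm e \<le> D * \<tau> ^ n * (norm (ap x n e) * norm f)"
    using transversal_expands[OF R(1)] eventually_ge_at_top[of 1]
  proof eventually_elim
    case (elim n)
    show ?case
    proof (intro allI ballI)
      fix x e f assume e: "e \<in> Es x" and f: "f \<in> Fs x"
      define G where "G = Fn x n"
      have G: "slow x n G" unfolding G_def using slow_Fn(1) elim(2) by blast
      have tr: "complementary (Es x) G" "angle_bound (2 * R) (Es x) G"
        and ex: "c x n * norm e \<le> 4 * R * norm (ap x n e)"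
        using elim(1)[rule_format, OF has_dim_Es complementary_Es_Fs R(2), of x] G e by blast+
      obtain h g where hg: "h \<in> Es x" "g \<in> G" "f = h + g" using complementaryD(4)[OF tr(1)] by blast
      have ng: "norm g \<le> (1 + 2 * R) * norm f" using angle_bound_snd[OF tr(2) hg(1,2)] hg(3) by simp
      have "- ap x n h \<in> Es ((T ^^ n) x)"
        using Es_equivariant_funpow[of x n] hg(1) by (intro subspace_neg[OF subspace_Es]) blast
      from angle_bound_snd[OF R(2) this Fs_equivariant_funpow[OF f]]
      have "norm (ap x n f) \<le> (1 + R) * norm (ap x n g)" by (simp add: hg(3) blinfun.add_right)
      also have "\<dots> \<le> (1 + R) * (L * \<tau> ^ n * c x n * norm g)"
        using slowD(4)[OF G hg(2)] R by (intro mult_left_mono) auto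
      also have "\<dots> \<le> (1 + R) * (L * \<tau> ^ n * c x n * ((1 + 2 * R) * norm f))"
        using ng R L \<tau> c_nonneg by (intro mult_left_mono) auto
      finally have "norm (ap x n f) * norm e \<le> (1 + R) * (L * \<tau> ^ n * c x n * ((1 + 2 * R) * norm f)) * norm e"
        by (rule mult_right_mono) simp
      also have "\<dots> = (1 + R) * (1 + 2 * R) * L * \<tau> ^ n * norm f * (c x n * norm e)" by simp
      also have "\<dots> \<le> (1 + R) * (1 + 2 * R) * L * \<tau> ^ n * norm f * (4 * R * norm (ap x n e))"
        using ex R L \<tau> by (intro mult_left_mono) auto
      also have "\<dots> = D * \<tau> ^ n * (norm (ap x n e) * norm f)" by (simp add: D_def)
      finally show "norm (ap x n f) * norm e \<le> D * \<tau> ^ n * (norm (ap x n e) * norm f)" .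
    qed
  qed
  then obtain N where N: "\<And>n x e f. n \<ge> N \<Longrightarrow> e \<in> Es x \<Longrightarrow> f \<in> Fs x \<Longrightarrow>
      norm (ap x n f) * norm e \<le> D * \<tau> ^ n * (norm (ap x n e) * norm f)"
    unfolding eventually_sequentially by blast
  \<comment> \<open>The finitely many times below \<open>N\<close> are covered by crude exponential
    bounds; \<open>1 \<le> b\<close> lets \<open>b ^ N\<close> dominate every smaller power.\<close>
  define b where "b = max 1 (M * q / \<tau>)"
  have b: "1 \<le> b" "M * q / \<tau> \<le> b" by (simp_all add: b_def)
  define K' where "K' = max D (b ^ N)"
  have K': "D \<le> K'" "b ^ N \<le> K'" by (simp_all add: K'_def)
  have "norm (ap x n f) * norm e \<le> K' * \<tau> ^ n * (norm (ap x n e) * norm f)" if ef: "e \<in> Es x" "f \<in> Fs x" for x n e f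
  proof (cases "n \<ge> N")
    case True
    have "D * \<tau> ^ n * (norm (ap x n e) * norm f) \<le> K' * \<tau> ^ n * (norm (ap x n e) * norm f)"
      using K'(1) \<tau> by (intro mult_right_mono) auto
    then show ?thesis using N[OF True ef] by linarith
  next
    case False
    have "norm e \<le> q ^ n * norm (ap x n e)" using expansion_funpow(2)[of Es q e x n] Es_equivariant q ef(1) by blast
    then have "norm (ap x n f) * norm e \<le> (M ^ n * norm f) * (q ^ n * norm (ap x n e))"
      using norm_An M by (intro mult_mono) auto
    also have "\<dots> = (M * q / \<tau>) ^ n * \<tau> ^ n * (norm (ap x n e) * norm f)"
      using \<tau>(1) by (simp add: power_divide power_mult_distrib)
    also have "\<dots> \<le> K' * \<tau> ^ n * (norm (ap x n e) * norm f)"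
    proof (intro mult_right_mono)
      have "(M * q / \<tau>) ^ n \<le> b ^ n" using b M q(1) \<tau> by (intro power_mono) auto
      also have "\<dots> \<le> b ^ N" using b False by (intro power_increasing) auto
      finally show "(M * q / \<tau>) ^ n \<le> K'" using K'(2) by linarith
    qed (use \<tau> in auto)
    finally show ?thesis .
  qed
  moreover have "0 < K'" using D K'(1) by linarith
  ultimately show ?thesis using that by blast
qed

lemma splitting_exists:
  "\<exists>E F. continuous_equivariant_splitting T A E F \<and> (\<forall>x. edim (E x) = enat k) \<and>
    (\<exists>K \<tau> :: real. K > 0 \<and> 0 < \<tau> \<and> \<tau> < 1 \<and>
      (\<forall>x. \<forall>n\<ge>1. (SUP (u, v) \<in> unit_sphere (E x) \<times> unit_sphere (F x).
          ennreal (norm (ap x n v) / norm (ap x n u))) \<le> ennreal (K * \<tau> ^ n)))"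
proof -
  obtain K' where K': "0 < K'"
    "\<And>x n e f. e \<in> Es x \<Longrightarrow> f \<in> Fs x \<Longrightarrow> norm (ap x n f) * norm e \<le> K' * \<tau> ^ n * (norm (ap x n e) * norm f)"
    using Es_Fs_dominated by blast
  have "(SUP (u, v) \<in> unit_sphere (Es x) \<times> unit_sphere (Fs x). ennreal (norm (ap x n v) / norm (ap x n u)))
      \<le> ennreal (K' * \<tau> ^ n)" for x n
    using ratio_bound_iff[OF subspace_Es subspace_Fs, of "K' * \<tau> ^ n" x n x] K' \<tau> by simp
  then have "\<exists>K \<tau> :: real. K > 0 \<and> 0 < \<tau> \<and> \<tau> < 1 \<and>
      (\<forall>x. \<forall>n\<ge>1. (SUP (u, v) \<in> unit_sphere (Es x) \<times> unit_sphere (Fs x).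
          ennreal (norm (ap x n v) / norm (ap x n u))) \<le> ennreal (K * \<tau> ^ n))"
    using K'(1) \<tau> by blast
  moreover have "continuous_equivariant_splitting T A Es Fs"
    unfolding continuous_equivariant_splitting_def
    using continuous_Es continuous_Fs complementary_Es_Fs Es_equivariant_funpow Fs_equivariant_funpow by blast
  moreover have "\<forall>x. edim (Es x) = enat k" using has_dim_Es edim_eq_iff_has_dim[OF subspace_Es] by blast
  ultimately show ?thesis by blast
qed

end

theorem theorem2:
  fixes T :: "'x::topological_space \<Rightarrow> 'x"
    and A :: "'x \<Rightarrow> nat \<Rightarrow> 'v::banach \<Rightarrow>\<^sub>L 'v"
    and k :: nat
  assumes "compact (UNIV :: 'x set)"
    and "\<exists>S. homeomorphism UNIV UNIV T S"
    and "k \<ge> 1" and "enat k \<le> edim (UNIV :: 'v set)"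
    and "continuous_cocycle T A"
    and "\<forall>x n. inj (blinfun_apply (A x n))"
  shows "(\<exists>K \<tau> :: real. K > 0 \<and> 0 < \<tau> \<and> \<tau> < 1 \<and>
            (\<forall>x. \<forall>n\<ge>1.
               max (gelfand_number (k + 1) (A x n)) (gelfand_number (k + 1) (A (T x) n))
                 < K * \<tau> ^ n * gelfand_number k (A x (n + 1))))
     \<longleftrightarrow>
         (\<exists>E F. continuous_equivariant_splitting T A E F \<and> (\<forall>x. edim (E x) = enat k) \<and>
            (\<exists>K \<tau> :: real. K > 0 \<and> 0 < \<tau> \<and> \<tau> < 1 \<and>
              (\<forall>x. \<forall>n\<ge>1.
                 (SUP (u, v) \<in> unit_sphere (E x) \<times> unit_sphere (F x).
                    ennreal (norm (blinfun_apply (A x n) v) / norm (blinfun_apply (A x n) u)))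
                   \<le> ennreal (K * \<tau> ^ n))))"
    (is "?gap \<longleftrightarrow> ?split")
proof
  interpret injective_cocycle T A k
    using assms by unfold_locales auto
  show ?split if gap: ?gap
  proof -
    obtain K \<tau> :: real where K: "0 < K" "0 < \<tau>" "\<tau> < 1"
      "\<And>x n. 1 \<le> n \<Longrightarrow> max (gelfand_number (k + 1) (A x n)) (gelfand_number (k + 1) (A (T x) n))
        < K * \<tau> ^ n * gelfand_number k (A x (n + 1))"
      using gap by blast
    obtain S where S: "homeomorphism UNIV UNIV T S" using assms(2) by blast
    obtain M where M: "1 \<le> M" "\<And>x. norm (A x 1) \<le> M" using A_bounded by blast
    interpret gapped_cocycle T A k S K \<tau> M
      using S K(1-3) M K(4) by unfold_locales simp_all
    show ?split by (rule splitting_exists)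
  qed
  show ?gap if split: ?split
  proof -
    obtain E F K \<tau> where "continuous_equivariant_splitting T A E F" "\<And>x. edim (E x) = enat k"
      "0 < (K :: real)" "0 < \<tau>" "\<tau> < 1"
      "\<And>x n. 1 \<le> n \<Longrightarrow> (SUP (u, v) \<in> unit_sphere (E x) \<times> unit_sphere (F x).
        ennreal (norm (ap x n v) / norm (ap x n u))) \<le> ennreal (K * \<tau> ^ n)"
      using split by blast
    then show ?gap by (rule gap_if_dominated)
  qed
qed

end
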